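(* Let $n\ge 3$. Then each of the outer automorphism groups $\mathrm{Out}(T_{n,1})$ and $\mathrm{Out}(G_{n,1})$ contains a subgroup isomorphic to R. Thompson's group $F$.
   Context: Maps act on the right. $X_n=\{0,\ldots,n-1\}$, $X_n^*$ is the set of finite words over $X_n$, $\dot{\mathbf r}=\{\dot 0,\ldots,\dot{(r-1)}\}$ is a further ordered alphabet, $X_{n,r}^+=\{\dot a w:\dot a\in\dot{\mathbf r},\,w\in X_n^*\}$, $\mathfrak C_n=X_n^\omega$, and $\mathfrak C_{n,r}=\{\dot a x:\dot a\in\dot{\mathbf r},\,x\in\mathfrak C_n\}$ is a Cantor space; $U_\nu$ is the set of infinite words with prefix $\nu$. A complete antichain is a finite set of pairwise prefix-incomparable words $u\in X_{n,r}^+$ whose sets $U_u$ cover $\mathfrak C_{n,r}$; it is listed in lexicographic order. $G_{n,r}$ is the group of all homeomorphisms $g$ of $\mathfrak C_{n,r}$ for which there are complete antichains $\{u_0,\ldots,u_{l-1}\}$, $\{v_0,\ldots,v_{l-1}\}$ of the same size and a bijection $\pi$ between them with $(u_i x)g=(u_i)\pi\, x$ for all $i$ and $x\in\mathfrak C_n$. $T_{n,r}\le G_{n,r}$ consists of those $g$ for which $\pi$ can be taken of the form $(u_i)\pi=v_{(i+j)\bmod l}$ for a fixed $j$. In the claim $r=1$. Thompson's group $F$ is the group of piecewise linear orientation-preserving homeomorphisms of $[0,1]$ with finitely many breakpoints, all at dyadic rationals, and all slopes powers of $2$. *)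

theory Defs
  imports
    "HOL-Analysis.Analysis"
    "HOL-Algebra.Coset"
    "HOL-Algebra.Bij"
    "HOL-Library.Omega_Words_Fun"
    "HOL-Library.Sublist"
begin

text \<open>
  The dotted alphabet is \<open>{..<r}\<close> and the undotted one is \<open>{..<n}\<close>.  A dotted letter
  followed by a finite (infinite) undotted word is a pair of the letter and the word.
\<close>

type_synonym dword = "nat \<times> nat list"
type_synonym dpoint = "nat \<times> (nat \<Rightarrow> nat)"

definition undotted_points :: "nat \<Rightarrow> (nat \<Rightarrow> nat) set" where
  "undotted_points n = (UNIV \<rightarrow> {..<n})"

definition cantor :: "nat \<Rightarrow> nat \<Rightarrow> dpoint set" where
  "cantor n r = {..<r} \<times> undotted_points n"

definition cantor_topology :: "nat \<Rightarrow> nat \<Rightarrow> dpoint topology" where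
  "cantor_topology n r =
     prod_topology (discrete_topology {..<r})
       (product_topology (\<lambda>i. discrete_topology {..<n}) UNIV)"

definition dwords :: "nat \<Rightarrow> nat \<Rightarrow> dword set" where
  "dwords n r = {..<r} \<times> lists {..<n}"

definition dprefix :: "dword \<Rightarrow> dword \<Rightarrow> bool" where
  "dprefix u v \<longleftrightarrow> fst u = fst v \<and> Sublist.prefix (snd u) (snd v)"

definition dconc :: "dword \<Rightarrow> (nat \<Rightarrow> nat) \<Rightarrow> dpoint" where
  "dconc u x = (fst u, snd u \<frown> x)"

definition cone :: "nat \<Rightarrow> dword \<Rightarrow> dpoint set" where
  "cone n u = dconc u ` undotted_points n"

definition complete_antichain :: "nat \<Rightarrow> nat \<Rightarrow> dword set \<Rightarrow> bool" where
  "complete_antichain n r A \<longleftrightarrow>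
     finite A \<and> A \<subseteq> dwords n r \<and>
     (\<forall>u\<in>A. \<forall>v\<in>A. u \<noteq> v \<longrightarrow> \<not> dprefix u v \<and> \<not> dprefix v u) \<and>
     (\<Union>u\<in>A. cone n u) = cantor n r"

definition lex_less :: "(dword \<times> dword) set" where
  "lex_less = less_than <*lex*> lexord less_than"

definition lex_listing :: "dword set \<Rightarrow> dword list \<Rightarrow> bool" where
  "lex_listing A us \<longleftrightarrow> set us = A \<and> sorted_wrt (\<lambda>u v. (u, v) \<in> lex_less) us"

definition replaces_prefixes ::
    "nat \<Rightarrow> nat \<Rightarrow> (dpoint \<Rightarrow> dpoint) \<Rightarrow> dword set \<Rightarrow> dword set \<Rightarrow> (dword \<Rightarrow> dword) \<Rightarrow> bool" where
  "replaces_prefixes n r g A B \<pi> \<longleftrightarrow>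
     complete_antichain n r A \<and> complete_antichain n r B \<and> card A = card B \<and> bij_betw \<pi> A B \<and>
     (\<forall>u\<in>A. \<forall>x\<in>undotted_points n. g (dconc u x) = dconc (\<pi> u) x)"

text \<open>
  As in \<^const>\<open>Bij\<close>, maps are taken extensional, so that a map of the space is determined by its
  values on the space.
\<close>

definition G_set :: "nat \<Rightarrow> nat \<Rightarrow> (dpoint \<Rightarrow> dpoint) set" where
  "G_set n r = {g \<in> extensional (cantor n r).
     homeomorphic_map (cantor_topology n r) (cantor_topology n r) g \<and>
     (\<exists>A B \<pi>. replaces_prefixes n r g A B \<pi>)}"

definition T_set :: "nat \<Rightarrow> nat \<Rightarrow> (dpoint \<Rightarrow> dpoint) set" where
  "T_set n r = {g \<in> G_set n r.
     \<exists>A B \<pi> us vs j. replaces_prefixes n r g A B \<pi> \<and> lex_listing A us \<and> lex_listing B vs \<and>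
       (\<forall>i<length us. \<pi> (us ! i) = vs ! ((i + j) mod length us))}"

text \<open>Maps act on the right: in the product \<open>g \<otimes> h\<close> the map \<open>g\<close> is applied first.\<close>

definition right_action_group :: "'a set \<Rightarrow> ('a \<Rightarrow> 'a) set \<Rightarrow> ('a \<Rightarrow> 'a) monoid" where
  "right_action_group S M = \<lparr>carrier = M, mult = \<lambda>g h. compose S h g, one = \<lambda>x\<in>S. x\<rparr>"

definition G_group :: "nat \<Rightarrow> nat \<Rightarrow> (dpoint \<Rightarrow> dpoint) monoid" where
  "G_group n r = right_action_group (cantor n r) (G_set n r)"

definition T_group :: "nat \<Rightarrow> nat \<Rightarrow> (dpoint \<Rightarrow> dpoint) monoid" where
  "T_group n r = right_action_group (cantor n r) (T_set n r)"

text \<open>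
  Thompson's group \<open>F\<close>.  The finite set \<open>B\<close> contains all breakpoints: the map is affine on every
  subinterval with no point of \<open>B\<close> in its interior.
\<close>

definition F_set :: "(real \<Rightarrow> real) set" where
  "F_set = {f \<in> extensional {0..1}.
     homeomorphic_map (top_of_set {0..1}) (top_of_set {0..1}) f \<and>
     strict_mono_on {0..1} f \<and>
     (\<exists>B. finite B \<and> B \<subseteq> dyadics \<and>
       (\<forall>a b. 0 \<le> a \<and> a < b \<and> b \<le> 1 \<and> {a<..<b} \<inter> B = {} \<longrightarrow>
         (\<exists>(k::int) c. \<forall>x\<in>{a..b}. f x = 2 powi k * x + c)))}"

definition F_group :: "(real \<Rightarrow> real) monoid" where
  "F_group = right_action_group {0..1} F_set"

definition Inn :: "('a, 'b) monoid_scheme \<Rightarrow> ('a \<Rightarrow> 'a) set" where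
  "Inn G = {\<lambda>x\<in>carrier G. inv\<^bsub>G\<^esub> g \<otimes>\<^bsub>G\<^esub> x \<otimes>\<^bsub>G\<^esub> g | g. g \<in> carrier G}"

text \<open>
  The library's \<^const>\<open>AutoGroup\<close> composes automorphisms on the left.  The opposite convention
  gives the opposite group, which is isomorphic via inversion.
\<close>

definition Out :: "('a, 'b) monoid_scheme \<Rightarrow> ('a \<Rightarrow> 'a) set monoid" where
  "Out G = AutoGroup G Mod Inn G"

definition contains_copy_of :: "('a, 'b) monoid_scheme \<Rightarrow> ('c, 'd) monoid_scheme \<Rightarrow> bool" where
  "contains_copy_of G K \<longleftrightarrow> (\<exists>H. subgroup H G \<and> G\<lparr>carrier := H\<rparr> \<cong> K)"

end

theory Submission
  imports Defs
begin

text \<open>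
  Call the letters strictly between \<open>0\<close> and \<open>n - 1\<close> middle letters; they exist because
  \<open>n \<ge> 3\<close>.  The points without a middle letter form a Cantor set in the two letters \<open>0\<close> and
  \<open>n - 1\<close>, whose gaps are indexed, in order, by the binary words, that is, by the dyadic rationals
  in \<open>(0, 1)\<close>.  An element \<open>f\<close> of \<open>F\<close> permutes these dyadic rationals monotonically, hence the gaps,
  and repeating this permutation inside every gap gives an order preserving homeomorphism \<open>h\<close> with
  \<open>h (w c x) = f(w) c h(x)\<close> for a binary word \<open>w\<close> and a middle letter \<open>c\<close>.  Below a long word
  the action of \<open>h\<close> depends only on the last letters read: it starts afresh after a middle letter and
  merely copies binary letters once \<open>f\<close> is affine there.  Therefore conjugation by \<open>h\<close>
  turns local prefix replacements into local prefix replacements, so \<open>h\<close> normalises both groups.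
  If this conjugation is inner, then \<open>h\<close> agrees with an element of \<open>G\<close> on the dense set of points
  with infinitely many middle letters, because \<open>T\<close> moves such points independently of all others.
  Then some \<open>h (w c x)\<close> is both a fixed word followed by \<open>h x\<close> and a fixed word followed by \<open>x\<close>,
  which forces \<open>h x = x\<close> and \<open>f = 1\<close>.
\<close>

section \<open>Embedding a group of conjugations into an outer automorphism group\<close>

text \<open>The definitions speak of pairs of antichains, which conjugation by h does not respect,
  so both groups first get a description without them. A bijection lies in G exactly if it replaces
  all prefixes of some fixed length N; that the replacing words again form a complete antichain
  follows from bijectivity. It lies in T if moreover it preserves the cyclic order of the points;
  the shift j between two listings becomes a cut of the linear order. Since h preserves the linear
  order, T is then hardly more work than G. Points without middle letters lie in no gap. There h has
  to be defined separately, through an initial word so long that f is affine behind it, and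
  monotonicity is obtained by approximation with points that do have a middle letter. Both groups
  are treated at once as a group M with T \<subseteq> M \<subseteq> G: a conjugator in M is used
  only as an element of G, and it is tested only against elements of T.\<close>

lemma carrier_AutoGroup: "carrier (AutoGroup G) = auto G"
  by (simp add: AutoGroup_def)

lemma mult_AutoGroup:
  "f \<in> auto G \<Longrightarrow> g \<in> auto G \<Longrightarrow> f \<otimes>\<^bsub>AutoGroup G\<^esub> g = compose (carrier G) f g"
  by (simp add: AutoGroup_def BijGroup_def auto_def)

lemma one_AutoGroup: "\<one>\<^bsub>AutoGroup G\<^esub> = (\<lambda>x\<in>carrier G. x)"
  by (simp add: AutoGroup_def BijGroup_def)

lemma (in group) inv_AutoGroup:
  assumes "f \<in> auto G"
  shows "inv\<^bsub>AutoGroup G\<^esub> f \<in> auto G"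
    and "x \<in> carrier G \<Longrightarrow> f ((inv\<^bsub>AutoGroup G\<^esub> f) x) = x"
    and "x \<in> carrier G \<Longrightarrow> (inv\<^bsub>AutoGroup G\<^esub> f) (f x) = x"
proof -
  interpret A: group "AutoGroup G" by (rule AutoGroup)
  show *: "inv\<^bsub>AutoGroup G\<^esub> f \<in> auto G"
    using A.inv_closed[of f] assms by (simp add: carrier_AutoGroup)
  show "f ((inv\<^bsub>AutoGroup G\<^esub> f) x) = x" if "x \<in> carrier G"
    using A.r_inv[of f] assms * that
    by (simp add: carrier_AutoGroup mult_AutoGroup one_AutoGroup) (metis compose_eq restrict_apply')
  show "(inv\<^bsub>AutoGroup G\<^esub> f) (f x) = x" if "x \<in> carrier G"
    using A.l_inv[of f] assms * that
    by (simp add: carrier_AutoGroup mult_AutoGroup one_AutoGroup) (metis compose_eq restrict_apply')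
qed

section \<open>Inner automorphisms\<close>

definition inner_map :: "('a, 'b) monoid_scheme \<Rightarrow> 'a \<Rightarrow> 'a \<Rightarrow> 'a" where
  "inner_map G g = (\<lambda>x\<in>carrier G. inv\<^bsub>G\<^esub> g \<otimes>\<^bsub>G\<^esub> x \<otimes>\<^bsub>G\<^esub> g)"

lemma Inn_eq: "Inn G = inner_map G ` carrier G"
  by (auto simp: Inn_def inner_map_def)

lemma (in group) inner_map_auto:
  assumes "g \<in> carrier G"
  shows "inner_map G g \<in> auto G"
proof -
  have "bij_betw (inner_map G g) (carrier G) (carrier G)"
  proof (rule bij_betwI[where g = "\<lambda>x. g \<otimes> x \<otimes> inv g"])
    show "inner_map G g \<in> carrier G \<rightarrow> carrier G" "(\<lambda>x. g \<otimes> x \<otimes> inv g) \<in> carrier G \<rightarrow> carrier G"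
      using assms by (auto simp: inner_map_def)
    fix x assume x: "x \<in> carrier G"
    show "g \<otimes> inner_map G g x \<otimes> inv g = x" "inner_map G g (g \<otimes> x \<otimes> inv g) = x"
      using assms x by (simp_all add: inner_map_def m_assoc) (simp_all add: m_assoc[symmetric])
  qed
  moreover have "inner_map G g \<in> hom G G"
    using assms
    by (auto simp: hom_def inner_map_def Pi_def m_assoc)
      (metis (no_types, lifting) inv_closed inv_solve_left' m_assoc m_closed r_inv)
  ultimately show ?thesis
    by (auto simp: auto_def Bij_def inner_map_def)
qed

text \<open>The factors change places because \<open>inner_map\<close> conjugates as g^-1 x g while
  \<open>AutoGroup\<close> applies its right factor first.\<close>

lemma (in group) inner_map_mult:
  assumes "g \<in> carrier G" "h \<in> carrier G"
  shows "inner_map G g \<otimes>\<^bsub>AutoGroup G\<^esub> inner_map G h = inner_map G (h \<otimes> g)"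
proof -
  have "compose (carrier G) (inner_map G g) (inner_map G h) x = inner_map G (h \<otimes> g) x" for x
    using assms by (cases "x \<in> carrier G") (simp_all add: compose_def inner_map_def inv_mult_group m_assoc)
  then show ?thesis using assms by (simp add: mult_AutoGroup inner_map_auto fun_eq_iff)
qed

text \<open>Conjugating the inner map of g by an automorphism f gives the inner map of f g.\<close>

lemma (in group) Inn_normal: "Inn G \<lhd> AutoGroup G"
proof -
  interpret A: group "AutoGroup G" by (rule AutoGroup)
  have one: "inner_map G \<one> = \<one>\<^bsub>AutoGroup G\<^esub>"
    by (auto simp: inner_map_def one_AutoGroup fun_eq_iff)
  have sub: "subgroup (Inn G) (AutoGroup G)"
  proof (rule A.subgroupI)
    show "Inn G \<subseteq> carrier (AutoGroup G)"
      by (auto simp: Inn_eq carrier_AutoGroup inner_map_auto)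
    show "Inn G \<noteq> {}" by (auto simp: Inn_eq)
    fix a assume "a \<in> Inn G"
    then obtain g where g: "g \<in> carrier G" "a = inner_map G g" by (auto simp: Inn_eq)
    have "inner_map G (inv g) \<otimes>\<^bsub>AutoGroup G\<^esub> a = \<one>\<^bsub>AutoGroup G\<^esub>"
      using g by (simp add: inner_map_mult one)
    then have "inv\<^bsub>AutoGroup G\<^esub> a = inner_map G (inv g)"
      using g by (intro A.inv_equality) (auto simp: carrier_AutoGroup inner_map_auto)
    then show "inv\<^bsub>AutoGroup G\<^esub> a \<in> Inn G"
      using g by (auto simp: Inn_eq)
    fix b assume "b \<in> Inn G"
    then show "a \<otimes>\<^bsub>AutoGroup G\<^esub> b \<in> Inn G"
      using g by (auto simp: Inn_eq inner_map_mult)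
  qed
  show ?thesis
    unfolding A.normal_inv_iff
  proof (intro conjI sub ballI)
    fix f a assume f: "f \<in> carrier (AutoGroup G)" and "a \<in> Inn G"
    then obtain g where g: "g \<in> carrier G" "a = inner_map G g" by (auto simp: Inn_eq)
    have fa: "f \<in> auto G" using f by (simp add: carrier_AutoGroup)
    have fh: "f \<in> hom G G" "f \<in> carrier G \<rightarrow> carrier G"
      using fa by (auto simp: auto_def hom_def)
    have finv: "f (inv x) = inv (f x)" if "x \<in> carrier G" for x
      using fh that group_hom.hom_inv[of G G f x] by (simp add: group_hom_def group_hom_axioms_def)
    let ?i = "inv\<^bsub>AutoGroup G\<^esub> f"
    note fi = inv_AutoGroup[OF fa]
    have ic: "?i x \<in> carrier G" if "x \<in> carrier G" for x
      using fi(1) that by (auto simp: auto_def hom_def)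
    have "f \<otimes>\<^bsub>AutoGroup G\<^esub> a \<otimes>\<^bsub>AutoGroup G\<^esub> ?i = inner_map G (f g)"
    proof -
      have "f \<otimes>\<^bsub>AutoGroup G\<^esub> a = compose (carrier G) f a" "compose (carrier G) f a \<in> auto G"
        using g fa A.m_closed[of f a] by (auto simp: mult_AutoGroup inner_map_auto carrier_AutoGroup)
      moreover have "compose (carrier G) (compose (carrier G) f a) ?i = inner_map G (f g)"
      proof
        fix x
        show "compose (carrier G) (compose (carrier G) f a) ?i x = inner_map G (f g) x"
        proof (cases "x \<in> carrier G")
          case True
          then show ?thesis
            using g fh ic fi(2) hom_mult[OF fh(1)] finv
            by (simp add: compose_eq inner_map_def)
        qed (simp add: compose_def inner_map_def)
      qed
      ultimately show ?thesis using fi(1) by (simp add: mult_AutoGroup)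
    qed
    then show "f \<otimes>\<^bsub>AutoGroup G\<^esub> a \<otimes>\<^bsub>AutoGroup G\<^esub> ?i \<in> Inn G"
      using g fh by (auto simp: Inn_eq)
  qed
qed

text \<open>The copy is the image of K under \<open>\<Phi>\<close> followed by the projection to
  \<open>Out G\<close>; \<open>inj\<close> says that this composite has trivial kernel.\<close>

lemma contains_copy_of_OutI:
  assumes G: "group G" and K: "group K" and hom: "\<Phi> \<in> hom K (AutoGroup G)"
    and inj: "\<And>k. k \<in> carrier K \<Longrightarrow> \<Phi> k \<in> Inn G \<Longrightarrow> k = \<one>\<^bsub>K\<^esub>"
  shows "contains_copy_of (Out G) K"
proof -
  interpret G: group G by (rule G)
  interpret K: group K by (rule K)
  interpret N: normal "Inn G" "AutoGroup G" by (rule G.Inn_normal)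
  define \<Psi> where "\<Psi> = (\<lambda>a. Inn G #>\<^bsub>AutoGroup G\<^esub> a) \<circ> \<Phi>"
  have "\<Psi> \<in> hom K (Out G)"
    unfolding \<Psi>_def Out_def by (rule hom_compose[OF hom N.r_coset_hom_Mod])
  then interpret \<Psi>: group_hom K "Out G" \<Psi>
    by (simp add: group_hom_def group_hom_axioms_def K Out_def N.factorgroup_is_group)
  have "k = \<one>\<^bsub>K\<^esub>" if "k \<in> carrier K" "\<Psi> k = \<one>\<^bsub>Out G\<^esub>" for k
  proof (rule inj[OF that(1)])
    have "\<Phi> k \<in> carrier (AutoGroup G)" using hom that(1) by (auto simp: hom_def)
    then show "\<Phi> k \<in> Inn G"
      using that(2) N.rcos_self[of "\<Phi> k" "Inn G"] N.subgroup_axioms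
      by (simp add: \<Psi>_def Out_def)
  qed
  then have "inj_on \<Psi> (carrier K)"
    by (auto simp: \<Psi>.inj_on_one_iff)
  then have "\<Psi> \<in> iso K (Out G\<lparr>carrier := \<Psi> ` carrier K\<rparr>)"
    using \<Psi>.homh by (auto simp: iso_def bij_betw_def hom_def)
  then have "K \<cong> Out G\<lparr>carrier := \<Psi> ` carrier K\<rparr>" by (rule is_isoI)
  then show ?thesis
    unfolding contains_copy_of_def using K.iso_sym \<Psi>.img_is_subgroup by blast
qed

section \<open>Groups of maps acting on the right\<close>

lemma right_action_group_simps [simp]:
  "carrier (right_action_group S M) = M"
  "\<one>\<^bsub>right_action_group S M\<^esub> = (\<lambda>x\<in>S. x)"
  "g \<otimes>\<^bsub>right_action_group S M\<^esub> h = compose S h g"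
  by (simp_all add: right_action_group_def)

lemma group_right_action_groupI:
  assumes Bij: "M \<subseteq> Bij S" and one: "(\<lambda>x\<in>S. x) \<in> M"
    and comp: "\<And>g h. g \<in> M \<Longrightarrow> h \<in> M \<Longrightarrow> compose S h g \<in> M"
    and inv: "\<And>g. g \<in> M \<Longrightarrow> (\<lambda>x\<in>S. inv_into S g x) \<in> M"
  shows "group (right_action_group S M)"
proof (rule groupI)
  show "\<exists>h\<in>carrier (right_action_group S M).
      h \<otimes>\<^bsub>right_action_group S M\<^esub> g = \<one>\<^bsub>right_action_group S M\<^esub>"
    if "g \<in> carrier (right_action_group S M)" for g
  proof -
    have "g \<in> Bij S" "g \<in> M" using that Bij by auto
    then have "compose S g (\<lambda>x\<in>S. inv_into S g x) = (\<lambda>x\<in>S. x)"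
      by (auto simp: compose_def fun_eq_iff Bij_def bij_betw_def f_inv_into_f inv_into_into)
    then show ?thesis using inv \<open>g \<in> M\<close> by auto
  qed
  fix f g h assume "f \<in> carrier (right_action_group S M)" "g \<in> carrier (right_action_group S M)"
    "h \<in> carrier (right_action_group S M)"
  then show "f \<otimes>\<^bsub>right_action_group S M\<^esub> g \<otimes>\<^bsub>right_action_group S M\<^esub> h =
      f \<otimes>\<^bsub>right_action_group S M\<^esub> (g \<otimes>\<^bsub>right_action_group S M\<^esub> h)"
    using Bij by (auto simp: compose_def fun_eq_iff Bij_def bij_betw_def)
next
  fix g assume "g \<in> carrier (right_action_group S M)"
  then have "g \<in> extensional S" using Bij by (auto simp: Bij_def)
  then show "\<one>\<^bsub>right_action_group S M\<^esub> \<otimes>\<^bsub>right_action_group S M\<^esub> g = g"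
    by (simp add: compose_Id compose_def fun_eq_iff extensional_def)
qed (simp_all add: one comp)

lemma inv_right_action_group:
  assumes "group (right_action_group S M)" "M \<subseteq> Bij S" "g \<in> M"
  shows "inv\<^bsub>right_action_group S M\<^esub> g \<in> M"
    and "x \<in> S \<Longrightarrow> g ((inv\<^bsub>right_action_group S M\<^esub> g) x) = x"
    and "x \<in> S \<Longrightarrow> (inv\<^bsub>right_action_group S M\<^esub> g) (g x) = x"
proof -
  interpret group "right_action_group S M" by fact
  show "inv\<^bsub>right_action_group S M\<^esub> g \<in> M" using inv_closed[of g] assms by simp
  show "g ((inv\<^bsub>right_action_group S M\<^esub> g) x) = x" if "x \<in> S"
    using l_inv[of g] assms that by (simp del: l_inv) (metis compose_eq restrict_apply')
  show "(inv\<^bsub>right_action_group S M\<^esub> g) (g x) = x" if "x \<in> S"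
    using r_inv[of g] assms that by (simp del: r_inv) (metis compose_eq restrict_apply')
qed

text \<open>For maps acting on the right, the map in \<open>conj\<close> is k m k^-1 with k read as
  \<open>\<theta> k\<close>. This side is the right one: \<open>\<theta>\<close> is a right action
  and \<open>AutoGroup\<close> composes on the left, so \<open>\<Phi>\<close> becomes a homomorphism
  and not an antihomomorphism. One inclusion in \<open>conj\<close> suffices for an automorphism, as
  it also holds for the inverse of k. If the automorphism is inner with conjugator g, then
  \<open>\<theta> k\<close> after g commutes with all of M, which is the premise of
  \<open>faithful\<close>.\<close>

lemma contains_copy_of_Out_conjugation:
  fixes \<theta> :: "'k \<Rightarrow> 'a \<Rightarrow> 'a"
  assumes R: "group (right_action_group S M)" and M: "M \<subseteq> Bij S" and K: "group K"
    and Bij: "\<And>k. k \<in> carrier K \<Longrightarrow> \<theta> k \<in> Bij S"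
    and mult: "\<And>k l x. k \<in> carrier K \<Longrightarrow> l \<in> carrier K \<Longrightarrow> x \<in> S \<Longrightarrow> \<theta> (k \<otimes>\<^bsub>K\<^esub> l) x = \<theta> l (\<theta> k x)"
    and one: "\<And>x. x \<in> S \<Longrightarrow> \<theta> \<one>\<^bsub>K\<^esub> x = x"
    and conj: "\<And>k m. k \<in> carrier K \<Longrightarrow> m \<in> M \<Longrightarrow>
      compose S (\<theta> (inv\<^bsub>K\<^esub> k)) (compose S m (\<theta> k)) \<in> M"
    and faithful: "\<And>k g. k \<in> carrier K \<Longrightarrow> g \<in> M \<Longrightarrow>
      (\<And>m x. m \<in> M \<Longrightarrow> x \<in> S \<Longrightarrow> m (\<theta> k (g x)) = \<theta> k (g (m x))) \<Longrightarrow> k = \<one>\<^bsub>K\<^esub>"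
  shows "contains_copy_of (Out (right_action_group S M)) K"
proof -
  let ?R = "right_action_group S M"
  interpret R: group ?R by (rule R)
  interpret K: group K by (rule K)
  define \<Phi> where "\<Phi> k = (\<lambda>m\<in>M. compose S (\<theta> (inv\<^bsub>K\<^esub> k)) (compose S m (\<theta> k)))" for k
  have in_S: "\<theta> k x \<in> S" if "k \<in> carrier K" "x \<in> S" for k x
    using Bij_imp_funcset[OF Bij[OF that(1)]] that(2) by auto
  have m_S: "m x \<in> S" if "m \<in> M" "x \<in> S" for m x
    using Bij_imp_funcset M that by blast
  have inv1: "\<theta> (inv\<^bsub>K\<^esub> k) (\<theta> k x) = x" "\<theta> k (\<theta> (inv\<^bsub>K\<^esub> k) x) = x" if "k \<in> carrier K" "x \<in> S" for k x
    using that one mult[of k "inv\<^bsub>K\<^esub> k" x] mult[of "inv\<^bsub>K\<^esub> k" k x] by simp_all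
  have \<Phi>_M: "\<Phi> k m \<in> M" if "k \<in> carrier K" "m \<in> M" for k m
    using that conj by (simp add: \<Phi>_def)
  have \<Phi>_apply: "\<Phi> k m x = \<theta> (inv\<^bsub>K\<^esub> k) (m (\<theta> k x))" if "k \<in> carrier K" "m \<in> M" "x \<in> S" for k m x
    using that by (simp add: \<Phi>_def compose_eq in_S)
  have eqI: "m = m'" if "m \<in> M" "m' \<in> M" "\<And>x. x \<in> S \<Longrightarrow> m x = m' x" for m m'
    using that M Bij_imp_extensional by (blast intro: extensionalityI)
  have \<Phi>_mult: "\<Phi> (k \<otimes>\<^bsub>K\<^esub> l) m = \<Phi> k (\<Phi> l m)" if "k \<in> carrier K" "l \<in> carrier K" "m \<in> M" for k l m
    using that
    by (intro eqI) (simp_all add: \<Phi>_M \<Phi>_apply K.inv_mult_group mult in_S m_S)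
  have \<Phi>_one: "\<Phi> \<one>\<^bsub>K\<^esub> m = m" if "m \<in> M" for m
    using that by (intro eqI) (simp_all add: \<Phi>_M \<Phi>_apply one m_S)
  have auto: "\<Phi> k \<in> auto ?R" if k: "k \<in> carrier K" for k
  proof -
    have "bij_betw (\<Phi> k) M M"
    proof (rule bij_betwI[where g = "\<Phi> (inv\<^bsub>K\<^esub> k)"])
      fix m assume m: "m \<in> M"
      show "\<Phi> (inv\<^bsub>K\<^esub> k) (\<Phi> k m) = m" "\<Phi> k (\<Phi> (inv\<^bsub>K\<^esub> k) m) = m"
        using k m by (simp_all add: \<Phi>_mult[symmetric] \<Phi>_one)
    qed (use k \<Phi>_M in auto)
    moreover have "\<Phi> k \<in> hom ?R ?R"
    proof (rule homI)
      fix m m' assume "m \<in> carrier ?R" "m' \<in> carrier ?R"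
      then have m: "m \<in> M" "m' \<in> M" and c: "compose S m' m \<in> M"
        using R.m_closed[of m m'] by auto
      then show "\<Phi> k (m \<otimes>\<^bsub>?R\<^esub> m') = \<Phi> k m \<otimes>\<^bsub>?R\<^esub> \<Phi> k m'"
        using k \<Phi>_M R.m_closed[of "\<Phi> k m" "\<Phi> k m'"]
        by (intro eqI) (simp_all add: \<Phi>_apply compose_eq in_S m_S inv1)
    qed (use k \<Phi>_M in auto)
    ultimately show ?thesis
      by (auto simp: auto_def Bij_def \<Phi>_def)
  qed
  show ?thesis
  proof (rule contains_copy_of_OutI[OF R K])
    show "\<Phi> \<in> hom K (AutoGroup ?R)"
    proof (rule homI)
      fix k l assume kl: "k \<in> carrier K" "l \<in> carrier K"
      show "\<Phi> (k \<otimes>\<^bsub>K\<^esub> l) = \<Phi> k \<otimes>\<^bsub>AutoGroup ?R\<^esub> \<Phi> l"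
      proof
        fix m show "\<Phi> (k \<otimes>\<^bsub>K\<^esub> l) m = (\<Phi> k \<otimes>\<^bsub>AutoGroup ?R\<^esub> \<Phi> l) m"
        proof (cases "m \<in> M")
          case True
          then show ?thesis using kl auto by (simp add: mult_AutoGroup compose_eq \<Phi>_mult)
        qed (use kl auto in \<open>simp add: mult_AutoGroup compose_def \<Phi>_def\<close>)
      qed
    qed (simp add: carrier_AutoGroup auto)
    fix k assume k: "k \<in> carrier K" and "\<Phi> k \<in> Inn ?R"
    then obtain g where g: "g \<in> M" and eq: "\<Phi> k = inner_map ?R g" by (auto simp: Inn_eq)
    show "k = \<one>\<^bsub>K\<^esub>"
    proof (rule faithful[OF k g])
      fix m x assume m: "m \<in> M" and x: "x \<in> S"
      note gi = inv_right_action_group[OF R M g]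
      \<comment> \<open>At the point \<open>g x\<close> the inverse of \<open>g\<close>
        cancels.\<close>
      have "\<Phi> k m (g x) = inner_map ?R g m (g x)" by (simp add: eq)
      also have "\<dots> = g (m x)"
        using m x g gi by (simp add: inner_map_def compose_eq m_S)
      finally have "\<theta> (inv\<^bsub>K\<^esub> k) (m (\<theta> k (g x))) = g (m x)"
        using k m x g by (simp add: \<Phi>_apply m_S)
      then have "\<theta> k (\<theta> (inv\<^bsub>K\<^esub> k) (m (\<theta> k (g x)))) = \<theta> k (g (m x))" by simp
      then show "m (\<theta> k (g x)) = \<theta> k (g (m x))"
        using k m x g by (simp add: inv1 m_S in_S)
    qed
  qed
qed

section \<open>Thompson's group F acting on finite binary words\<close>

definition dyadic :: "real \<Rightarrow> bool" where
  "dyadic x \<longleftrightarrow> (\<exists>(i::int) (k::nat). x = of_int i / 2 ^ k)"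

lemma dyadicI: "dyadic (of_int i / 2 ^ k)"
  by (auto simp: dyadic_def)

lemma dyadic_add:
  assumes "dyadic x" "dyadic y"
  shows "dyadic (x + y)"
proof -
  obtain i k j l where x: "x = of_int i / 2 ^ k" and y: "y = of_int j / 2 ^ l"
    using assms by (auto simp: dyadic_def)
  have "x + y = of_int (i * 2 ^ l + j * 2 ^ k) / 2 ^ (k + l)"
    by (simp add: x y field_simps power_add)
  then show ?thesis by (metis dyadicI)
qed

lemma dyadic_minus: "dyadic x \<Longrightarrow> dyadic (- x)"
  unfolding dyadic_def by (metis minus_divide_left of_int_minus)

lemma dyadic_diff: "dyadic x \<Longrightarrow> dyadic y \<Longrightarrow> dyadic (x - y)"
  using dyadic_add[of x "- y"] dyadic_minus by simp

lemma dyadic_powi_mult: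
  assumes "dyadic x"
  shows "dyadic (2 powi k * x)"
proof -
  obtain i l where x: "x = of_int i / 2 ^ l" using assms by (auto simp: dyadic_def)
  show ?thesis
  proof (cases "k \<ge> 0")
    case True
    then have "2 powi k * x = of_int (i * 2 ^ nat k) / 2 ^ l"
      by (simp add: x power_int_def)
    then show ?thesis by (metis dyadicI)
  next
    case False
    then have "2 powi k * x = of_int i / 2 ^ (l + nat (- k))"
      by (simp add: x power_int_def power_add field_simps)
    then show ?thesis by (metis dyadicI)
  qed
qed

text \<open>The elements of \<open>dyadics\<close> are nonnegative; the signed version
  \<open>dyadic\<close> is closed under differences, which the computations with affine pieces
  need.\<close>

lemma dyadics_iff_dyadic: "x \<in> dyadics \<longleftrightarrow> 0 \<le> x \<and> dyadic x"
proof
  assume "x \<in> dyadics"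
  then obtain m k where "x = of_int (int m) / 2 ^ k" by (auto simp: dyadics_def)
  then show "0 \<le> x \<and> dyadic x" using dyadicI[of "int m" k] by simp
next
  assume "0 \<le> x \<and> dyadic x"
  then obtain i k where x: "x = of_int i / 2 ^ k" and "0 \<le> x" by (auto simp: dyadic_def)
  then have "real_of_int i = x * 2 ^ k" by simp
  then have "0 \<le> real_of_int i" using \<open>0 \<le> x\<close> by simp
  then have "0 \<le> i" by simp
  then have "x = of_nat (nat i) / 2 ^ k" by (simp add: x)
  then show "x \<in> dyadics" by (auto simp: dyadics_def)
qed

text \<open>Stated for all large exponents, so that finitely many dyadic numbers can be put on one
  grid by taking a maximum.\<close>

lemma dyadic_grid:
  assumes "dyadic x" "0 \<le> x"
  obtains K where "\<And>k. K \<le> k \<Longrightarrow> \<exists>a::nat. x = real a / 2 ^ k"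
proof -
  obtain i K where x: "x = of_int i / 2 ^ K" using assms(1) by (auto simp: dyadic_def)
  then have "real_of_int i = x * 2 ^ K" by simp
  then have "0 \<le> real_of_int i" using assms(2) by simp
  then have i: "0 \<le> i" by simp
  show thesis
  proof (rule that[of K])
    fix k assume "K \<le> k"
    then have "x = real (nat i * 2 ^ (k - K)) / 2 ^ k"
      using i by (simp add: x field_simps flip: power_add)
    then show "\<exists>a::nat. x = real a / 2 ^ k" by blast
  qed
qed

section \<open>Elements of F as maps of the unit interval\<close>

lemma
  assumes "f \<in> F_set"
  shows F_bij: "bij_betw f {0..1} {0..1}"
    and F_strict_mono: "\<lbrakk>0 \<le> x; x < y; y \<le> 1\<rbrakk> \<Longrightarrow> f x < f y"
    and F_ext: "f \<in> extensional {0..1}"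
    and F_range: "\<lbrakk>0 \<le> x; x \<le> 1\<rbrakk> \<Longrightarrow> 0 \<le> f x" "\<lbrakk>0 \<le> x; x \<le> 1\<rbrakk> \<Longrightarrow> f x \<le> 1"
    and F_0: "f 0 = 0" and F_1: "f 1 = 1"
proof -
  show b: "bij_betw f {0..1} {0..1}"
    using assms homeomorphic_imp_injective_map[of "top_of_set {0..1}" "top_of_set {0..1}" f]
      homeomorphic_imp_surjective_map[of "top_of_set {0..1}" "top_of_set {0..1}" f]
    by (auto simp: F_set_def bij_betw_def)
  have sm: "strict_mono_on {0..1} f" using assms by (simp add: F_set_def)
  then show "\<lbrakk>0 \<le> x; x < y; y \<le> 1\<rbrakk> \<Longrightarrow> f x < f y" by (auto simp: strict_mono_on_def)
  show "f \<in> extensional {0..1}" using assms by (simp add: F_set_def)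
  show r1: "0 \<le> f x" and r2: "f x \<le> 1" if "0 \<le> x" "x \<le> 1" for x
    using bij_betwE[OF b] that by auto
  have im: "f ` {0..1} = {0..1}" using b by (simp add: bij_betw_def)
  show "f 0 = 0"
  proof -
    have "0 \<in> f ` {0..1}" unfolding im by simp
    then obtain x where x: "x \<in> {0..1}" "f x = 0" by force
    have "\<not> 0 < x" using strict_mono_onD[OF sm, of 0 x] x r1[of 0] by auto
    then show ?thesis using x by (cases "x = 0") auto
  qed
  show "f 1 = 1"
  proof -
    have "1 \<in> f ` {0..1}" unfolding im by simp
    then obtain x where x: "x \<in> {0..1}" "f x = 1" by force
    have "\<not> x < 1" using strict_mono_onD[OF sm, of x 1] x r2[of 1] by auto
    then show ?thesis using x by (cases "x = 1") auto
  qed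
qed

lemma F_less_iff:
  assumes "f \<in> F_set" "0 \<le> x" "x \<le> 1" "0 \<le> y" "y \<le> 1"
  shows "f x < f y \<longleftrightarrow> x < y"
  using F_strict_mono[OF assms(1), of x y] F_strict_mono[OF assms(1), of y x] assms(2-)
  by (metis less_irrefl less_not_sym linorder_less_linear)

lemma F_pieces:
  assumes "f \<in> F_set"
  obtains B where "finite B" "B \<subseteq> dyadics"
    and "\<And>a b. 0 \<le> a \<Longrightarrow> a < b \<Longrightarrow> b \<le> 1 \<Longrightarrow> {a<..<b} \<inter> B = {} \<Longrightarrow>
         \<exists>(k::int) c. \<forall>x\<in>{a..b}. f x = 2 powi k * x + c"
proof -
  have "\<exists>B. finite B \<and> B \<subseteq> dyadics \<and> (\<forall>a b. 0 \<le> a \<and> a < b \<and> b \<le> 1 \<and> {a<..<b} \<inter> B = {} \<longrightarrow>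
         (\<exists>(k::int) c. \<forall>x\<in>{a..b}. f x = 2 powi k * x + c))"
    using assms by (simp add: F_set_def)
  then obtain B where "finite B \<and> B \<subseteq> dyadics \<and> (\<forall>a b. 0 \<le> a \<and> a < b \<and> b \<le> 1 \<and> {a<..<b} \<inter> B = {} \<longrightarrow>
         (\<exists>(k::int) c. \<forall>x\<in>{a..b}. f x = 2 powi k * x + c))" ..
  then show thesis by (intro that[of B]) simp_all
qed

text \<open>Once the grid is fine enough to contain all breakpoints, none of them is interior to a
  cell. Cells are the form of piecewise linearity that suits binary words: the points of a cell
  share an initial word.\<close>

lemma F_grid:
  assumes f: "f \<in> F_set"
  obtains M where "\<And>K a. M \<le> K \<Longrightarrow> a < (2::nat) ^ K \<Longrightarrow>
    \<exists>(k::int) c. \<forall>x\<in>{real a / 2 ^ K..(real a + 1) / 2 ^ K}. f x = 2 powi k * x + c"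
proof -
  obtain B where B: "finite B" "B \<subseteq> dyadics" and
    aff: "\<And>a b. 0 \<le> a \<Longrightarrow> a < b \<Longrightarrow> b \<le> 1 \<Longrightarrow> {a<..<b} \<inter> B = {} \<Longrightarrow>
         \<exists>(k::int) c. \<forall>x\<in>{a..b}. f x = 2 powi k * x + c"
    using F_pieces[OF f] by metis
  have "\<exists>M. \<forall>k\<ge>M. \<forall>b\<in>B. \<exists>m::nat. b = real m / 2 ^ k"
    using B
  proof (induction rule: finite_induct)
    case (insert b B)
    then obtain M where M: "\<forall>k\<ge>M. \<forall>b\<in>B. \<exists>m::nat. b = real m / 2 ^ k" by auto
    obtain M' where "\<And>k. M' \<le> k \<Longrightarrow> \<exists>m::nat. b = real m / 2 ^ k"
      using dyadic_grid[of b] insert.prems by (metis dyadics_iff_dyadic insert_subset)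
    then have "\<forall>k\<ge>max M M'. \<forall>b\<in>insert b B. \<exists>m::nat. b = real m / 2 ^ k" using M by auto
    then show ?case by blast
  qed simp
  then obtain M where M: "\<And>k b. M \<le> k \<Longrightarrow> b \<in> B \<Longrightarrow> \<exists>m::nat. b = real m / 2 ^ k" by blast
  show thesis
  proof (rule that)
    fix K a assume K: "M \<le> K" and a: "a < (2::nat) ^ K"
    have "real a + 1 \<le> 2 ^ K" using a of_nat_mono[of "Suc a" "2 ^ K", where 'a = real] by simp
    moreover have "b \<notin> {real a / 2 ^ K<..<(real a + 1) / 2 ^ K}" if "b \<in> B" for b
    proof
      assume b: "b \<in> {real a / 2 ^ K<..<(real a + 1) / 2 ^ K}"
      obtain m :: nat where m: "b = real m / 2 ^ K" using M[OF K \<open>b \<in> B\<close>] by blast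
      have "real a < real m" "real m < real (a + 1)"
        using b by (simp_all add: m divide_less_cancel)
      then show False by (simp only: of_nat_less_iff)
    qed
    ultimately show "\<exists>(k::int) c. \<forall>x\<in>{real a / 2 ^ K..(real a + 1) / 2 ^ K}. f x = 2 powi k * x + c"
      by (intro aff) (auto simp: field_simps)
  qed
qed

text \<open>Only the slopes are known to be powers of 2, nothing is known of the intercepts. So the
  values on a grid are computed by walking from \<open>f 0 = 0\<close>: crossing a cell adds a
  dyadic amount.\<close>

lemma F_dyadic:
  assumes f: "f \<in> F_set" and x: "dyadic x" "0 \<le> x" "x \<le> 1"
  shows "dyadic (f x)"
proof -
  obtain M where M: "\<And>K a. M \<le> K \<Longrightarrow> a < (2::nat) ^ K \<Longrightarrow>
    \<exists>(k::int) c. \<forall>x\<in>{real a / 2 ^ K..(real a + 1) / 2 ^ K}. f x = 2 powi k * x + c"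
    using F_grid[OF f] by metis
  obtain M' where M': "\<And>k. M' \<le> k \<Longrightarrow> \<exists>a::nat. x = real a / 2 ^ k"
    using dyadic_grid[OF x(1,2)] by blast
  define K where "K = max M M'"
  have "dyadic (f (real a / 2 ^ K))" if "a \<le> 2 ^ K" for a
    using that
  proof (induction a)
    case 0
    show ?case using F_0[OF f] dyadicI[of 0 0] by simp
  next
    case (Suc a)
    then obtain k c where kc: "\<forall>x\<in>{real a / 2 ^ K..(real a + 1) / 2 ^ K}. f x = 2 powi (k::int) * x + c"
      using M[of K a] by (auto simp: K_def)
    have "f (real a / 2 ^ K) = 2 powi k * (real a / 2 ^ K) + c"
      "f (real (Suc a) / 2 ^ K) = 2 powi k * (real (Suc a) / 2 ^ K) + c"
      by (rule kc[rule_format]; simp add: divide_right_mono add.commute)+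
    then have "f (real (Suc a) / 2 ^ K) = f (real a / 2 ^ K) + 2 powi k * (of_int 1 / 2 ^ K)"
      by (simp add: field_simps)
    then show ?case
      using Suc by (simp only: dyadic_add dyadic_powi_mult dyadicI Suc_leD)
  qed
  moreover obtain a :: nat where a: "x = real a / 2 ^ K" using M'[of K] by (auto simp: K_def)
  moreover have "a \<le> 2 ^ K" using x(3) a by (simp add: field_simps)
  ultimately show ?thesis by simp
qed

text \<open>The affine piece around x can be inverted, since the reciprocal of its slope is again a
  power of 2. This is what makes the breakpoints of a composite dyadic.\<close>

lemma F_dyadic_rev:
  assumes f: "f \<in> F_set" and x: "0 \<le> x" "x \<le> 1" and fx: "dyadic (f x)"
  shows "dyadic x"
proof (cases "x = 1")
  case True
  then show ?thesis using dyadicI[of 1 0] by simp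
next
  case False
  obtain M where M: "\<And>K a. M \<le> K \<Longrightarrow> a < (2::nat) ^ K \<Longrightarrow>
    \<exists>(k::int) c. \<forall>x\<in>{real a / 2 ^ K..(real a + 1) / 2 ^ K}. f x = 2 powi k * x + c"
    using F_grid[OF f] by metis
  \<comment> \<open>The index of the half-open cell that contains x; this is why x = 1 is treated
    apart.\<close>
  define a where "a = nat \<lfloor>x * 2 ^ M\<rfloor>"
  have ra: "real a = of_int \<lfloor>x * 2 ^ M\<rfloor>" using x by (simp add: a_def)
  have a: "real a \<le> x * 2 ^ M" "x * 2 ^ M < real a + 1" unfolding ra by linarith+
  have "x * 2 ^ M < 2 ^ M" using x False by simp
  then have "real a < 2 ^ M" using a by linarith
  then have a2: "a < 2 ^ M" by (metis of_nat_less_iff of_nat_numeral of_nat_power)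
  obtain k c where kc: "\<forall>x\<in>{real a / 2 ^ M..(real a + 1) / 2 ^ M}. f x = 2 powi (k::int) * x + c"
    using M[OF order_refl a2] by blast
  have "f (real a / 2 ^ M) = 2 powi k * (real a / 2 ^ M) + c" "f x = 2 powi k * x + c"
    using a by (intro kc[rule_format]; simp add: pos_divide_le_eq pos_le_divide_eq divide_right_mono)+
  then have "f x - f (real a / 2 ^ M) = 2 powi k * (x - real a / 2 ^ M)"
    by (simp add: right_diff_distrib)
  then have "2 powi (- k) * (f x - f (real a / 2 ^ M)) = x - real a / 2 ^ M"
    by (simp add: power_int_minus)
  then have x_eq: "x = real a / 2 ^ M + 2 powi (- k) * (f x - f (real a / 2 ^ M))" by simp
  have da: "dyadic (real a / 2 ^ M)" using dyadicI[of "int a" M] by simp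
  moreover have "dyadic (f (real a / 2 ^ M))"
    using F_dyadic[OF f da] \<open>real a < 2 ^ M\<close> by simp
  ultimately show ?thesis
    using fx by (subst x_eq) (intro dyadic_add dyadic_powi_mult dyadic_diff)
qed

section \<open>The group axioms for F\<close>

lemma restrict_id_in_F: "(\<lambda>x\<in>{0..1}. x) \<in> F_set"
proof -
  have "homeomorphic_map (top_of_set {0..1::real}) (top_of_set {0..1}) (\<lambda>x\<in>{0..1}. x)"
    by (rule homeomorphic_map_eq[OF homeomorphic_map_id[THEN iffD2]]) auto
  moreover have "\<exists>B. finite B \<and> B \<subseteq> dyadics \<and> (\<forall>a b::real. 0 \<le> a \<and> a < b \<and> b \<le> 1 \<and> {a<..<b} \<inter> B = {} \<longrightarrow>
         (\<exists>(k::int) c. \<forall>x\<in>{a..b}. (\<lambda>x\<in>{0..1}. x) x = 2 powi k * x + c))"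
    by (intro exI[of _ "{}"] conjI allI impI exI[of _ "0::int"] exI[of _ "0::real"]) auto
  ultimately show ?thesis
    by (auto simp: F_set_def strict_mono_on_def)
qed

lemma F_inv:
  assumes f: "f \<in> F_set"
  shows "(\<lambda>x\<in>{0..1}. inv_into {0..1} f x) \<in> F_set"
proof -
  define g where "g = (\<lambda>x\<in>{0..1}. inv_into {0..1} f x)"
  note b = F_bij[OF f]
  have gr: "g y \<in> {0..1}" and fg: "f (g y) = y" if "y \<in> {0..1}" for y
    using that b bij_betw_inv_into_right[OF b, of y] bij_betwE[OF bij_betw_inv_into[OF b]] by (auto simp: g_def)
  have gf: "g (f x) = x" if "x \<in> {0..1}" for x
    using that bij_betw_inv_into_left[OF b that] bij_betwE[OF b] by (simp add: g_def)
  have mono: "g x < g y" if "x \<in> {0..1}" "y \<in> {0..1}" "x < y" for x y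
    using F_less_iff[OF f, of "g x" "g y"] gr[OF that(1)] gr[OF that(2)] fg that by simp
  have hom: "homeomorphic_map (top_of_set {0..1}) (top_of_set {0..1}) g"
  proof -
    have "homeomorphic_map (top_of_set {0..1}) (top_of_set {0..1}) f"
      using f by (simp add: F_set_def)
    then obtain g' where g': "homeomorphic_maps (top_of_set {0..1}) (top_of_set {0..1}) f g'"
      by (auto simp: homeomorphic_map_maps)
    then have "homeomorphic_map (top_of_set {0..1}) (top_of_set {0..1}) g'"
      using homeomorphic_map_maps homeomorphic_maps_sym by blast
    moreover have "g' y = g y" if "y \<in> {0..1}" for y
    proof -
      have "f (g' y) = y" "g' y \<in> {0..1}"
        using g' that unfolding homeomorphic_maps_def by (auto simp: continuous_map_def)
      then show ?thesis using gf[of "g' y"] by simp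
    qed
    ultimately show ?thesis by (metis homeomorphic_map_eq topspace_euclidean_subtopology)
  qed
  obtain B where B: "finite B" "B \<subseteq> dyadics" and
    aff: "\<And>a b. 0 \<le> a \<Longrightarrow> a < b \<Longrightarrow> b \<le> 1 \<Longrightarrow> {a<..<b} \<inter> B = {} \<Longrightarrow>
         \<exists>(k::int) c. \<forall>x\<in>{a..b}. f x = 2 powi k * x + c"
    using F_pieces[OF f] by metis
  have "\<exists>B. finite B \<and> B \<subseteq> dyadics \<and> (\<forall>a b. 0 \<le> a \<and> a < b \<and> b \<le> 1 \<and> {a<..<b} \<inter> B = {} \<longrightarrow>
         (\<exists>(k::int) c. \<forall>x\<in>{a..b}. g x = 2 powi k * x + c))"
  \<comment> \<open>The breakpoints of the inverse are the images of those of \<open>f\<close>.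
    \<open>B\<close> may have members beyond 1, where the extensional \<open>f\<close> carries no
    information.\<close>
  proof (intro exI[of _ "f ` (B \<inter> {0..1})"] conjI allI impI)
    show "f ` (B \<inter> {0..1}) \<subseteq> dyadics"
      using B F_dyadic[OF f] F_range[OF f] by (auto simp: dyadics_iff_dyadic subset_iff)
    fix a b :: real assume ab: "0 \<le> a \<and> a < b \<and> b \<le> 1 \<and> {a<..<b} \<inter> f ` (B \<inter> {0..1}) = {}"
    have "{g a<..<g b} \<inter> B = {}"
    proof (rule equals0I)
      fix x assume x: "x \<in> {g a<..<g b} \<inter> B"
      then have x01: "x \<in> {0..1}" using gr[of a] gr[of b] ab by auto
      then have "f (g a) < f x" "f x < f (g b)"
        using x gr[of a] gr[of b] ab F_less_iff[OF f] by auto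
      then have "f x \<in> {a<..<b}" using fg ab by auto
      then show False using ab x x01 by blast
    qed
    then obtain k c where kc: "\<forall>x\<in>{g a..g b}. f x = 2 powi (k::int) * x + c"
      using aff[of "g a" "g b"] gr[of a] gr[of b] mono[of a b] ab by auto
    have "\<forall>y\<in>{a..b}. g y = 2 powi (- k) * y + (- (2 powi (- k) * c))"
    proof
      fix y assume y: "y \<in> {a..b}"
      then have y01: "y \<in> {0..1}" using ab by auto
      have "g a \<le> g y" "g y \<le> g b" using y ab mono[of a y] mono[of y b] by (force simp: le_less)+
      then have "y = 2 powi k * g y + c" using kc fg[OF y01] by auto
      then have "2 powi (- k) * y = 2 powi (- k) * (2 powi k * g y + c)" by simp
      then show "g y = 2 powi (- k) * y + (- (2 powi (- k) * c))"
        by (simp add: power_int_minus field_simps)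
    qed
    then show "\<exists>(k::int) c. \<forall>x\<in>{a..b}. g x = 2 powi k * x + c" by blast
  qed (use B in auto)
  then have "g \<in> F_set"
    using hom mono by (auto simp: F_set_def strict_mono_on_def g_def)
  then show ?thesis by (simp add: g_def)
qed

lemma F_compose:
  assumes f: "f \<in> F_set" and g: "g \<in> F_set"
  shows "compose {0..1} g f \<in> F_set"
proof -
  have "homeomorphic_map (top_of_set {0..1}) (top_of_set {0..1}) (g \<circ> f)"
    using f g by (auto simp: F_set_def intro: homeomorphic_map_compose)
  then have hom: "homeomorphic_map (top_of_set {0..1}) (top_of_set {0..1}) (compose {0..1} g f)"
    by (rule homeomorphic_map_eq) (simp add: compose_def)
  obtain B where B: "finite B" "B \<subseteq> dyadics" and
    aff: "\<And>a b. 0 \<le> a \<Longrightarrow> a < b \<Longrightarrow> b \<le> 1 \<Longrightarrow> {a<..<b} \<inter> B = {} \<Longrightarrow>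
         \<exists>(k::int) c. \<forall>x\<in>{a..b}. f x = 2 powi k * x + c"
    using F_pieces[OF f] by metis
  obtain B' where B': "finite B'" "B' \<subseteq> dyadics" and
    aff': "\<And>a b. 0 \<le> a \<Longrightarrow> a < b \<Longrightarrow> b \<le> 1 \<Longrightarrow> {a<..<b} \<inter> B' = {} \<Longrightarrow>
         \<exists>(k::int) c. \<forall>x\<in>{a..b}. g x = 2 powi k * x + c"
    using F_pieces[OF g] by metis
  have "\<exists>B. finite B \<and> B \<subseteq> dyadics \<and> (\<forall>a b. 0 \<le> a \<and> a < b \<and> b \<le> 1 \<and> {a<..<b} \<inter> B = {} \<longrightarrow>
         (\<exists>(k::int) c. \<forall>x\<in>{a..b}. compose {0..1} g f x = 2 powi k * x + c))"
  \<comment> \<open>A point is critical if \<open>f\<close> breaks there or if \<open>f\<close>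
    sends it to a breakpoint of \<open>g\<close>.\<close>
  proof (intro exI[of _ "B \<union> {x \<in> {0..1}. f x \<in> B'}"] conjI allI impI)
    have "inj_on f {0..1}" using F_bij[OF f] by (simp add: bij_betw_def)
    then show "finite (B \<union> {x \<in> {0..1}. f x \<in> B'})"
      using B(1) finite_vimage_IntI[OF B'(1), of f "{0..1}"]
      by (simp add: vimage_def Int_def Collect_conj_eq[symmetric] conj_commute)
    show "B \<union> {x \<in> {0..1}. f x \<in> B'} \<subseteq> dyadics"
      using B B' F_dyadic_rev[OF f] by (auto simp: dyadics_iff_dyadic subset_iff)
    fix a b :: real assume ab: "0 \<le> a \<and> a < b \<and> b \<le> 1 \<and> {a<..<b} \<inter> (B \<union> {x \<in> {0..1}. f x \<in> B'}) = {}"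
    then have "{a<..<b} \<inter> B = {}" by blast
    then obtain k c where kc: "\<forall>x\<in>{a..b}. f x = 2 powi (k::int) * x + c"
      using aff[of a b] ab by auto
    have "{f a<..<f b} \<inter> B' = {}"
    proof (rule equals0I)
      fix y assume y: "y \<in> {f a<..<f b} \<inter> B'"
      then have "y \<in> {0..1}" using F_range[OF f, of a] F_range[OF f, of b] ab by auto
      then obtain x where x: "x \<in> {0..1}" "y = f x" using F_bij[OF f] by (metis bij_betw_def imageE)
      then have "x \<in> {a<..<b}" using y ab F_less_iff[OF f, of a x] F_less_iff[OF f, of x b] by auto
      then show False using ab x y by auto
    qed
    then obtain l d where ld: "\<forall>x\<in>{f a..f b}. g x = 2 powi (l::int) * x + d"
      using aff'[of "f a" "f b"] F_range[OF f] F_strict_mono[OF f, of a b] ab by auto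
    have "\<forall>x\<in>{a..b}. compose {0..1} g f x = 2 powi (l + k) * x + (2 powi l * c + d)"
    proof
      fix x assume x: "x \<in> {a..b}"
      then have "f a \<le> f x" "f x \<le> f b"
        using F_strict_mono[OF f, of a x] F_strict_mono[OF f, of x b] ab by (force simp: le_less)+
      then have "g (f x) = 2 powi l * f x + d" using ld by auto
      then show "compose {0..1} g f x = 2 powi (l + k) * x + (2 powi l * c + d)"
        using kc x ab by (simp add: compose_def power_int_add algebra_simps)
    qed
    then show "\<exists>(k::int) c. \<forall>x\<in>{a..b}. compose {0..1} g f x = 2 powi k * x + c" by blast
  qed
  moreover have "strict_mono_on {0..1} (compose {0..1} g f)"
    using F_strict_mono[OF f] F_strict_mono[OF g] F_range[OF f]
    by (auto simp: strict_mono_on_def compose_def)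
  ultimately show ?thesis using hom by (simp add: F_set_def)
qed

lemma F_subset_Bij: "F_set \<subseteq> Bij {0..1}"
  using F_bij F_ext by (auto simp: Bij_def)

lemma group_F: "group F_group"
  unfolding F_group_def
  by (rule group_right_action_groupI)
    (simp_all add: F_subset_Bij restrict_id_in_F F_compose F_inv)

section \<open>Binary words as names of dyadic rationals\<close>

text \<open>The binary word \<open>w\<close> stands for the binary fraction \<open>0.w\<close> in \<open>bin_low\<close> and for the midpoint
  \<open>0.w1\<close> of the corresponding dyadic interval in \<open>bin_mid\<close>.\<close>

fun bin_low :: "bool list \<Rightarrow> real" where
  "bin_low [] = 0"
| "bin_low (b # w) = (of_bool b + bin_low w) / 2"

fun bin_mid :: "bool list \<Rightarrow> real" where
  "bin_mid [] = 1 / 2"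
| "bin_mid (b # w) = (of_bool b + bin_mid w) / 2"

lemma bin_low_append: "bin_low (u @ t) = bin_low u + bin_low t / 2 ^ length u"
  by (induction u) (simp_all add: field_simps)

lemma bin_mid_append: "bin_mid (u @ t) = bin_low u + bin_mid t / 2 ^ length u"
  by (induction u) (simp_all add: field_simps)

lemma bin_mid_bounds: "0 < bin_mid w" "bin_mid w < 1"
  by (induction w) (auto simp: of_bool_def)

lemma bin_low_bounds: "0 \<le> bin_low w" "bin_low w < 1"
  by (induction w) (auto simp: of_bool_def)

lemma bin_low_grid: "\<exists>a. bin_low w = real a / 2 ^ length w \<and> a < 2 ^ length w"
proof (induction w)
  case (Cons b w)
  then obtain a where "bin_low w = real a / 2 ^ length w" "a < 2 ^ length w" by blast
  then show ?case
    by (intro exI[of _ "of_bool b * 2 ^ length w + a"]) (auto simp: field_simps of_bool_def)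
qed simp

lemma bin_low_surj:
  assumes "a < 2 ^ k"
  shows "\<exists>w. length w = k \<and> bin_low w = real a / 2 ^ k"
  using assms
proof (induction k arbitrary: a)
  case (Suc k)
  define b where "b = (a \<ge> 2 ^ k)"
  have "a - of_bool b * 2 ^ k < 2 ^ k" using Suc.prems by (auto simp: b_def)
  then obtain w where w: "length w = k" "bin_low w = real (a - of_bool b * 2 ^ k) / 2 ^ k"
    using Suc.IH by blast
  have "bin_low (b # w) = real a / 2 ^ Suc k"
    by (cases b) (auto simp: w b_def of_nat_diff field_simps)
  then show ?case using w(1) by (intro exI[of _ "b # w"]) simp
qed simp

text \<open>The first letter decides on which side of 1/2 the value lies, and only the empty word
  gives 1/2 itself.\<close>

lemma bin_mid_inject: "bin_mid u = bin_mid v \<longleftrightarrow> u = v"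
proof (induction u arbitrary: v)
  case Nil
  show ?case
    by (cases v) (use bin_mid_bounds[of "tl v"] in \<open>auto simp: of_bool_def\<close>)
next
  case (Cons b u)
  show ?case
  proof (cases v)
    case Nil
    then show ?thesis using bin_mid_bounds[of u] by (auto simp: of_bool_def)
  next
    case (Cons c w)
    then show ?thesis
      using Cons.IH[of w] bin_mid_bounds[of u] bin_mid_bounds[of w] by (auto simp: of_bool_def)
  qed
qed

lemma bin_mid_surj:
  assumes "dyadic x" "0 < x" "x < 1"
  shows "\<exists>w. bin_mid w = x"
proof -
  obtain K where "\<And>k. K \<le> k \<Longrightarrow> \<exists>a::nat. x = real a / 2 ^ k"
    using dyadic_grid[of x] assms by auto
  then obtain a where x: "x = real a / 2 ^ K" by blast
  have "\<exists>w. bin_mid w = real a / 2 ^ K" if "0 < a" "a < 2 ^ K" for a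
    using that
  proof (induction K arbitrary: a)
    case (Suc K)
    consider "a < 2 ^ K" | "a = 2 ^ K" | "a > 2 ^ K" by linarith
    then show ?case
    proof cases
      case 1
      then obtain w where "bin_mid w = real a / 2 ^ K" using Suc by blast
      then have "bin_mid (False # w) = real a / 2 ^ Suc K" by simp
      then show ?thesis by blast
    next
      case 2
      then have "bin_mid [] = real a / 2 ^ Suc K" by simp
      then show ?thesis by blast
    next
      case 3
      then have "0 < a - 2 ^ K" "a - 2 ^ K < 2 ^ K" using Suc.prems by auto
      then obtain w where "bin_mid w = real (a - 2 ^ K) / 2 ^ K" using Suc.IH by blast
      then have "bin_mid (True # w) = real a / 2 ^ Suc K"
        using 3 by (simp add: of_nat_diff field_simps)
      then show ?thesis by blast
    qed
  qed simp
  moreover have "0 < a" "a < 2 ^ K"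
    using assms(2,3) unfolding x by (auto simp: field_simps zero_less_divide_iff)
  ultimately show ?thesis unfolding x by blast
qed

lemma dyadic_bin_mid: "dyadic (bin_mid w)"
proof -
  obtain a where "bin_low w = real a / 2 ^ length w" using bin_low_grid by blast
  then have "bin_mid w = of_int (int (2 * a + 1)) / 2 ^ (length w + 1)"
    using bin_mid_append[of w "[]"] by (simp add: field_simps)
  then show ?thesis by (metis dyadicI)
qed

section \<open>The permutation of binary words induced by an element of F\<close>

definition F_word :: "(real \<Rightarrow> real) \<Rightarrow> bool list \<Rightarrow> bool list" where
  "F_word f w = (SOME v. bin_mid v = f (bin_mid w))"

lemma bin_mid_F_word:
  assumes f: "f \<in> F_set"
  shows "bin_mid (F_word f w) = f (bin_mid w)"
proof -
  have "\<exists>v. bin_mid v = f (bin_mid w)"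
    using F_strict_mono[OF f, of 0 "bin_mid w"] F_strict_mono[OF f, of "bin_mid w" 1]
      bin_mid_bounds[of w] F_0[OF f] F_1[OF f] F_dyadic[OF f dyadic_bin_mid]
    by (intro bin_mid_surj) auto
  then show ?thesis unfolding F_word_def by (rule someI_ex)
qed

lemma F_word_mono:
  assumes "f \<in> F_set" "bin_mid u < bin_mid v"
  shows "bin_mid (F_word f u) < bin_mid (F_word f v)"
  using assms F_strict_mono[OF assms(1)] bin_mid_bounds[of u] bin_mid_bounds[of v]
  by (simp add: bin_mid_F_word)

lemma F_word_one: "F_word \<one>\<^bsub>F_group\<^esub> w = w"
proof -
  have "bin_mid (F_word (\<lambda>x\<in>{0..1}. x) w) = bin_mid w"
    using bin_mid_bounds[of w] by (simp add: bin_mid_F_word restrict_id_in_F)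
  then show ?thesis by (simp add: F_group_def bin_mid_inject)
qed

lemma F_word_mult:
  assumes "f \<in> F_set" "g \<in> F_set"
  shows "F_word (f \<otimes>\<^bsub>F_group\<^esub> g) w = F_word g (F_word f w)"
proof -
  have "bin_mid (F_word (compose {0..1} g f) w) = bin_mid (F_word g (F_word f w))"
    using bin_mid_bounds[of w] assms by (simp add: bin_mid_F_word F_compose compose_eq)
  then show ?thesis by (simp add: F_group_def bin_mid_inject)
qed

text \<open>In this form piecewise linearity enters the action on the Cantor space: behind a long
  enough word, letters are merely copied.\<close>

definition eventually_prefix :: "(bool list \<Rightarrow> bool list) \<Rightarrow> bool" where
  "eventually_prefix \<beta> \<longleftrightarrow> (\<exists>M. \<forall>u t. M \<le> length u \<longrightarrow> \<beta> (u @ t) = \<beta> u @ t)"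

text \<open>On the cell of a word u of length M the map is affine with slope 2^k. Hence the subcell
  of u s goes to an interval of length 2^-L with L = M + length s - k. If the left end of this
  interval is a multiple of 2^-L, the interval is itself the cell of a word v, and an affine map
  between cells sends the midpoint named by u s t to the one named by v t.\<close>

lemma eventually_prefix_F_word:
  assumes f: "f \<in> F_set"
  shows "eventually_prefix (F_word f)"
proof -
  obtain M where M: "\<And>K a. M \<le> K \<Longrightarrow> a < (2::nat) ^ K \<Longrightarrow>
    \<exists>(k::int) c. \<forall>x\<in>{real a / 2 ^ K..(real a + 1) / 2 ^ K}. f x = 2 powi k * x + c"
    using F_grid[OF f] by metis
  have piece: "\<exists>S. \<forall>s. S \<le> length s \<longrightarrow> (\<exists>v. \<forall>t. F_word f (u @ s @ t) = v @ t)"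
    if u: "length u = M" for u
  proof -
    obtain a where a: "bin_low u = real a / 2 ^ M" "a < 2 ^ M"
      using bin_low_grid[of u] u by auto
    obtain k c where kc: "\<forall>x\<in>{real a / 2 ^ M..(real a + 1) / 2 ^ M}. f x = 2 powi (k::int) * x + c"
      using M[OF order_refl a(2)] by blast
    have aff: "f (bin_low u + z / 2 ^ M) = f (bin_low u) + 2 powi k * (z / 2 ^ M)"
      if "0 \<le> z" "z \<le> 1" for z
    proof -
      have "f (bin_low u + z / 2 ^ M) = 2 powi k * (bin_low u + z / 2 ^ M) + c"
        "f (bin_low u) = 2 powi k * bin_low u + c"
        using that a(1) by (intro kc[rule_format]; simp add: add_divide_distrib divide_right_mono)+
      then show ?thesis by (simp add: algebra_simps)
    qed
    have "dyadic (f (bin_low u))"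
      using F_dyadic[OF f, of "bin_low u"] bin_low_bounds[of u] dyadicI[of "int a" M] a(1) by simp
    then obtain i e where ie: "f (bin_low u) = of_int i / 2 ^ e" by (auto simp: dyadic_def)
    show ?thesis
    \<comment> \<open>From this length on L \<ge> e, so that \<open>f (bin_low u)\<close>, with
      denominator 2^e, lies on the grid of width 2^-L.\<close>
    proof (intro exI[of _ "nat (int e + k)"] allI impI)
      fix s :: "bool list" assume s: "nat (int e + k) \<le> length s"
      define L where "L = nat (int M + int (length s) - k)"
      have L: "int L = int M + int (length s) - k" and eL: "e \<le> L"
        using s by (auto simp: L_def)
      have L2: "2 powi k / 2 ^ (M + length s) = (1 / 2 ^ L :: real)"
      proof -
        have "(2::real) powi k * 2 ^ L = 2 powi (k + int L)" by (simp add: power_int_add)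
        also have "k + int L = int (M + length s)" using L by simp
        finally have "(2::real) powi k * 2 ^ L = 2 ^ (M + length s)"
          by (simp only: power_int_of_nat)
        then show ?thesis by (simp add: field_simps)
      qed
      obtain j where j: "bin_low s = real j / 2 ^ length s" using bin_low_grid by blast
      \<comment> \<open>The numerator of the left end of the image cell over the denominator
        2^L.\<close>
      define A where "A = i * 2 ^ (L - e) + int j"
      have low: "f (bin_low (u @ s)) = of_int A / 2 ^ L"
      proof -
        have "f (bin_low (u @ s)) = of_int i / 2 ^ e + 2 powi k / 2 ^ (M + length s) * real j"
          using aff[of "bin_low s"] bin_low_bounds[of s] u
          by (simp add: bin_low_append ie j power_add)
        also have "\<dots> = of_int A / 2 ^ L"
          using eL by (simp only: L2) (simp add: A_def field_simps flip: power_add)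
        finally show ?thesis .
      qed
      have "0 \<le> f (bin_low (u @ s))" "f (bin_low (u @ s)) < 1"
        using bin_low_bounds[of "u @ s"] F_strict_mono[OF f, of "bin_low (u @ s)" 1] F_range[OF f]
          F_1[OF f] by auto
      then have "0 \<le> real_of_int A" "real_of_int A < 2 ^ L"
        unfolding low by (simp_all add: pos_le_divide_eq)
      then have "0 \<le> A" "real_of_int A < real_of_int (2 ^ L)" by simp_all
      then have "0 \<le> A" "A < 2 ^ L" by (simp_all only: of_int_less_iff)
      then have "nat A < 2 ^ L" by (simp add: nat_less_iff)
      then obtain v where v: "length v = L" "bin_low v = real (nat A) / 2 ^ L"
        using bin_low_surj by blast
      have "F_word f (u @ s @ t) = v @ t" for t
      proof -
        have "f (bin_mid (u @ s @ t)) = f (bin_low u) + 2 powi k * (bin_mid (s @ t) / 2 ^ M)"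
          using aff[of "bin_mid (s @ t)"] bin_mid_bounds[of "s @ t"] u
          by (simp add: bin_mid_append[of u])
        also have "\<dots> = f (bin_low u) + 2 powi k * (bin_low s / 2 ^ M)
            + 2 powi k / 2 ^ (M + length s) * bin_mid t"
          by (simp add: bin_mid_append[of s] power_add field_simps)
        also have "\<dots> = f (bin_low (u @ s)) + bin_mid t / 2 ^ L"
          using aff[of "bin_low s"] bin_low_bounds[of s] u
          by (simp add: L2) (simp add: bin_low_append)
        also have "\<dots> = bin_mid (v @ t)"
          using \<open>0 \<le> A\<close> by (simp add: low bin_mid_append v)
        finally show ?thesis using f by (simp add: bin_mid_F_word flip: bin_mid_inject)
      qed
      then show "\<exists>v. \<forall>t. F_word f (u @ s @ t) = v @ t" by blast
    qed
  qed
  then obtain S where S: "\<And>u s. length u = M \<Longrightarrow> S u \<le> length s \<Longrightarrow>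
      \<exists>v. \<forall>t. F_word f (u @ s @ t) = v @ t" by metis
  have fin: "finite {u :: bool list. length u = M}"
    using finite_lists_length_eq[of "UNIV :: bool set" M] by simp
  \<comment> \<open>There are only finitely many words of length M, so their individual bounds have
    a maximum.\<close>
  define N where "N = M + Max (S ` {u. length u = M})"
  have "F_word f (u @ t) = F_word f u @ t" if "N \<le> length u" for u t
  proof -
    have "length (take M u) = M" using that by (simp add: N_def)
    moreover have "S (take M u) \<le> Max (S ` {u. length u = M})"
      using fin calculation by (intro Max_ge) auto
    moreover have "length (drop M u) \<ge> Max (S ` {u. length u = M})"
      using that by (simp add: N_def)
    ultimately obtain v where v: "\<forall>t. F_word f (take M u @ drop M u @ t) = v @ t"
      using S[of "take M u" "drop M u"] by auto
    have "F_word f (u @ t) = v @ t" for t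
      using v[rule_format, of t] by (simp only: append_assoc[symmetric] append_take_drop_id)
    \<comment> \<open>The empty tail identifies v as \<open>F_word f u\<close>.\<close>
    from this[of t] this[of "[]"] show ?thesis by simp
  qed
  then show ?thesis unfolding eventually_prefix_def by blast
qed

lemma bin_mid_dense:
  assumes "0 \<le> a" "a < b" "b \<le> 1"
  shows "\<exists>w. a < bin_mid w \<and> bin_mid w < b"
proof -
  obtain K where K: "(1 / 2) ^ K < b - a"
    using real_arch_pow_inv[of "b - a" "1/2"] assms by auto
  define x where "x = of_int (\<lfloor>a * 2 ^ K\<rfloor> + 1) / (2::real) ^ K"
  have "a * 2 ^ K < of_int (\<lfloor>a * 2 ^ K\<rfloor> + 1)" "of_int (\<lfloor>a * 2 ^ K\<rfloor> + 1) \<le> a * 2 ^ K + 1"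
    by linarith+
  then have x1: "a < x" "x \<le> a + (1 / 2) ^ K"
    unfolding x_def by (simp_all add: field_simps)
  then have "0 < x" "x < 1" using K assms by linarith+
  moreover have "dyadic x" unfolding x_def by (rule dyadicI)
  ultimately show ?thesis using bin_mid_surj[of x] x1 K by force
qed

text \<open>If x and \<open>f x\<close> were different, a midpoint strictly between them would be
  fixed, against monotonicity.\<close>

lemma F_word_faithful:
  assumes f: "f \<in> F_set" and id: "\<And>w. F_word f w = w"
  shows "f = \<one>\<^bsub>F_group\<^esub>"
proof -
  have mid: "f (bin_mid w) = bin_mid w" for w using bin_mid_F_word[OF f, of w] id by simp
  have "f x = x" if x: "0 \<le> x" "x \<le> 1" for x
  proof (rule ccontr)
    assume "f x \<noteq> x"
    then consider "f x < x" | "x < f x" by linarith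
    then show False
    proof cases
      case 1
      then obtain w where w: "f x < bin_mid w" "bin_mid w < x"
        using bin_mid_dense[of "f x" x] F_range[OF f] x by auto
      then have "f (bin_mid w) < f x" using F_strict_mono[OF f] x bin_mid_bounds[of w] by simp
      then show False using w mid by simp
    next
      case 2
      then obtain w where w: "x < bin_mid w" "bin_mid w < f x"
        using bin_mid_dense[of x "f x"] F_range[OF f] x by auto
      then have "f x < f (bin_mid w)" using F_strict_mono[OF f] x bin_mid_bounds[of w] by simp
      then show False using w mid by simp
    qed
  qed
  then have "f = (\<lambda>x\<in>{0..1}. x)"
    using F_ext[OF f] by (intro extensionalityI[of f "{0..1}"]) auto
  then show ?thesis by (simp add: F_group_def)
qed

hide_const (open) Sublist.prefix Sublist.suffix
declare One_nat_def [simp del]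

section \<open>The groups of Higman and Thompson as groups of local prefix replacements\<close>

lemma undotted_points_iff: "x \<in> undotted_points n \<longleftrightarrow> (\<forall>i. x i < n)"
  by (auto simp: undotted_points_def)

lemma conc_in_undotted_points [simp]:
  "w \<frown> x \<in> undotted_points n \<longleftrightarrow> w \<in> lists {..<n} \<and> x \<in> undotted_points n"
proof -
  have "w \<frown> x \<in> undotted_points n \<longleftrightarrow> range (w \<frown> x) \<subseteq> {..<n}"
    by (simp only: undotted_points_def image_subset_iff_funcset)
  also have "\<dots> \<longleftrightarrow> w \<in> lists {..<n} \<and> x \<in> undotted_points n"
    by (simp add: undotted_points_def lists_eq_set flip: image_subset_iff_funcset)
  finally show ?thesis .
qed

lemma suffix_in_undotted_points [simp]: "x \<in> undotted_points n \<Longrightarrow> suffix k x \<in> undotted_points n"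
  by (simp add: undotted_points_iff)

lemma prefix_in_lists: "x \<in> undotted_points n \<Longrightarrow> prefix k x \<in> lists {..<n}"
  by (auto simp: undotted_points_iff)

lemma build_in_undotted_points [simp]:
  "c ## x \<in> undotted_points n \<longleftrightarrow> c < n \<and> x \<in> undotted_points n"
  using conc_in_undotted_points[of "[c]" x n] by (simp del: conc_in_undotted_points)

lemma cantor_1_iff: "p \<in> cantor n 1 \<longleftrightarrow> (\<exists>x\<in>undotted_points n. p = (0, x))"
  by (cases p) (auto simp: cantor_def)

lemma conc_eq_conc_cases:
  assumes "u \<frown> y = w \<frown> z" "length u \<le> length w"
  obtains s where "w = u @ s" "y = s \<frown> z"
proof -
  have "u \<frown> y = take (length u) w \<frown> (drop (length u) w \<frown> z)"
    using assms by simp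
  then have "u = take (length u) w" "y = drop (length u) w \<frown> z"
    using assms(2) by (simp_all del: conc_conc)
  then show thesis using that[of "drop (length u) w"] by (metis append_take_drop_id)
qed

text \<open>The words of length N are themselves a complete antichain, so one number stands for the
  antichain of the domain. The range is left out because bijectivity will determine it.\<close>

definition replaces_long_prefixes :: "nat \<Rightarrow> (dpoint \<Rightarrow> dpoint) \<Rightarrow> nat \<Rightarrow> bool" where
  "replaces_long_prefixes n g N \<longleftrightarrow> (\<forall>w\<in>lists {..<n}. length w = N \<longrightarrow>
     (\<exists>v\<in>lists {..<n}. \<forall>x\<in>undotted_points n. g (0, w \<frown> x) = (0, v \<frown> x)))"

text \<open>The length bound says that at most N letters are lost, so that a second map can still be
  applied to v in a composition.\<close>

lemma replaces_long_prefixesD: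
  assumes g: "replaces_long_prefixes n g N" and w: "w \<in> lists {..<n}" "N \<le> length w"
  obtains v where "v \<in> lists {..<n}" "length w \<le> length v + N"
    "\<forall>x\<in>undotted_points n. g (0, w \<frown> x) = (0, v \<frown> x)"
proof -
  have "take N w \<in> lists {..<n}" "drop N w \<in> lists {..<n}" "length (take N w) = N"
    using w set_take_subset[of N w] set_drop_subset[of N w] by auto
  then obtain v where v: "v \<in> lists {..<n}"
    "\<And>x. x \<in> undotted_points n \<Longrightarrow> g (0, take N w \<frown> x) = (0, v \<frown> x)"
    using g unfolding replaces_long_prefixes_def by metis
  have "g (0, w \<frown> x) = (0, (v @ drop N w) \<frown> x)" if "x \<in> undotted_points n" for x
    using v(2)[of "drop N w \<frown> x"] that \<open>drop N w \<in> lists {..<n}\<close> by simp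
  moreover have "v @ drop N w \<in> lists {..<n}" "length w \<le> length (v @ drop N w) + N"
    using v \<open>drop N w \<in> lists {..<n}\<close> by auto
  ultimately show thesis by (intro that[of "v @ drop N w"]) simp_all
qed

lemma replaces_long_prefixes_choice:
  assumes "replaces_long_prefixes n g N"
  obtains p where "\<forall>w\<in>lists {..<n}. length w = N \<longrightarrow> p w \<in> lists {..<n} \<and>
    (\<forall>x\<in>undotted_points n. g (0, w \<frown> x) = (0, p w \<frown> x))"
proof -
  define P where "P w v \<longleftrightarrow> v \<in> lists {..<n} \<and>
    (\<forall>x\<in>undotted_points n. g (0, w \<frown> x) = (0, v \<frown> x))" for w v
  have "P w (SOME v. P w v)" if "w \<in> lists {..<n}" "length w = N" for w
  proof (rule someI_ex)
    show "\<exists>v. P w v" using assms that unfolding replaces_long_prefixes_def P_def by blast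
  qed
  then show thesis by (intro that[of "\<lambda>w. SOME v. P w v"]) (unfold P_def, blast)
qed

text \<open>Let w be as long as the longest member of D. The member that covers some point of the
  cone of w is no longer than w, hence a prefix of w. Thus replacement rules for words of various
  lengths are turned into rules for a single length.\<close>

lemma replaces_long_prefixes_cover:
  assumes "0 < n" and D: "finite D" "D \<subseteq> lists {..<n}"
    and cover: "\<And>x. x \<in> undotted_points n \<Longrightarrow> \<exists>u\<in>D. \<exists>y\<in>undotted_points n. x = u \<frown> y"
    and g: "\<And>u. u \<in> D \<Longrightarrow>
      \<exists>v\<in>lists {..<n}. \<forall>x\<in>undotted_points n. g (0, u \<frown> x) = (0, v \<frown> x)"
  shows "\<exists>N. replaces_long_prefixes n g N"
proof (intro exI)
  define N where "N = Max (length ` D)"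
  show "replaces_long_prefixes n g N"
    unfolding replaces_long_prefixes_def
  proof (intro ballI impI)
    fix w assume w: "w \<in> lists {..<n}" "length w = N"
    have "(\<lambda>_. 0) \<in> undotted_points n" using \<open>0 < n\<close> by (simp add: undotted_points_iff)
    then have "w \<frown> (\<lambda>_. 0) \<in> undotted_points n" using w by simp
    then obtain u y where u: "u \<in> D" "w \<frown> (\<lambda>_. 0) = u \<frown> y" using cover by blast
    then have "length u \<le> length w" using D w by (simp add: N_def)
    with u(2) obtain s where s: "w = u @ s" by (metis conc_eq_conc_cases)
    obtain v where v: "v \<in> lists {..<n}" "\<forall>x\<in>undotted_points n. g (0, u \<frown> x) = (0, v \<frown> x)"
      using g u by blast
    have "\<forall>x\<in>undotted_points n. g (0, w \<frown> x) = (0, (v @ s) \<frown> x)"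
    proof
      fix x assume "x \<in> undotted_points n"
      then show "g (0, w \<frown> x) = (0, (v @ s) \<frown> x)"
        using v(2)[rule_format, of "s \<frown> x"] w s by simp
    qed
    moreover have "v @ s \<in> lists {..<n}" using v w s by simp
    ultimately show "\<exists>v\<in>lists {..<n}. \<forall>x\<in>undotted_points n. g (0, w \<frown> x) = (0, v \<frown> x)" by blast
  qed
qed

section \<open>The topology of the Cantor space\<close>

lemma topspace_cantor_topology: "topspace (cantor_topology n r) = cantor n r"
  by (auto simp: cantor_topology_def cantor_def undotted_points_def)

lemma compact_cantor_topology: "compact_space (cantor_topology n r)"
  by (simp add: cantor_topology_def compact_space_prod_topology compact_space_product_topology
      compact_space_discrete_topology)

lemma Hausdorff_cantor_topology: "Hausdorff_space (cantor_topology n r)"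
  by (simp add: cantor_topology_def Hausdorff_space_prod_topology Hausdorff_space_product_topology)

lemma continuous_map_letter:
  "continuous_map (cantor_topology n r) (discrete_topology {..<n}) (\<lambda>p. snd p i)"
proof -
  have "continuous_map (cantor_topology n r) (discrete_topology {..<n}) ((\<lambda>x. x i) \<circ> snd)"
    unfolding cantor_topology_def
    by (rule continuous_map_compose[OF continuous_map_snd]) (rule continuous_map_product_projection, simp)
  then show ?thesis by (simp add: comp_def)
qed

lemma openin_cantor_topologyI:
  assumes "S \<subseteq> cantor n 1"
    and S: "\<And>p q. p \<in> S \<Longrightarrow> q \<in> cantor n 1 \<Longrightarrow> (\<And>i. i < K \<Longrightarrow> snd p i = snd q i) \<Longrightarrow> q \<in> S"
  shows "openin (cantor_topology n 1) S"
proof (subst openin_subopen, intro ballI)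
  fix p assume p: "p \<in> S"
  have "openin (cantor_topology n 1) {q \<in> cantor n 1. \<forall>i<k. snd q i = snd p i}" for k
  proof (induction k)
    case 0
    then show ?case by (simp flip: topspace_cantor_topology)
  next
    case (Suc k)
    have "snd p k < n" using p assms(1) by (auto simp: cantor_def undotted_points_iff)
    then have "openin (cantor_topology n 1)
        {q \<in> topspace (cantor_topology n 1). snd q k \<in> {snd p k}}"
      by (intro openin_continuous_map_preimage[OF continuous_map_letter]) simp
    then have "openin (cantor_topology n 1)
        ({q \<in> cantor n 1. snd q k \<in> {snd p k}} \<inter> {q \<in> cantor n 1. \<forall>i<k. snd q i = snd p i})"
      using Suc by (intro openin_Int) (simp_all add: topspace_cantor_topology)
    moreover have "{q \<in> cantor n 1. snd q k \<in> {snd p k}} \<inter> {q \<in> cantor n 1. \<forall>i<k. snd q i = snd p i}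
        = {q \<in> cantor n 1. \<forall>i<Suc k. snd q i = snd p i}"
      by (auto simp: less_Suc_eq)
    ultimately show ?case by simp
  qed
  moreover have "{q \<in> cantor n 1. \<forall>i<K. snd q i = snd p i} \<subseteq> S" using S[OF p] by auto
  ultimately show "\<exists>T. openin (cantor_topology n 1) T \<and> p \<in> T \<and> T \<subseteq> S"
    using p assms(1) by (intro exI[of _ "{q \<in> cantor n 1. \<forall>i<K. snd q i = snd p i}"]) auto
qed

text \<open>Letter i of the image is determined by the first N + i + 1 letters of the argument,
  hence continuity. Continuity of the inverse comes from compactness and the Hausdorff
  property.\<close>

lemma homeomorphic_map_cantorI:
  assumes bij: "bij_betw g (cantor n 1) (cantor n 1)" and g: "replaces_long_prefixes n g N"
  shows "homeomorphic_map (cantor_topology n 1) (cantor_topology n 1) g"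
proof (rule continuous_imp_homeomorphic_map)
  show "g ` topspace (cantor_topology n 1) = topspace (cantor_topology n 1)"
    "inj_on g (topspace (cantor_topology n 1))"
    using bij by (simp_all add: topspace_cantor_topology bij_betw_def)
  have in_X: "g p \<in> cantor n 1" if "p \<in> cantor n 1" for p using bij_betwE[OF bij] that by blast
  have "continuous_map (cantor_topology n 1) (discrete_topology {..<n}) (\<lambda>p. snd (g p) i)" for i
    unfolding continuous_map topspace_cantor_topology
  proof (intro conjI allI impI)
    show "(\<lambda>p. snd (g p) i) ` cantor n 1 \<subseteq> topspace (discrete_topology {..<n})"
    proof
      fix c assume "c \<in> (\<lambda>p. snd (g p) i) ` cantor n 1"
      then obtain p where "p \<in> cantor n 1" "c = snd (g p) i" by blast
      then show "c \<in> topspace (discrete_topology {..<n})"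
        using in_X[of p] by (auto simp: cantor_1_iff undotted_points_iff)
    qed
    fix U
    show "openin (cantor_topology n 1) {p \<in> cantor n 1. snd (g p) i \<in> U}"
    proof (rule openin_cantor_topologyI[where K = "N + i + 1"])
      fix p q assume p: "p \<in> {p \<in> cantor n 1. snd (g p) i \<in> U}" and q: "q \<in> cantor n 1"
        and eq: "\<And>j. j < N + i + 1 \<Longrightarrow> snd p j = snd q j"
      obtain x y where x: "p = (0, x)" "x \<in> undotted_points n" and y: "q = (0, y)" "y \<in> undotted_points n"
        using p q by (auto simp: cantor_1_iff)
      have pre: "prefix N x = prefix N y"
        using eq by (intro nth_equalityI) (auto simp: x y)
      have "N \<le> length (prefix N x)" by simp
      then obtain v where v: "\<forall>z\<in>undotted_points n. g (0, prefix N x \<frown> z) = (0, v \<frown> z)"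
        by (rule replaces_long_prefixesD[OF g prefix_in_lists[OF x(2), of N]])
      have "snd (g p) = v \<frown> suffix N x"
        using bspec[OF v, of "suffix N x"] x by (simp del: prefix_suffix add: prefix_suffix[symmetric])
      moreover have "snd (g q) = v \<frown> suffix N y"
        using bspec[OF v, of "suffix N y"] y pre by (simp del: prefix_suffix add: prefix_suffix[symmetric])
      moreover have "(v \<frown> suffix N x) i = (v \<frown> suffix N y) i"
        using eq by (simp add: conc_def x y)
      ultimately show "q \<in> {p \<in> cantor n 1. snd (g p) i \<in> U}" using p q by simp
    qed simp
  qed
  then have "continuous_map (cantor_topology n 1)
      (product_topology (\<lambda>i. discrete_topology {..<n}) UNIV) (snd \<circ> g)"
    by (simp add: continuous_map_componentwise_UNIV comp_def)
  moreover have "continuous_map (cantor_topology n 1) (discrete_topology {..<1}) (fst \<circ> g)"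
  proof (rule continuous_map_eq)
    show "continuous_map (cantor_topology n 1) (discrete_topology {..<1}) (\<lambda>_. 0::nat)"
      by (simp add: One_nat_def)
    show "0 = (fst \<circ> g) p" if "p \<in> topspace (cantor_topology n 1)" for p
      using in_X[of p] that by (force simp: topspace_cantor_topology cantor_1_iff)
  qed
  ultimately show "continuous_map (cantor_topology n 1) (cantor_topology n 1) g"
    by (subst (2) cantor_topology_def) (simp add: continuous_map_pairwise)
qed (simp_all add: compact_cantor_topology Hausdorff_cantor_topology)

section \<open>Complete antichains and prefixes of a fixed length\<close>

lemma cone_1: "cone n (0, w) = (\<lambda>x. (0, w \<frown> x)) ` undotted_points n"
  by (simp add: cone_def dconc_def)

lemma dwords_1_iff: "u \<in> dwords n 1 \<longleftrightarrow> (\<exists>w\<in>lists {..<n}. u = (0, w))"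
  by (cases u) (auto simp: dwords_def)

lemma complete_antichain_cover:
  assumes "complete_antichain n 1 A" "x \<in> undotted_points n"
  obtains u y where "(0, u) \<in> A" "u \<in> lists {..<n}" "y \<in> undotted_points n" "x = u \<frown> y"
proof -
  have "(0, x) \<in> (\<Union>u\<in>A. cone n u)"
    using assms by (auto simp: complete_antichain_def cantor_1_iff)
  then obtain u where u: "u \<in> A" "(0, x) \<in> cone n u" by blast
  have "A \<subseteq> dwords n 1" using assms(1) by (simp add: complete_antichain_def)
  then have "u \<in> dwords n 1" using u(1) by (rule subsetD)
  then obtain w where "u = (0, w)" "w \<in> lists {..<n}" unfolding dwords_1_iff by (elim bexE)
  then show thesis using u that by (auto simp: cone_1)
qed

text \<open>For the converse the antichain of the domain consists of all words of length N. Their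
  replacements are incomparable because g is injective, and their cones cover the space because g is
  surjective.\<close>

lemma G_set_iff:
  assumes "0 < n"
  shows "g \<in> G_set n 1 \<longleftrightarrow> g \<in> Bij (cantor n 1) \<and> (\<exists>N. replaces_long_prefixes n g N)"
proof (intro iffI conjI)
  assume g: "g \<in> G_set n 1"
  have "homeomorphic_map (cantor_topology n 1) (cantor_topology n 1) g" "g \<in> extensional (cantor n 1)"
    using g by (auto simp: G_set_def)
  then show "g \<in> Bij (cantor n 1)"
    using homeomorphic_imp_injective_map homeomorphic_imp_surjective_map
    by (fastforce simp: Bij_def bij_betw_def topspace_cantor_topology)
  obtain A B \<pi> where "replaces_prefixes n 1 g A B \<pi>" using g by (auto simp: G_set_def)
  then have A: "complete_antichain n 1 A" and B: "complete_antichain n 1 B" and \<pi>: "bij_betw \<pi> A B"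
    and act: "\<And>u x. u \<in> A \<Longrightarrow> x \<in> undotted_points n \<Longrightarrow> g (dconc u x) = dconc (\<pi> u) x"
    by (auto simp: replaces_prefixes_def)
  have AD: "finite A" "A \<subseteq> dwords n 1" and BD: "B \<subseteq> dwords n 1"
    using A B by (auto simp: complete_antichain_def)
  show "\<exists>N. replaces_long_prefixes n g N"
  proof (rule replaces_long_prefixes_cover[OF assms])
    show "finite (snd ` A)" "snd ` A \<subseteq> lists {..<n}" using AD by (auto simp: dwords_def)
    show "\<exists>u\<in>snd ` A. \<exists>y\<in>undotted_points n. x = u \<frown> y" if "x \<in> undotted_points n" for x
      using complete_antichain_cover[OF A that] by (metis image_eqI snd_conv)
    fix w assume "w \<in> snd ` A"
    then have w: "(0, w) \<in> A" using AD by (force simp: dwords_def)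
    then have "\<pi> (0, w) \<in> B" using \<pi> bij_betwE by blast
    then obtain v where v: "v \<in> lists {..<n}" "\<pi> (0, w) = (0, v)" using BD dwords_1_iff by blast
    then show "\<exists>v\<in>lists {..<n}. \<forall>x\<in>undotted_points n. g (0, w \<frown> x) = (0, v \<frown> x)"
      using act[OF w] by (auto simp: dconc_def)
  qed
next
  assume g: "g \<in> Bij (cantor n 1) \<and> (\<exists>N. replaces_long_prefixes n g N)"
  then obtain N where N: "replaces_long_prefixes n g N" by blast
  have bij: "bij_betw g (cantor n 1) (cantor n 1)" and ext: "g \<in> extensional (cantor n 1)"
    using g by (auto simp: Bij_def)
  define A where "A = (\<lambda>w. (0::nat, w)) ` {w \<in> lists {..<n}. length w = N}"
  obtain p where "\<forall>w\<in>lists {..<n}. length w = N \<longrightarrow> p w \<in> lists {..<n} \<and>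
      (\<forall>x\<in>undotted_points n. g (0, w \<frown> x) = (0, p w \<frown> x))"
    by (rule replaces_long_prefixes_choice[OF N])
  then have p: "\<And>w. w \<in> lists {..<n} \<Longrightarrow> length w = N \<Longrightarrow> p w \<in> lists {..<n}"
    "\<And>w x. w \<in> lists {..<n} \<Longrightarrow> length w = N \<Longrightarrow> x \<in> undotted_points n \<Longrightarrow>
      g (0, w \<frown> x) = (0, p w \<frown> x)"
    by blast+
  define \<pi> where "\<pi> u = (0::nat, p (snd u))" for u :: dword
  have finA: "finite A"
    using finite_lists_length_eq[of "{..<n}" N] by (auto simp: A_def lists_eq_set)
  have o: "(\<lambda>_. 0) \<in> undotted_points n" using assms by (simp add: undotted_points_iff)
  \<comment> \<open>If \<open>p w' = p w @ s\<close>, then w s 0 0 ... and w' 0 0 ... have the same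
    image; as w and w' have equal length, they coincide.\<close>
  have pre: "w = w'" if w: "w \<in> lists {..<n}" "length w = N" "w' \<in> lists {..<n}" "length w' = N"
    and "Sublist.prefix (p w) (p w')" for w w'
  proof -
    obtain s where s: "p w' = p w @ s" using \<open>Sublist.prefix (p w) (p w')\<close> by (auto simp: Sublist.prefix_def)
    then have "s \<in> lists {..<n}" using p(1)[OF w(3,4)] by simp
    then have "s \<frown> (\<lambda>_. 0) \<in> undotted_points n" using o by simp
    then have "g (0, w \<frown> (s \<frown> (\<lambda>_. 0))) = g (0, w' \<frown> (\<lambda>_. 0))"
      using p(2)[OF w(1,2), of "s \<frown> (\<lambda>_. 0)"] p(2)[OF w(3,4) o] s by simp
    moreover have "(0, w \<frown> (s \<frown> (\<lambda>_. 0))) \<in> cantor n 1" "(0, w' \<frown> (\<lambda>_. 0)) \<in> cantor n 1"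
      using w o \<open>s \<in> lists {..<n}\<close> by (auto simp: cantor_1_iff)
    ultimately have "(0, w \<frown> (s \<frown> (\<lambda>_. 0))) = (0::nat, w' \<frown> (\<lambda>_. 0))"
      using inj_onD[OF bij_betw_imp_inj_on[OF bij]] by presburger
    then show ?thesis using w by (simp del: conc_conc)
  qed
  have A_elim: "\<exists>w. a = (0, w) \<and> w \<in> lists {..<n} \<and> length w = N" if "a \<in> A" for a
    using that unfolding A_def by (elim imageE CollectE) simp
  have A: "complete_antichain n 1 A"
    unfolding complete_antichain_def
  proof (intro conjI)
    show "A \<subseteq> dwords n 1" by (auto simp: A_def dwords_def)
    show "\<forall>u\<in>A. \<forall>v\<in>A. u \<noteq> v \<longrightarrow> \<not> dprefix u v \<and> \<not> dprefix v u"
    proof -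
      have "u = v" if uv: "u \<in> A" "v \<in> A" "dprefix u v" for u v
      proof -
        obtain w w' where w: "u = (0, w)" "v = (0, w')" "length w = N" "length w' = N"
          using uv(1,2) by (auto simp: A_def)
        then obtain t where "w' = w @ t" using uv(3) by (auto simp: dprefix_def Sublist.prefix_def)
        then show ?thesis using w by simp
      qed
      then show ?thesis by metis
    qed
    show "(\<Union>u\<in>A. cone n u) = cantor n 1"
    proof (intro equalityI subsetI)
      fix q assume "q \<in> cantor n 1"
      then obtain x where x: "x \<in> undotted_points n" "q = (0, x)" by (auto simp: cantor_1_iff)
      have "q \<in> cone n (0, prefix N x)"
        using x by (auto simp: cone_1 intro!: image_eqI[of _ _ "suffix N x"])
      moreover have "(0, prefix N x) \<in> A"
        using prefix_in_lists[OF x(1)] by (auto simp: A_def)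
      ultimately show "q \<in> (\<Union>u\<in>A. cone n u)" by blast
    qed (auto simp: A_def cone_1 cantor_1_iff)
  qed (rule finA)
  have inj: "inj_on \<pi> A"
  proof (rule inj_onI)
    fix u v assume "u \<in> A" "v \<in> A" and eq: "\<pi> u = \<pi> v"
    then obtain w w' where w: "u = (0, w)" "v = (0, w')" "w \<in> lists {..<n}" "w' \<in> lists {..<n}"
      "length w = N" "length w' = N" by (auto simp: A_def)
    then show "u = v" using pre[of w w'] eq by (simp add: \<pi>_def)
  qed
  have B: "complete_antichain n 1 (\<pi> ` A)"
    unfolding complete_antichain_def
  proof (intro conjI)
    show "finite (\<pi> ` A)" using finA by simp
    show piA: "\<pi> ` A \<subseteq> dwords n 1"
    proof
      fix u assume "u \<in> \<pi> ` A"
      then obtain a where "a \<in> A" "u = \<pi> a" by (elim imageE)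
      with A_elim obtain w where "w \<in> lists {..<n}" "length w = N" "u = (0, p w)"
        by (metis \<pi>_def snd_conv)
      then show "u \<in> dwords n 1" using p(1) by (simp add: dwords_def)
    qed
    show "\<forall>u\<in>\<pi> ` A. \<forall>v\<in>\<pi> ` A. u \<noteq> v \<longrightarrow> \<not> dprefix u v \<and> \<not> dprefix v u"
    proof -
      have "u = v" if uv: "u \<in> A" "v \<in> A" "dprefix (\<pi> u) (\<pi> v)" for u v
      proof -
        obtain w w' where w: "u = (0, w)" "v = (0, w')" "w \<in> lists {..<n}" "w' \<in> lists {..<n}"
          "length w = N" "length w' = N" using uv(1,2) by (auto simp: A_def)
        then show ?thesis using pre[of w w'] uv(3) by (simp add: \<pi>_def dprefix_def)
      qed
      then show ?thesis by blast
    qed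
    show "(\<Union>u\<in>\<pi> ` A. cone n u) = cantor n 1"
    proof (intro equalityI subsetI)
      fix q assume "q \<in> cantor n 1"
      then have "q \<in> g ` cantor n 1" using bij_betw_imp_surj_on[OF bij] by argo
      then obtain q' where "q' \<in> cantor n 1" "q = g q'" by (elim imageE)
      then obtain x where x: "x \<in> undotted_points n" "q = g (0, x)" unfolding cantor_1_iff by blast
      obtain w y where w: "(0, w) \<in> A" "w \<in> lists {..<n}" and y: "y \<in> undotted_points n" "x = w \<frown> y"
        using complete_antichain_cover[OF A x(1)] by metis
      have "length w = N" using A_elim[OF w(1)] by simp
      then have "q = (0, p w \<frown> y)" using p(2) w y x by simp
      then have "q \<in> cone n (\<pi> (0, w))" using y by (simp add: \<pi>_def cone_1)
      then show "q \<in> (\<Union>u\<in>\<pi> ` A. cone n u)" using w(1) by blast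
    next
      fix q assume "q \<in> (\<Union>u\<in>\<pi> ` A. cone n u)"
      then obtain u where "u \<in> \<pi> ` A" "q \<in> cone n u" by blast
      moreover from this(1) piA have "u \<in> dwords n 1" by blast
      ultimately show "q \<in> cantor n 1" by (auto simp: dwords_1_iff cone_1 cantor_1_iff)
    qed
  qed
  have "g (dconc u x) = dconc (\<pi> u) x" if "u \<in> A" "x \<in> undotted_points n" for u x
    using A_elim[OF that(1)] p(2) that(2) by (elim exE conjE) (simp add: dconc_def \<pi>_def)
  then have "replaces_prefixes n 1 g A (\<pi> ` A) \<pi>"
    using A B inj inj_on_imp_bij_betw[OF inj] by (simp add: replaces_prefixes_def card_image)
  then show "g \<in> G_set n 1"
    using ext homeomorphic_map_cantorI[OF bij N] unfolding G_set_def by blast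
qed

section \<open>The group G\<close>

lemma G_set_subset_Bij: "0 < n \<Longrightarrow> G_set n 1 \<subseteq> Bij (cantor n 1)"
  using G_set_iff by blast

lemma G_set_id: "0 < n \<Longrightarrow> (\<lambda>p\<in>cantor n 1. p) \<in> G_set n 1"
proof -
  assume "0 < n"
  have "replaces_long_prefixes n (\<lambda>p\<in>cantor n 1. p) 0"
    unfolding replaces_long_prefixes_def
  proof (intro ballI impI bexI[of _ "[]"])
    fix w :: "nat list" and x assume "length w = 0" "x \<in> undotted_points n"
    then show "(\<lambda>p\<in>cantor n 1. p) (0, w \<frown> x) = (0, [] \<frown> x)" by (simp add: cantor_def)
  qed simp
  then show ?thesis using id_Bij G_set_iff[OF \<open>0 < n\<close>] by blast
qed

lemma G_set_compose:
  assumes n: "0 < n" and g: "g \<in> G_set n 1" "h \<in> G_set n 1"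
  shows "compose (cantor n 1) h g \<in> G_set n 1"
proof -
  obtain N M where N: "replaces_long_prefixes n g N" and M: "replaces_long_prefixes n h M"
    using g G_set_iff[OF n] by blast
  \<comment> \<open>\<open>g\<close> may consume N letters, and M letters must remain for
    \<open>h\<close>.\<close>
  have "replaces_long_prefixes n (compose (cantor n 1) h g) (M + N)"
    unfolding replaces_long_prefixes_def
  proof (intro ballI impI)
    fix w assume w: "w \<in> lists {..<n}" "length w = M + N"
    have "N \<le> length w" using w(2) by simp
    then obtain v where v: "v \<in> lists {..<n}" "length w \<le> length v + N"
      "\<forall>x\<in>undotted_points n. g (0, w \<frown> x) = (0, v \<frown> x)"
      by (rule replaces_long_prefixesD[OF N w(1)])
    then have "M \<le> length v" using w(2) by simp
    then obtain v' where v': "v' \<in> lists {..<n}"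
      "\<forall>x\<in>undotted_points n. h (0, v \<frown> x) = (0, v' \<frown> x)"
      by (rule replaces_long_prefixesD[OF M v(1)])
    have "compose (cantor n 1) h g (0, w \<frown> x) = (0, v' \<frown> x)" if "x \<in> undotted_points n" for x
      using that w v(3) v'(2) by (simp add: compose_def cantor_def)
    then show "\<exists>v\<in>lists {..<n}. \<forall>x\<in>undotted_points n. compose (cantor n 1) h g (0, w \<frown> x) = (0, v \<frown> x)"
      using v'(1) by blast
  qed
  moreover have "compose (cantor n 1) h g \<in> Bij (cantor n 1)"
    using g G_set_iff[OF n] compose_Bij by blast
  ultimately show ?thesis using G_set_iff[OF n] by blast
qed

lemma finite_lists_length: "finite {w \<in> lists {..<n::nat}. length w = N}"
  using finite_lists_length_eq[of "{..<n}" N] by (simp add: lists_eq_set)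

text \<open>The inverse undoes the replacement of each word of length N. The replacing words may
  have different lengths, which \<open>replaces_long_prefixes_cover\<close> evens out.\<close>

lemma G_set_inv:
  assumes n: "0 < n" and g: "g \<in> G_set n 1"
  shows "(\<lambda>p\<in>cantor n 1. inv_into (cantor n 1) g p) \<in> G_set n 1"
proof -
  obtain N where N: "replaces_long_prefixes n g N" and gB: "g \<in> Bij (cantor n 1)"
    using g G_set_iff[OF n] by blast
  have bij: "bij_betw g (cantor n 1) (cantor n 1)" using gB by (simp add: Bij_def)
  obtain p where "\<forall>w\<in>lists {..<n}. length w = N \<longrightarrow> p w \<in> lists {..<n} \<and>
      (\<forall>x\<in>undotted_points n. g (0, w \<frown> x) = (0, p w \<frown> x))"
    by (rule replaces_long_prefixes_choice[OF N])
  then have p: "\<And>w. w \<in> lists {..<n} \<Longrightarrow> length w = N \<Longrightarrow> p w \<in> lists {..<n}"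
    "\<And>w x. w \<in> lists {..<n} \<Longrightarrow> length w = N \<Longrightarrow> x \<in> undotted_points n \<Longrightarrow>
      g (0, w \<frown> x) = (0, p w \<frown> x)"
    by blast+
  have "\<exists>K. replaces_long_prefixes n (\<lambda>p\<in>cantor n 1. inv_into (cantor n 1) g p) K"
  proof (rule replaces_long_prefixes_cover[OF n])
    show "finite (p ` {w \<in> lists {..<n}. length w = N})" by (simp add: finite_lists_length)
    show "p ` {w \<in> lists {..<n}. length w = N} \<subseteq> lists {..<n}" using p(1) by blast
    show "\<exists>u\<in>p ` {w \<in> lists {..<n}. length w = N}. \<exists>y\<in>undotted_points n. x = u \<frown> y"
      if "x \<in> undotted_points n" for x
    proof -
      have "(0, x) \<in> g ` cantor n 1"
        using that cantor_1_iff by (subst bij_betw_imp_surj_on[OF bij]) blast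
      then obtain q where "q \<in> cantor n 1" "g q = (0, x)" by (elim imageE) simp
      then obtain y where y: "y \<in> undotted_points n" "g (0, y) = (0, x)"
        unfolding cantor_1_iff by blast
      have "g (0, y) = (0, p (prefix N y) \<frown> suffix N y)"
        using p(2)[OF prefix_in_lists[OF y(1)], of N "suffix N y"] y(1) by simp
      then have "x = p (prefix N y) \<frown> suffix N y" using y(2) by simp
      moreover have "prefix N y \<in> {w \<in> lists {..<n}. length w = N}"
        using prefix_in_lists[OF y(1)] by simp
      ultimately show ?thesis using y(1) by (intro bexI[of _ "p (prefix N y)"] bexI[of _ "suffix N y"]) simp_all
    qed
    fix v assume "v \<in> p ` {w \<in> lists {..<n}. length w = N}"
    then obtain w where w: "w \<in> lists {..<n}" "length w = N" "v = p w" by blast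
    have "inv_into (cantor n 1) g (0, v \<frown> x) = (0, w \<frown> x)" if x: "x \<in> undotted_points n" for x
      using p(2)[OF w(1,2) x] bij_betw_inv_into_left[OF bij, of "(0, w \<frown> x)"] w x
      by (auto simp: cantor_1_iff)
    moreover have "v \<in> lists {..<n}" using p(1) w by simp
    ultimately show "\<exists>w\<in>lists {..<n}. \<forall>x\<in>undotted_points n.
        (\<lambda>p\<in>cantor n 1. inv_into (cantor n 1) g p) (0, v \<frown> x) = (0, w \<frown> x)"
      using w(1) by (auto simp: cantor_1_iff)
  qed
  then show ?thesis using G_set_iff[OF n] restrict_inv_into_Bij[OF gB] by blast
qed

lemma group_G: "0 < n \<Longrightarrow> group (G_group n 1)"
  unfolding G_group_def
  by (rule group_right_action_groupI)
    (simp_all add: G_set_subset_Bij G_set_id G_set_compose G_set_inv)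

declare in_listsD [rule del] in_listsI [rule del]

section \<open>The cyclic order\<close>

definition lexlt :: "(nat \<Rightarrow> nat) \<Rightarrow> (nat \<Rightarrow> nat) \<Rightarrow> bool" where
  "lexlt x y \<longleftrightarrow> (\<exists>k. (\<forall>i<k. x i = y i) \<and> x k < y k)"

lemma lexlt_irrefl: "\<not> lexlt x x"
  by (auto simp: lexlt_def)

lemma lexlt_trans:
  assumes "lexlt x y" "lexlt y z"
  shows "lexlt x z"
proof -
  obtain k l where k: "\<forall>i<k. x i = y i" "x k < y k" and l: "\<forall>i<l. y i = z i" "y l < z l"
    using assms by (auto simp: lexlt_def)
  consider "k < l" | "k = l" | "l < k" by linarith
  then show ?thesis
  proof cases
    case 1
    then show ?thesis using k l by (auto simp: lexlt_def intro!: exI[of _ k])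
  next
    case 2
    then show ?thesis using k l by (auto simp: lexlt_def intro!: exI[of _ k])
  next
    case 3
    then show ?thesis using k l by (auto simp: lexlt_def intro!: exI[of _ l])
  qed
qed

lemma lexlt_total: "lexlt x y \<or> x = y \<or> lexlt y x"
proof (cases "x = y")
  case False
  then have ex: "\<exists>k. x k \<noteq> y k" by auto
  define k where "k = (LEAST k. x k \<noteq> y k)"
  have "x k \<noteq> y k" unfolding k_def by (rule LeastI_ex[OF ex])
  moreover have "x i = y i" if "i < k" for i using that not_less_Least unfolding k_def by blast
  ultimately show ?thesis unfolding lexlt_def by (metis nat_neq_iff)
qed simp

interpretation lex: linorder "\<lambda>x y. x = y \<or> lexlt x y" lexlt
  by unfold_locales (use lexlt_irrefl lexlt_trans lexlt_total in blast)+

lemma lexlt_conc [simp]: "lexlt (u \<frown> x) (u \<frown> y) \<longleftrightarrow> lexlt x y"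
proof
  assume "lexlt (u \<frown> x) (u \<frown> y)"
  then obtain k where k: "\<forall>i<k. (u \<frown> x) i = (u \<frown> y) i" "(u \<frown> x) k < (u \<frown> y) k"
    by (auto simp: lexlt_def)
  have "length u \<le> k" using k(2) by (cases "k < length u") auto
  then have "x (k - length u) < y (k - length u)" using k(2) by simp
  moreover have "x i = y i" if "i < k - length u" for i
    using k(1)[rule_format, of "length u + i"] that by simp
  ultimately show "lexlt x y" unfolding lexlt_def by blast
next
  assume "lexlt x y"
  then obtain k where k: "\<forall>i<k. x i = y i" "x k < y k" by (auto simp: lexlt_def)
  have "(u \<frown> x) i = (u \<frown> y) i" if "i < length u + k" for i
    using that k(1) by (cases "i < length u") auto
  moreover have "(u \<frown> x) (length u + k) < (u \<frown> y) (length u + k)" using k(2) by simp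
  ultimately show "lexlt (u \<frown> x) (u \<frown> y)" unfolding lexlt_def by blast
qed

lemma lexlt_build [simp]: "lexlt (a ## x) (b ## y) \<longleftrightarrow> a < b \<or> a = b \<and> lexlt x y"
proof (cases "a = b")
  case True
  then show ?thesis using lexlt_conc[of "[a]" x y] by (simp del: lexlt_conc)
next
  case False
  have "(\<forall>i<k. (a ## x) i = (b ## y) i) \<longleftrightarrow> k = 0" for k
    using False by (cases k) auto
  then show ?thesis using False by (simp add: lexlt_def)
qed

text \<open>Outside the prefix case the comparison is decided at a position inside both words, so
  the continuations are arbitrary.\<close>

lemma lexlt_of_lexord:
  assumes "(u, v) \<in> lexord less_than" "\<not> Sublist.prefix u v"
  shows "lexlt (u \<frown> x) (v \<frown> y)"
proof -
  obtain p a b s t where "a < b" "u = p @ a # s" "v = p @ b # t"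
    using assms by (auto simp: lexord_def)
  then show ?thesis by simp
qed

lemma lexord_less_than_total: "(u, v) \<in> lexord less_than \<or> u = v \<or> (v, u) \<in> lexord less_than"
  by (rule lexord_linear) (auto simp: less_than_iff)

lemma lexord_of_lexlt:
  assumes "lexlt (u \<frown> x) (v \<frown> y)" "\<not> Sublist.prefix u v" "\<not> Sublist.prefix v u"
  shows "(u, v) \<in> lexord less_than"
proof (rule ccontr)
  assume "(u, v) \<notin> lexord less_than"
  moreover have "u \<noteq> v" using assms(2) by auto
  ultimately have "(v, u) \<in> lexord less_than"
    using lexord_less_than_total by blast
  then show False using lexlt_of_lexord[OF _ assms(3)] assms(1) lex.less_asym by blast
qed

section \<open>Lexicographic listings of antichains\<close>

lemma lex_less_trans: "(u, v) \<in> lex_less \<Longrightarrow> (v, w) \<in> lex_less \<Longrightarrow> (u, w) \<in> lex_less"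
  using lexord_trans[of "snd u" "snd v" less_than "snd w"] by (cases u; cases v; cases w) (auto simp: lex_less_def trans_less_than)

lemma lex_less_irrefl: "(u, u) \<notin> lex_less"
  using lexord_irreflexive[of less_than "snd u"] by (cases u) (auto simp: lex_less_def)

lemma lex_less_total: "(u, v) \<in> lex_less \<or> u = v \<or> (v, u) \<in> lex_less"
  using lexord_less_than_total[of "snd u" "snd v"] by (cases u; cases v) (auto simp: lex_less_def)

lemma lex_listing_exists:
  assumes "finite A"
  shows "\<exists>us. lex_listing A us"
  using assms
proof (induction rule: finite_induct)
  case empty
  show ?case by (auto simp: lex_listing_def)
next
  case (insert u A)
  then obtain us where us: "set us = A" "sorted_wrt (\<lambda>u v. (u, v) \<in> lex_less) us"
    by (auto simp: lex_listing_def)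
  let ?vs = "filter (\<lambda>v. (v, u) \<in> lex_less) us @ u # filter (\<lambda>v. (u, v) \<in> lex_less) us"
  have "set ?vs = insert u A" using lex_less_total[of _ u] by (simp add: us(1)) blast
  moreover have "sorted_wrt (\<lambda>u v. (u, v) \<in> lex_less) ?vs"
    using us(2) by (auto simp: sorted_wrt_append sorted_wrt_filter intro: lex_less_trans)
  ultimately show ?case unfolding lex_listing_def by blast
qed

lemma lex_listing_nth:
  "lex_listing A us \<Longrightarrow> i < j \<Longrightarrow> j < length us \<Longrightarrow> (us ! i, us ! j) \<in> lex_less"
  by (simp add: lex_listing_def sorted_wrt_iff_nth_less)

lemma lex_listing_length:
  assumes "lex_listing A us"
  shows "length us = card A"
proof -
  have "us ! i \<noteq> us ! j" if "i < length us" "j < length us" "i \<noteq> j" for i j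
    using lex_listing_nth[OF assms, of i j] lex_listing_nth[OF assms, of j i] that lex_less_irrefl
    by (metis nat_neq_iff)
  then have "distinct us" by (simp add: distinct_conv_nth)
  then show ?thesis using assms by (metis distinct_card lex_listing_def)
qed

lemma complete_antichain_listing_less:
  assumes A: "complete_antichain n 1 A" and us: "lex_listing A us" and ij: "i < j" "j < length us"
  shows "lexlt (snd (us ! i) \<frown> x) (snd (us ! j) \<frown> y)"
proof -
  have l: "(us ! i, us ! j) \<in> lex_less" by (rule lex_listing_nth[OF us ij])
  have m: "us ! i \<in> A" "us ! j \<in> A" using us ij by (auto simp: lex_listing_def)
  then have d: "us ! i \<in> dwords n 1" "us ! j \<in> dwords n 1" and "\<not> dprefix (us ! i) (us ! j)"
    using A l lex_less_irrefl unfolding complete_antichain_def by (blast, blast, metis)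
  then have "\<not> Sublist.prefix (snd (us ! i)) (snd (us ! j))"
    by (auto simp: dwords_1_iff dprefix_def)
  moreover have "(snd (us ! i), snd (us ! j)) \<in> lexord less_than"
    using l d by (auto simp: dwords_1_iff lex_less_def)
  ultimately show ?thesis by (intro lexlt_of_lexord)
qed

section \<open>Cyclic order and cuts\<close>

definition cyc :: "(nat \<Rightarrow> nat) \<Rightarrow> (nat \<Rightarrow> nat) \<Rightarrow> (nat \<Rightarrow> nat) \<Rightarrow> bool" where
  "cyc x y z \<longleftrightarrow> lexlt x y \<and> lexlt y z \<or> lexlt y z \<and> lexlt z x \<or> lexlt z x \<and> lexlt x y"

text \<open>An intrinsic condition for membership in T: without antichains in it, its behaviour
  under composition and inversion is easy to follow.\<close>

definition cyclic_mono :: "nat \<Rightarrow> (dpoint \<Rightarrow> dpoint) \<Rightarrow> bool" where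
  "cyclic_mono n g \<longleftrightarrow> (\<forall>x\<in>undotted_points n. \<forall>y\<in>undotted_points n. \<forall>z\<in>undotted_points n.
     cyc x y z \<longrightarrow> cyc (snd (g (0, x))) (snd (g (0, y))) (snd (g (0, z))))"

text \<open>\<open>L\<close> holds for the points before the cut. The map is increasing on each side
  of the cut and puts the images of the later side before those of the earlier one. This linear
  picture mediates between rotated listings and the cyclic order.\<close>

definition cut_mono :: "nat \<Rightarrow> (dpoint \<Rightarrow> dpoint) \<Rightarrow> ((nat \<Rightarrow> nat) \<Rightarrow> bool) \<Rightarrow> bool" where
  "cut_mono n g L \<longleftrightarrow> (\<forall>x\<in>undotted_points n. \<forall>y\<in>undotted_points n. lexlt x y \<longrightarrow>
     (L y \<longrightarrow> L x) \<and>
     (L x = L y \<longrightarrow> lexlt (snd (g (0, x))) (snd (g (0, y)))) \<and>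
     (L x \<and> \<not> L y \<longrightarrow> lexlt (snd (g (0, y))) (snd (g (0, x)))))"

text \<open>A cyclically ordered triple is a rotation of an increasing one, so only the possible
  places of the cut relative to x < y < z matter.\<close>

lemma cyclic_mono_of_cut:
  assumes "cut_mono n g L"
  shows "cyclic_mono n g"
proof -
  let ?h = "\<lambda>x. snd (g (0, x))"
  have step: "cyc (?h x) (?h y) (?h z)"
    if "x \<in> undotted_points n" "y \<in> undotted_points n" "z \<in> undotted_points n"
      and l: "lexlt x y" "lexlt y z" for x y z
  proof -
    have "lexlt x z" using l lexlt_trans by blast
    then have "(L y \<longrightarrow> L x)" "(L z \<longrightarrow> L y)" "(L z \<longrightarrow> L x)"
      "L x = L y \<longrightarrow> lexlt (?h x) (?h y)" "L y = L z \<longrightarrow> lexlt (?h y) (?h z)"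
      "L x = L z \<longrightarrow> lexlt (?h x) (?h z)" "L x \<and> \<not> L y \<longrightarrow> lexlt (?h y) (?h x)"
      "L y \<and> \<not> L z \<longrightarrow> lexlt (?h z) (?h y)" "L x \<and> \<not> L z \<longrightarrow> lexlt (?h z) (?h x)"
      using assms that unfolding cut_mono_def by metis+
    then show ?thesis unfolding cyc_def by argo
  qed
  have "cyc (?h x) (?h y) (?h z)"
    if "x \<in> undotted_points n" "y \<in> undotted_points n" "z \<in> undotted_points n" "cyc x y z" for x y z
    using that(4) step[of x y z] step[of y z x] step[of z x y] that(1-3)
    unfolding cyc_def by argo
  then show ?thesis unfolding cyclic_mono_def by blast
qed

text \<open>The cut is found with the help of the least point: a point comes before the cut as long
  as its image has not wrapped around below the image of \<open>\<lambda>_. 0\<close>.\<close>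

lemma cut_mono_of_cyclic:
  assumes n: "0 < n" and inj: "inj_on (\<lambda>x. snd (g (0, x))) (undotted_points n)" and c: "cyclic_mono n g"
  shows "cut_mono n g (\<lambda>x. \<not> lexlt (snd (g (0, x))) (snd (g (0, \<lambda>_. 0))))"
proof -
  let ?h = "\<lambda>x. snd (g (0, x))" and ?o = "\<lambda>_. 0 :: nat"
  have o: "?o \<in> undotted_points n" using n by (simp add: undotted_points_iff)
  show ?thesis
    unfolding cut_mono_def
  proof (intro ballI impI)
    fix x y assume x: "x \<in> undotted_points n" and y: "y \<in> undotted_points n" and xy: "lexlt x y"
    have ne: "?h x \<noteq> ?h y" using inj_onD[OF inj _ x y] xy lexlt_irrefl by metis
    have *: "lexlt (?h ?o) (?h x) \<and> lexlt (?h x) (?h y) \<or> lexlt (?h x) (?h y) \<and> lexlt (?h y) (?h ?o)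
      \<or> lexlt (?h y) (?h ?o) \<and> lexlt (?h ?o) (?h x) \<or> x = ?o"
    proof (cases "x = ?o")
      case False
      moreover have "\<not> lexlt x ?o" by (simp add: lexlt_def)
      ultimately have "lexlt ?o x" using lexlt_total by metis
      then have "cyc ?o x y" using xy by (simp add: cyc_def)
      then have "cyc (?h ?o) (?h x) (?h y)" using c o x y unfolding cyclic_mono_def by metis
      then show ?thesis unfolding cyc_def by argo
    qed simp
    show "(\<not> lexlt (?h y) (?h ?o) \<longrightarrow> \<not> lexlt (?h x) (?h ?o)) \<and>
      ((\<not> lexlt (?h x) (?h ?o)) = (\<not> lexlt (?h y) (?h ?o)) \<longrightarrow> lexlt (?h x) (?h y)) \<and>
      (\<not> lexlt (?h x) (?h ?o) \<and> \<not> \<not> lexlt (?h y) (?h ?o) \<longrightarrow> lexlt (?h y) (?h x))"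
      using * ne lexlt_irrefl[of "?h x"] lexlt_irrefl[of "?h y"] lexlt_irrefl[of "?h ?o"]
        lexlt_trans[of "?h x" "?h y" "?h ?o"] lexlt_trans[of "?h y" "?h ?o" "?h x"]
        lexlt_trans[of "?h ?o" "?h x" "?h y"] lexlt_trans[of "?h y" "?h x" "?h y"]
        lexlt_trans[of "?h x" "?h ?o" "?h x"] lexlt_trans[of "?h y" "?h ?o" "?h y"]
        lexlt_total[of "?h x" "?h y"] lexlt_total[of "?h ?o" "?h y"]
      by metis
  qed
qed

text \<open>Shifting indices by s = j mod l is increasing apart from one wrap-around, and
  lexicographic listings translate indices into the order of cones.\<close>

lemma cut_mono_of_rotation:
  assumes r: "replaces_prefixes n 1 g A B \<pi>" and us: "lex_listing A us" and vs: "lex_listing B vs"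
    and rot: "\<forall>i<length us. \<pi> (us ! i) = vs ! ((i + j) mod length us)"
  shows "\<exists>L. cut_mono n g L"
proof -
  define l where "l = length us"
  define s where "s = j mod l"
  have A: "complete_antichain n 1 A" and B: "complete_antichain n 1 B" and card: "card A = card B"
    and act: "\<And>u x. u \<in> A \<Longrightarrow> x \<in> undotted_points n \<Longrightarrow> g (dconc u x) = dconc (\<pi> u) x"
    using r unfolding replaces_prefixes_def by blast+
  have lv: "length vs = l"
    using lex_listing_length[OF us] lex_listing_length[OF vs] card by (simp add: l_def)
  have shift: "(i + j) mod l = (if i + s < l then i + s else i + s - l)" if "i < l" for i
  proof -
    have "s < l" using that unfolding s_def by simp
    have "(i + j) mod l = (i + s) mod l" unfolding s_def by (simp add: mod_add_right_eq)
    then show ?thesis using \<open>s < l\<close> that by (simp add: mod_if)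
  qed
  have idx: "\<exists>a y. a < l \<and> y \<in> undotted_points n \<and> x = snd (us ! a) \<frown> y \<and>
      snd (g (0, x)) = snd (vs ! ((a + j) mod l)) \<frown> y" if x: "x \<in> undotted_points n" for x
  proof -
    obtain u y where u: "(0, u) \<in> A" and y: "y \<in> undotted_points n" "x = u \<frown> y"
      by (rule complete_antichain_cover[OF A x])
    have "(0, u) \<in> set us" using us u by (simp add: lex_listing_def)
    then obtain a where a: "a < l" "us ! a = (0, u)" unfolding in_set_conv_nth l_def by blast
    have "g (0, x) = dconc (\<pi> (0, u)) y" using act[OF u y(1)] y(2) by (simp add: dconc_def)
    moreover have "\<pi> (0, u) = vs ! ((a + j) mod l)"
      using rot[rule_format, of a] a by (simp add: l_def)
    ultimately have "snd (g (0, x)) = snd (vs ! ((a + j) mod l)) \<frown> y" by (simp add: dconc_def)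
    then show ?thesis using a y by (intro exI[of _ a] exI[of _ y]) simp
  qed
  have less: "lexlt (snd (us ! a) \<frown> x) (snd (us ! b) \<frown> y)" if "a < b" "b < l" for a b x y
    using complete_antichain_listing_less[OF A us] that by (simp add: l_def)
  have less': "lexlt (snd (vs ! a) \<frown> x) (snd (vs ! b) \<frown> y)" if "a < b" "b < l" for a b x y
    using complete_antichain_listing_less[OF B vs] that by (simp add: lv)
  have uniq: "a = b" if "a < l" "b < l" "snd (us ! a) \<frown> x = snd (us ! b) \<frown> y" for a b x y
    using less[of a b x y] less[of b a y x] that lexlt_irrefl by (metis nat_neq_iff)
  \<comment> \<open>The cones whose shifted index does not wrap around.\<close>
  define L where "L x \<longleftrightarrow> (\<exists>a y. a < l \<and> a + s < l \<and> x = snd (us ! a) \<frown> y)" for x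
  have L_iff: "L (snd (us ! a) \<frown> y) \<longleftrightarrow> a + s < l" if "a < l" for a y
    using uniq that unfolding L_def by blast
  have "cut_mono n g L"
    unfolding cut_mono_def
  proof (intro ballI impI)
    fix x y assume "x \<in> undotted_points n" "y \<in> undotted_points n" and xy: "lexlt x y"
    then obtain a x' b y' where a: "a < l" "x = snd (us ! a) \<frown> x'"
      "snd (g (0, x)) = snd (vs ! ((a + j) mod l)) \<frown> x'"
      and b: "b < l" "y = snd (us ! b) \<frown> y'" "snd (g (0, y)) = snd (vs ! ((b + j) mod l)) \<frown> y'"
      using idx by metis
    have "\<not> b < a" using less[of b a y' x'] a b xy lex.less_asym by blast
    then consider "a = b" | "a < b" by linarith
    then show "(L y \<longrightarrow> L x) \<and> (L x = L y \<longrightarrow> lexlt (snd (g (0, x))) (snd (g (0, y)))) \<and>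
        (L x \<and> \<not> L y \<longrightarrow> lexlt (snd (g (0, y))) (snd (g (0, x))))"
    proof cases
      case 1
      then show ?thesis using a b xy L_iff by simp
    next
      case 2
      have "s < l" using a(1) unfolding s_def by simp
      with 2 show ?thesis
        unfolding a(3) b(3) using L_iff[OF a(1)] L_iff[OF b(1)] shift[OF a(1)] shift[OF b(1)] a b
        by (auto intro!: less')
    qed
  qed
  then show ?thesis by blast
qed

text \<open>The cut splits the listing of A as \<open>ps @ qs\<close>. Then \<open>\<pi>\<close>
  takes \<open>qs @ ps\<close> to the listing of B, so the required shift is the length of
  \<open>qs\<close>.\<close>

lemma rotation_of_cut_mono:
  assumes n: "0 < n" and r: "replaces_prefixes n 1 g A B \<pi>" and L: "cut_mono n g L"
  shows "\<exists>us vs j. lex_listing A us \<and> lex_listing B vs \<and>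
    (\<forall>i<length us. \<pi> (us ! i) = vs ! ((i + j) mod length us))"
proof -
  have A: "complete_antichain n 1 A" and B: "complete_antichain n 1 B" and \<pi>: "bij_betw \<pi> A B"
    and act: "\<And>u x. u \<in> A \<Longrightarrow> x \<in> undotted_points n \<Longrightarrow> g (dconc u x) = dconc (\<pi> u) x"
    using r unfolding replaces_prefixes_def by blast+
  have "finite A" using A by (simp add: complete_antichain_def)
  then obtain us where us: "lex_listing A us" using lex_listing_exists by blast
  let ?o = "\<lambda>_. 0 :: nat"
  have o: "?o \<in> undotted_points n" using n by (simp add: undotted_points_iff)
  \<comment> \<open>One test point per cone is enough, since the order of incomparable words can be
    read off from any of their extensions.\<close>
  define P where "P u \<longleftrightarrow> L (snd u \<frown> ?o)" for u :: dword
  define ps where "ps = takeWhile P us"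
  define qs where "qs = dropWhile P us"
  have us_eq: "us = ps @ qs" by (simp add: ps_def qs_def)
  have set_us: "set us = A" and sorted: "sorted_wrt (\<lambda>u v. (u, v) \<in> lex_less) us"
    using us by (auto simp: lex_listing_def)
  have AD: "A \<subseteq> dwords n 1" and BD: "B \<subseteq> dwords n 1"
    using A B by (auto simp: complete_antichain_def)
  have point: "snd u \<frown> ?o \<in> undotted_points n" if "u \<in> A" for u
  proof -
    have "u \<in> dwords n 1" using AD that by blast
    then show ?thesis using o by (auto simp: dwords_1_iff)
  qed
  have less: "lexlt (snd u \<frown> ?o) (snd v \<frown> ?o)" if uv: "(u, v) \<in> lex_less" "u \<in> A" "v \<in> A" for u v
  proof -
    have "u \<in> set us" "v \<in> set us" using uv(2,3) set_us by simp_all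
    then obtain i j where ij: "i < length us" "u = us ! i" "j < length us" "v = us ! j"
      unfolding in_set_conv_nth by blast
    have "\<not> j \<le> i"
      using lex_listing_nth[OF us, of j i] ij uv(1) lex_less_irrefl lex_less_trans
      by (metis le_neq_implies_less)
    then show ?thesis using complete_antichain_listing_less[OF A us, of i j] ij by simp
  qed
  have g_less: "(\<pi> u, \<pi> v) \<in> lex_less"
    if uv: "u \<in> A" "v \<in> A" "u \<noteq> v" "lexlt (snd (g (0, snd u \<frown> ?o))) (snd (g (0, snd v \<frown> ?o)))" for u v
  proof -
    have "u \<in> dwords n 1" "v \<in> dwords n 1" using AD uv(1,2) by blast+
    then have d: "g (0, snd u \<frown> ?o) = dconc (\<pi> u) ?o" "g (0, snd v \<frown> ?o) = dconc (\<pi> v) ?o"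
      using act[OF uv(1) o] act[OF uv(2) o] by (auto simp: dwords_1_iff dconc_def)
    have \<pi>B: "\<pi> u \<in> B" "\<pi> v \<in> B" "\<pi> u \<noteq> \<pi> v"
      using \<pi> uv(1-3) unfolding bij_betw_def inj_on_def by blast+
    then have nd: "\<not> dprefix (\<pi> u) (\<pi> v)" "\<not> dprefix (\<pi> v) (\<pi> u)"
      using B unfolding complete_antichain_def by blast+
    have "\<pi> u \<in> dwords n 1" "\<pi> v \<in> dwords n 1" using BD \<pi>B by blast+
    then obtain a b where ab: "\<pi> u = (0, a)" "\<pi> v = (0, b)" unfolding dwords_1_iff by blast
    have "(a, b) \<in> lexord less_than"
      using lexord_of_lexlt[of a ?o b ?o] uv(4) nd unfolding d by (simp add: ab dconc_def dprefix_def)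
    then show ?thesis by (simp add: ab lex_less_def)
  qed
  have sorted_us: "sorted_wrt (\<lambda>u v. (u, v) \<in> lex_less) ps" "sorted_wrt (\<lambda>u v. (u, v) \<in> lex_less) qs"
    and ps_qs: "\<And>u v. u \<in> set ps \<Longrightarrow> v \<in> set qs \<Longrightarrow> (u, v) \<in> lex_less"
    using sorted unfolding us_eq sorted_wrt_append by blast+
  have in_A: "u \<in> A" if "u \<in> set ps \<or> u \<in> set qs" for u using that set_us us_eq by auto
  have P_ps: "P u" if "u \<in> set ps" for u using that unfolding ps_def by (rule set_takeWhileD[THEN conjunct2])
  have P_down: "P v \<Longrightarrow> P u" if "(u, v) \<in> lex_less" "u \<in> A" "v \<in> A" for u v
    using L less[OF that] point[OF that(2)] point[OF that(3)] unfolding cut_mono_def P_def by blast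
  have P_qs: "\<not> P v" if "v \<in> set qs" for v
  proof (cases qs)
    case (Cons q qs')
    have "\<not> P q" using Cons hd_dropWhile[of P us] unfolding qs_def by (metis list.distinct(1) list.sel(1))
    moreover have "v = q \<or> (q, v) \<in> lex_less" using that sorted_us(2) Cons by auto
    ultimately show ?thesis using P_down[of q v] in_A[of q] in_A[of v] that Cons by auto
  qed (use that in simp)
  have same: "(\<pi> u, \<pi> v) \<in> lex_less" if uv: "(u, v) \<in> lex_less" "u \<in> A" "v \<in> A" "P u = P v" for u v
  proof (rule g_less[OF uv(2,3)])
    show "u \<noteq> v" using uv(1) lex_less_irrefl by blast
    show "lexlt (snd (g (0, snd u \<frown> ?o))) (snd (g (0, snd v \<frown> ?o)))"
      using L less[OF uv(1-3)] point[OF uv(2)] point[OF uv(3)] uv(4) unfolding cut_mono_def P_def by blast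
  qed
  have opposite: "(\<pi> v, \<pi> u) \<in> lex_less" if uv: "u \<in> set ps" "v \<in> set qs" for u v
  proof (rule g_less)
    have lt: "(u, v) \<in> lex_less" by (rule ps_qs[OF uv])
    show uA: "u \<in> A" "v \<in> A" using uv in_A by blast+
    show "v \<noteq> u" using lt lex_less_irrefl by blast
    show "lexlt (snd (g (0, snd v \<frown> ?o))) (snd (g (0, snd u \<frown> ?o)))"
      using L less[OF lt uA] point[OF uA(1)] point[OF uA(2)] P_ps[OF uv(1)] P_qs[OF uv(2)]
      unfolding cut_mono_def P_def by blast
  qed
  define vs where "vs = map \<pi> (qs @ ps)"
  have "sorted_wrt (\<lambda>u v. (u, v) \<in> lex_less) (map \<pi> qs)"
    unfolding sorted_wrt_map using sorted_us(2)
    by (rule sorted_wrt_mono_rel[rotated]) (use same in_A P_qs in metis)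
  moreover have "sorted_wrt (\<lambda>u v. (u, v) \<in> lex_less) (map \<pi> ps)"
    unfolding sorted_wrt_map using sorted_us(1)
    by (rule sorted_wrt_mono_rel[rotated]) (use same in_A P_ps in metis)
  ultimately have "sorted_wrt (\<lambda>u v. (u, v) \<in> lex_less) vs"
    using opposite by (auto simp: vs_def sorted_wrt_append)
  moreover have "set vs = B"
  proof -
    have "set vs = \<pi> ` set us" unfolding vs_def us_eq by auto
    then show ?thesis using bij_betw_imp_surj_on[OF \<pi>] set_us by simp
  qed
  ultimately have "lex_listing B vs" by (simp add: lex_listing_def)
  moreover have "\<pi> (us ! i) = vs ! ((i + length qs) mod length us)" if "i < length us" for i
  proof (cases "i < length ps")
    case True
    then have "(i + length qs) mod length us = i + length qs" by (simp add: us_eq)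
    then show ?thesis using True by (simp add: vs_def us_eq nth_append)
  next
    case False
    then have "i + length qs = (i - length ps) + length us" by (simp add: us_eq)
    moreover have "i - length ps < length us" using that by simp
    ultimately have "(i + length qs) mod length us = i - length ps" by simp
    moreover have "i - length ps < length qs" using that False by (simp add: us_eq less_diff_conv2)
    ultimately show ?thesis using False that by (simp add: vs_def us_eq nth_append)
  qed
  ultimately show ?thesis using us by blast
qed

lemma Bij_cantor_base:
  assumes "g \<in> Bij (cantor n 1)"
  shows "inj_on (\<lambda>x. snd (g (0, x))) (undotted_points n)"
    and "x \<in> undotted_points n \<Longrightarrow> g (0, x) = (0, snd (g (0, x)))"
    and "x \<in> undotted_points n \<Longrightarrow> snd (g (0, x)) \<in> undotted_points n"
proof -
  have *: "g (0, x) = (0, snd (g (0, x))) \<and> snd (g (0, x)) \<in> undotted_points n"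
    if "x \<in> undotted_points n" for x
  proof -
    have "g (0, x) \<in> cantor n 1"
      using Bij_imp_funcset[OF assms] that by (auto simp: cantor_1_iff)
    then show ?thesis by (auto simp: cantor_1_iff)
  qed
  then show "x \<in> undotted_points n \<Longrightarrow> g (0, x) = (0, snd (g (0, x)))"
    and "x \<in> undotted_points n \<Longrightarrow> snd (g (0, x)) \<in> undotted_points n" by blast+
  show "inj_on (\<lambda>x. snd (g (0, x))) (undotted_points n)"
  proof (rule inj_onI)
    fix x y assume xy: "x \<in> undotted_points n" "y \<in> undotted_points n" "snd (g (0, x)) = snd (g (0, y))"
    then have "g (0, x) = g (0, y)" using * by metis
    moreover have "inj_on g (cantor n 1)" using assms by (simp add: Bij_def bij_betw_def)
    moreover have "(0, x) \<in> cantor n 1" "(0, y) \<in> cantor n 1" using xy by (simp_all add: cantor_def)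
    ultimately have "(0::nat, x) = (0, y)" by (metis inj_onD)
    then show "x = y" by simp
  qed
qed

text \<open>A cut does not refer to antichains; so the pair that witnesses membership in G also
  witnesses membership in T.\<close>

lemma T_set_iff:
  assumes "0 < n"
  shows "g \<in> T_set n 1 \<longleftrightarrow> g \<in> G_set n 1 \<and> cyclic_mono n g"
proof
  assume "g \<in> T_set n 1"
  then show "g \<in> G_set n 1 \<and> cyclic_mono n g"
    unfolding T_set_def using cut_mono_of_rotation cyclic_mono_of_cut by blast
next
  assume g: "g \<in> G_set n 1 \<and> cyclic_mono n g"
  then have gB: "g \<in> Bij (cantor n 1)" using G_set_subset_Bij[OF assms] by blast
  have "cyclic_mono n g" using g ..
  from cut_mono_of_cyclic[OF assms Bij_cantor_base(1)[OF gB] this]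
  obtain L where L: "cut_mono n g L" by blast
  obtain A B \<pi> where r: "replaces_prefixes n 1 g A B \<pi>" using g unfolding G_set_def by blast
  then show "g \<in> T_set n 1"
    using g rotation_of_cut_mono[OF assms r L] unfolding T_set_def by blast
qed

section \<open>The group T\<close>

lemma cyclic_mono_mono:
  assumes "\<And>x y. x \<in> undotted_points n \<Longrightarrow> y \<in> undotted_points n \<Longrightarrow> lexlt x y \<Longrightarrow>
    lexlt (snd (g (0, x))) (snd (g (0, y)))"
  shows "cyclic_mono n g"
  unfolding cyclic_mono_def cyc_def using assms by blast

lemma cyclic_mono_compose:
  assumes "cyclic_mono n g" "g \<in> Bij (cantor n 1)" "cyclic_mono n h"
  shows "cyclic_mono n (compose (cantor n 1) h g)"
proof -
  have "snd (compose (cantor n 1) h g (0, x)) = snd (h (0, snd (g (0, x))))"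
    if "x \<in> undotted_points n" for x
    using Bij_cantor_base(2)[OF assms(2) that] that by (simp add: compose_def cantor_def)
  then show ?thesis
    using assms Bij_cantor_base(3)[OF assms(2)] unfolding cyclic_mono_def by simp
qed

text \<open>Three distinct points have exactly one of two cyclic orientations. If the inverse
  reversed a triple, \<open>g\<close> would carry the reversed orientation back to the original
  points.\<close>

lemma cyclic_mono_inv:
  assumes c: "cyclic_mono n g" and g: "g \<in> Bij (cantor n 1)"
  shows "cyclic_mono n (\<lambda>p\<in>cantor n 1. inv_into (cantor n 1) g p)"
proof -
  define k where "k = (\<lambda>p\<in>cantor n 1. inv_into (cantor n 1) g p)"
  have k: "k \<in> Bij (cantor n 1)" unfolding k_def by (rule restrict_inv_into_Bij[OF g])
  have bij: "bij_betw g (cantor n 1) (cantor n 1)" using g by (simp add: Bij_def)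
  have gk: "snd (g (0, snd (k (0, x)))) = x" if "x \<in> undotted_points n" for x
  proof -
    have "(0, x) \<in> cantor n 1" using that by (auto simp: cantor_1_iff)
    then have "g (k (0, x)) = (0, x)" using bij_betw_inv_into_right[OF bij] by (simp add: k_def)
    then show ?thesis using Bij_cantor_base(2)[OF k that] by simp
  qed
  have "cyc (snd (k (0, x))) (snd (k (0, y))) (snd (k (0, z)))"
    if xyz: "x \<in> undotted_points n" "y \<in> undotted_points n" "z \<in> undotted_points n" "cyc x y z" for x y z
  proof -
    let ?x = "snd (k (0, x))" and ?y = "snd (k (0, y))" and ?z = "snd (k (0, z))"
    have "x \<noteq> y" "y \<noteq> z" "x \<noteq> z" using xyz(4) lexlt_irrefl lexlt_trans unfolding cyc_def by blast+
    then have ne: "?x \<noteq> ?y" "?y \<noteq> ?z" "?x \<noteq> ?z" using gk xyz by metis+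
    have "\<not> cyc x z y"
      using xyz(4) lexlt_irrefl lexlt_trans unfolding cyc_def by blast
    moreover have "cyc ?x ?z ?y \<Longrightarrow> cyc x z y"
      using c Bij_cantor_base(3)[OF k] gk xyz(1-3) unfolding cyclic_mono_def by metis
    ultimately have "\<not> cyc ?x ?z ?y" by blast
    then show ?thesis
      using ne lexlt_total[of ?x ?y] lexlt_total[of ?y ?z] lexlt_total[of ?x ?z] unfolding cyc_def by argo
  qed
  then show ?thesis unfolding cyclic_mono_def k_def by blast
qed

lemma T_set_subset_Bij: "0 < n \<Longrightarrow> T_set n 1 \<subseteq> Bij (cantor n 1)"
  using T_set_iff G_set_subset_Bij by blast

lemma group_T:
  assumes n: "0 < n"
  shows "group (T_group n 1)"
  unfolding T_group_def
proof (rule group_right_action_groupI)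
  show "T_set n 1 \<subseteq> Bij (cantor n 1)" by (rule T_set_subset_Bij[OF n])
  have "cyclic_mono n (\<lambda>p\<in>cantor n 1. p)" by (rule cyclic_mono_mono) (simp add: cantor_def)
  then show "(\<lambda>p\<in>cantor n 1. p) \<in> T_set n 1" using T_set_iff[OF n] G_set_id[OF n] by blast
next
  fix g h assume "g \<in> T_set n 1" "h \<in> T_set n 1"
  then show "compose (cantor n 1) h g \<in> T_set n 1"
    using T_set_iff[OF n] G_set_compose[OF n] G_set_subset_Bij[OF n] cyclic_mono_compose by blast
next
  fix g assume "g \<in> T_set n 1"
  then show "(\<lambda>p\<in>cantor n 1. inv_into (cantor n 1) g p) \<in> T_set n 1"
    using T_set_iff[OF n] G_set_inv[OF n] G_set_subset_Bij[OF n] cyclic_mono_inv by blast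
qed

section \<open>The action of binary word permutations on the Cantor space\<close>

definition middle :: "nat \<Rightarrow> nat \<Rightarrow> bool" where
  "middle n c \<longleftrightarrow> 0 < c \<and> c < n - 1"

definition enc :: "nat \<Rightarrow> bool list \<Rightarrow> nat list" where
  "enc n w = map (\<lambda>b. if b then n - 1 else 0) w"

text \<open>Inverts \<open>enc n\<close> only on words without middle letters; a middle letter would
  be read as \<open>True\<close>.\<close>

definition dec :: "nat list \<Rightarrow> bool list" where
  "dec w = map (\<lambda>c. c \<noteq> 0) w"

definition first_middle :: "nat \<Rightarrow> (nat \<Rightarrow> nat) \<Rightarrow> nat" where
  "first_middle n x = (LEAST k. middle n (x k))"

text \<open>A definite place to cut a point without middle letters. Any later cut gives the same
  result, see \<open>act_binary'\<close>.\<close>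

definition stable :: "(bool list \<Rightarrow> bool list) \<Rightarrow> nat" where
  "stable \<beta> = (LEAST M. \<forall>u t. M \<le> length u \<longrightarrow> \<beta> (u @ t) = \<beta> u @ t)"

lemma stableD:
  assumes "eventually_prefix \<beta>" "stable \<beta> \<le> length u"
  shows "\<beta> (u @ t) = \<beta> u @ t"
proof -
  have "\<forall>u t. stable \<beta> \<le> length u \<longrightarrow> \<beta> (u @ t) = \<beta> u @ t"
    unfolding stable_def by (rule LeastI_ex) (use assms(1) in \<open>simp add: eventually_prefix_def\<close>)
  then show ?thesis using assms(2) by simp
qed

definition first_block :: "nat \<Rightarrow> (bool list \<Rightarrow> bool list) \<Rightarrow> (nat \<Rightarrow> nat) \<Rightarrow> nat list" where
  "first_block n \<beta> x = enc n (\<beta> (dec (prefix (first_middle n x) x)))"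

text \<open>A point is read as a sequence of blocks, each a word in the two extreme letters followed by a
  middle letter, and \<open>\<beta>\<close> is applied to the word of every block.  If there is no further middle
  letter, \<open>\<beta>\<close> is applied to a long prefix.  The recursion on the position of the requested letter
  ends because each block contributes at least its middle letter.\<close>

function act :: "nat \<Rightarrow> (bool list \<Rightarrow> bool list) \<Rightarrow> (nat \<Rightarrow> nat) \<Rightarrow> nat \<Rightarrow> nat" where
  "act n \<beta> x i =
    (if \<exists>k. middle n (x k) then
       if i < length (first_block n \<beta> x) then first_block n \<beta> x ! i
       else if i = length (first_block n \<beta> x) then x (first_middle n x)
       else act n \<beta> (suffix (Suc (first_middle n x)) x) (i - Suc (length (first_block n \<beta> x)))
     else (enc n (\<beta> (dec (prefix (stable \<beta>) x))) \<frown> suffix (stable \<beta>) x) i)"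
  by pat_completeness auto
termination
  by (relation "Wellfounded.measure (\<lambda>(n, \<beta>, x, i). i)") auto

declare act.simps [simp del]

lemma length_enc [simp]: "length (enc n w) = length w"
  by (simp add: enc_def)

lemma enc_append: "enc n (u @ v) = enc n u @ enc n v"
  by (simp add: enc_def)

lemma enc_simps: "enc n [] = []" "enc n (b # w) = (if b then n - 1 else 0) # enc n w"
  by (simp_all add: enc_def)

definition middle_infinitely_often :: "nat \<Rightarrow> (nat \<Rightarrow> nat) \<Rightarrow> bool" where
  "middle_infinitely_often n x \<longleftrightarrow> (\<forall>k. \<exists>i\<ge>k. middle n (x i))"

context
  fixes n :: nat
  assumes n: "3 \<le> n"
begin

section \<open>Extreme letters, middle letters and blocks\<close>

lemma middle_1: "middle n 1"
  using n by (simp add: middle_def)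

lemma zero_in_undotted_points: "(\<lambda>_. 0) \<in> undotted_points n"
  using n by (simp add: undotted_points_iff)

lemma middle_less: "middle n c \<Longrightarrow> c < n"
  unfolding middle_def by linarith

lemma enc_in_lists [simp]: "enc n w \<in> lists {..<n}"
  using n by (auto simp: enc_def lists_eq_set)

lemma not_middle_enc: "i < length w \<Longrightarrow> \<not> middle n (enc n w ! i)"
  by (simp add: enc_def middle_def)

lemma dec_enc [simp]: "dec (enc n w) = w"
  using n by (induction w) (simp_all add: enc_def dec_def)

lemma enc_eq_iff [simp]: "enc n u = enc n v \<longleftrightarrow> u = v"
  by (metis dec_enc)

lemma enc_dec:
  assumes "\<forall>c\<in>set w. c < n \<and> \<not> middle n c"
  shows "enc n (dec w) = w"
  using assms by (induction w) (auto simp: enc_def dec_def middle_def)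

lemma first_middle_block:
  assumes "middle n c"
  shows "first_middle n (enc n w \<frown> c ## y) = length w"
  unfolding first_middle_def
proof (rule Least_equality)
  show "middle n ((enc n w \<frown> c ## y) (length w))" using assms by simp
  show "length w \<le> k" if "middle n ((enc n w \<frown> c ## y) k)" for k
    using that not_middle_enc[of k w] by (cases "k < length w") simp_all
qed

lemma block_cases:
  assumes x: "x \<in> undotted_points n"
  obtains (block) w c y where "middle n c" "y \<in> undotted_points n" "x = enc n w \<frown> c ## y"
  | (binary) "\<forall>i. \<not> middle n (x i)"
proof (cases "\<exists>k. middle n (x k)")
  case True
  define k where "k = first_middle n x"
  have m: "middle n (x k)" unfolding k_def first_middle_def by (rule LeastI_ex[OF True])
  have "\<not> middle n (x i)" if "i < k" for i
    using that not_less_Least unfolding k_def first_middle_def by blast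
  then have "enc n (dec (prefix k x)) = prefix k x"
    using x by (intro enc_dec) (auto simp: undotted_points_iff)
  moreover have "x = prefix k x \<frown> x k ## suffix (Suc k) x"
    using prefix_suffix[of x "Suc k"] by simp
  ultimately have "x = enc n (dec (prefix k x)) \<frown> x k ## suffix (Suc k) x" by simp
  then show thesis by (rule block[OF m suffix_in_undotted_points[OF x]])
qed (use binary in blast)

lemma enc_prefix_binary:
  assumes "x \<in> undotted_points n" "\<forall>i. \<not> middle n (x i)"
  shows "enc n (dec (prefix k x)) = prefix k x"
  using assms by (intro enc_dec) (auto simp: undotted_points_iff)

lemma block_eq_iff:
  assumes "middle n c" "middle n d"
  shows "enc n u \<frown> c ## x = enc n v \<frown> d ## y \<longleftrightarrow> u = v \<and> c = d \<and> x = y"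
proof
  assume eq: "enc n u \<frown> c ## x = enc n v \<frown> d ## y"
  then have "length u = length v"
    using first_middle_block[OF assms(1), of u x] first_middle_block[OF assms(2), of v y] by simp
  then show "u = v \<and> c = d \<and> x = y" using eq by simp
qed simp

lemma nth_block:
  "(enc n w \<frown> c ## y) (length w) = c"
  "(enc n w \<frown> c ## y) (Suc (length w + j)) = y j"
  by (simp_all add: conc_def Suc_diff_le)

lemma block_position_cases:
  fixes i k :: nat
  obtains (inside) "i < k" | (letter) "i = k" | (beyond) j where "i = Suc (k + j)"
  using less_imp_Suc_add[of k i] by (metis nat_neq_iff)

text \<open>Together with \<open>act_binary\<close> this replaces the letterwise definition, which
  is not unfolded again after these two lemmas.\<close>

lemma act_block:
  assumes c: "middle n c"
  shows "act n \<beta> (enc n w \<frown> c ## y) = enc n (\<beta> w) \<frown> c ## act n \<beta> y"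
proof
  fix i
  define x where "x = enc n w \<frown> c ## y"
  have f: "first_middle n x = length w" unfolding x_def by (rule first_middle_block[OF c])
  have b: "first_block n \<beta> x = enc n (\<beta> w)"
    using prefix_conc_length[of "enc n w" "c ## y"] by (simp add: first_block_def f) (simp add: x_def)
  have l: "x (length w) = c" by (simp add: x_def)
  have s: "suffix (Suc (length w)) x = y"
    using suffix_conc_length[of "enc n w @ [c]" y] by (simp add: x_def)
  have "\<exists>k. middle n (x k)" using c l by metis
  then have act: "act n \<beta> x i = (if i < length (\<beta> w) then enc n (\<beta> w) ! i
      else if i = length (\<beta> w) then c else act n \<beta> y (i - Suc (length (\<beta> w))))"
    using act.simps[of n \<beta> x i] by (simp add: f b l s)
  show "act n \<beta> (enc n w \<frown> c ## y) i = (enc n (\<beta> w) \<frown> c ## act n \<beta> y) i"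
    using act unfolding x_def[symmetric]
    by (cases i "length (\<beta> w)" rule: block_position_cases) (simp_all add: nth_block)
qed

lemma binary_conc:
  assumes "\<forall>i. \<not> middle n (z i)"
  shows "\<not> middle n ((enc n u \<frown> z) i)"
  using assms not_middle_enc[of i u] by (cases "i < length u") simp_all

lemma act_binary:
  assumes \<beta>: "eventually_prefix \<beta>" and z: "\<forall>i. \<not> middle n (z i)" and u: "stable \<beta> \<le> length u"
  shows "act n \<beta> (enc n u \<frown> z) = enc n (\<beta> u) \<frown> z"
proof -
  let ?M = "stable \<beta>"
  have p: "prefix ?M (enc n u \<frown> z) = enc n (take ?M u)"
    using u by (simp add: enc_def take_map)
  have s: "suffix ?M (enc n u \<frown> z) = enc n (drop ?M u) \<frown> z"
    using u by (simp add: enc_def drop_map)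
  have "act n \<beta> (enc n u \<frown> z) = enc n (\<beta> (take ?M u)) \<frown> enc n (drop ?M u) \<frown> z"
    using binary_conc[OF z] by (intro ext, subst act.simps) (simp add: p s del: conc_conc)
  also have "\<dots> = enc n (\<beta> (take ?M u @ drop ?M u)) \<frown> z"
    using u by (subst stableD[OF \<beta>]) (simp_all add: enc_append)
  finally show ?thesis by simp
qed

lemma act_binary':
  assumes \<beta>: "eventually_prefix \<beta>" and x: "x \<in> undotted_points n" "\<forall>i. \<not> middle n (x i)"
    and k: "stable \<beta> \<le> k"
  shows "act n \<beta> x = enc n (\<beta> (dec (prefix k x))) \<frown> suffix k x"
proof -
  have "act n \<beta> (enc n (dec (prefix k x)) \<frown> suffix k x) = enc n (\<beta> (dec (prefix k x))) \<frown> suffix k x"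
    using x(2) k by (intro act_binary[OF \<beta>]) (simp_all add: dec_def)
  then show ?thesis by (simp add: enc_prefix_binary[OF x])
qed

section \<open>The laws of an action\<close>

lemma act_in_undotted_points:
  assumes \<beta>: "eventually_prefix \<beta>" and "x \<in> undotted_points n"
  shows "act n \<beta> x \<in> undotted_points n"
proof -
  have "act n \<beta> x i < n" if "x \<in> undotted_points n" for x i
    using that
  proof (induction i arbitrary: x rule: less_induct)
    case (less i)
    from less.prems show ?case
    proof (cases rule: block_cases)
      case (block w c y)
      show ?thesis
        unfolding block(3) act_block[OF block(1)]
      proof (cases i "length (\<beta> w)" rule: block_position_cases)
        case inside
        then show "(enc n (\<beta> w) \<frown> c ## act n \<beta> y) i < n" using n by (simp add: enc_def)
      next
        case letter
        then show "(enc n (\<beta> w) \<frown> c ## act n \<beta> y) i < n"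
          using middle_less[OF block(1)] by (simp add: nth_block)
      next
        case (beyond j)
        then show "(enc n (\<beta> w) \<frown> c ## act n \<beta> y) i < n"
          using less.IH[OF _ block(2), of j] by (simp add: nth_block)
      qed
    next
      case binary
      have "act n \<beta> x \<in> undotted_points n"
        unfolding act_binary'[OF \<beta> less.prems binary order_refl] using less.prems by simp
      then show ?thesis by (simp add: undotted_points_iff)
    qed
  qed
  then show ?thesis using assms(2) by (simp add: undotted_points_iff)
qed

lemma act_compose:
  assumes \<beta>: "eventually_prefix \<beta>" and \<gamma>: "eventually_prefix \<gamma>" and \<delta>: "eventually_prefix \<delta>"
    and \<delta>_eq: "\<And>w. \<delta> w = \<beta> (\<gamma> w)" and x: "x \<in> undotted_points n"
  shows "act n \<beta> (act n \<gamma> x) = act n \<delta> x"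
proof
  fix i
  show "act n \<beta> (act n \<gamma> x) i = act n \<delta> x i"
    using x
  proof (induction i arbitrary: x rule: less_induct)
    case (less i)
    from less.prems show ?case
    proof (cases rule: block_cases)
      case (block w c y)
      show ?thesis
        unfolding block(3) act_block[OF block(1)] \<delta>_eq[of w]
        using less.IH[OF _ block(2), of "i - Suc (length (\<beta> (\<gamma> w)))"]
        by (cases i "length (\<beta> (\<gamma> w))" rule: block_position_cases) (simp_all add: nth_block)
    next
      case binary
      \<comment> \<open>\<open>\<gamma>\<close> alters only the first \<open>stable \<gamma>\<close>
        letters of u, so \<open>\<gamma> u\<close> keeps at least \<open>stable \<beta>\<close>
        letters and \<open>act_binary\<close> applies a second time.\<close>
      define k where "k = stable \<gamma> + stable \<beta> + stable \<delta>"
      define u where "u = dec (prefix k x)"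
      have k: "stable \<gamma> \<le> k" "stable \<delta> \<le> k" by (simp_all add: k_def)
      have "u = take (stable \<gamma>) u @ drop (stable \<gamma>) u" by simp
      then have "\<gamma> u = \<gamma> (take (stable \<gamma>) u) @ drop (stable \<gamma>) u"
        by (metis \<gamma> stableD length_take min.absorb2 k(1) u_def dec_def length_map diff_zero subsequence_length order_refl)
      moreover have "length u = k" by (simp add: u_def dec_def)
      ultimately have "length (\<gamma> u) \<ge> stable \<beta>" by (simp add: k_def)
      then have "act n \<beta> (enc n (\<gamma> u) \<frown> suffix k x) = enc n (\<beta> (\<gamma> u)) \<frown> suffix k x"
        using binary by (intro act_binary[OF \<beta>]) simp_all
      then show ?thesis
        using act_binary'[OF \<gamma> less.prems binary k(1)] act_binary'[OF \<delta> less.prems binary k(2)]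
        by (simp add: \<delta>_eq[of u] flip: u_def)
    qed
  qed
qed

lemma act_id:
  assumes "\<And>w. \<delta> w = w" "x \<in> undotted_points n"
  shows "act n \<delta> x = x"
proof
  have \<delta>: "eventually_prefix \<delta>" using assms(1) by (simp add: eventually_prefix_def)
  fix i
  show "act n \<delta> x i = x i"
    using assms(2)
  proof (induction i arbitrary: x rule: less_induct)
    case (less i)
    from less.prems show ?case
    proof (cases rule: block_cases)
      case (block w c y)
      show ?thesis
        unfolding block(3) act_block[OF block(1)] assms(1)[of w]
        using less.IH[OF _ block(2), of "i - Suc (length w)"]
        by (cases i "length w" rule: block_position_cases) (simp_all add: nth_block)
    next
      case binary
      show ?thesis
        unfolding act_binary'[OF \<delta> less.prems binary order_refl]
          assms(1)[of "dec (prefix (stable \<delta>) x)"]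
        by (simp add: enc_prefix_binary[OF less.prems binary])
    qed
  qed
qed

text \<open>What the action does behind a long word of extreme letters: the rest of the current
  block is copied, and behind its middle letter the action starts afresh. It does not depend on the
  word read before, which is the key to conjugation.\<close>

definition act_tail :: "(bool list \<Rightarrow> bool list) \<Rightarrow> (nat \<Rightarrow> nat) \<Rightarrow> nat \<Rightarrow> nat" where
  "act_tail \<beta> y = (if \<exists>k. middle n (y k)
     then prefix (Suc (first_middle n y)) y \<frown> act n \<beta> (suffix (Suc (first_middle n y)) y) else y)"

lemma act_tail_block:
  assumes "middle n c"
  shows "act_tail \<beta> (enc n w \<frown> c ## y) = enc n w \<frown> c ## act n \<beta> y"
proof -
  have "\<exists>k. middle n ((enc n w \<frown> c ## y) k)" using assms by (intro exI[of _ "length w"]) simp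
  moreover have "suffix (Suc (length w)) (enc n w \<frown> c ## y) = y"
    using suffix_conc_length[of "enc n w @ [c]" y] by simp
  moreover have "prefix (Suc (length w)) (enc n w \<frown> c ## y) = enc n w @ [c]"
    using prefix_conc_length[of "enc n w @ [c]" y] by simp
  ultimately show ?thesis by (simp add: act_tail_def first_middle_block[OF assms])
qed

lemma act_long:
  assumes \<beta>: "eventually_prefix \<beta>" and u: "stable \<beta> \<le> length u" and y: "y \<in> undotted_points n"
  shows "act n \<beta> (enc n u \<frown> y) = enc n (\<beta> u) \<frown> act_tail \<beta> y"
  using y
proof (cases rule: block_cases)
  case (block w c z)
  have "act n \<beta> (enc n u \<frown> y) = enc n (\<beta> (u @ w)) \<frown> c ## act n \<beta> z"
    using act_block[OF block(1), of \<beta> "u @ w" z] by (simp add: block(3) enc_append)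
  then show ?thesis
    using block(3) stableD[OF \<beta> u] act_tail_block[OF block(1)] by (simp add: enc_append)
next
  case binary
  then show ?thesis using act_binary[OF \<beta> binary u] by (simp add: act_tail_def)
qed

text \<open>Lets an arbitrary tail be written as \<open>act_tail \<beta> y\<close> when a conjugated
  map is evaluated.\<close>

lemma act_tail_surj:
  assumes onto: "\<And>z. z \<in> undotted_points n \<Longrightarrow> \<exists>y\<in>undotted_points n. act n \<beta> y = z"
    and z: "z \<in> undotted_points n"
  shows "\<exists>y\<in>undotted_points n. act_tail \<beta> y = z"
  using z
proof (cases rule: block_cases)
  case (block w c z')
  then obtain y where y: "y \<in> undotted_points n" "act n \<beta> y = z'" using onto by blast
  then have "act_tail \<beta> (enc n w \<frown> c ## y) = z" using block act_tail_block by simp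
  moreover have "enc n w \<frown> c ## y \<in> undotted_points n" using y block middle_less by simp
  ultimately show ?thesis by blast
next
  case binary
  then have "act_tail \<beta> z = z" by (simp add: act_tail_def)
  then show ?thesis using z by blast
qed

lemma act_tail_in_undotted_points:
  assumes "eventually_prefix \<beta>" "y \<in> undotted_points n"
  shows "act_tail \<beta> y \<in> undotted_points n"
  using assms(2)
proof (cases rule: block_cases)
  case (block w c z)
  then show ?thesis
    using act_tail_block act_in_undotted_points[OF assms(1)] middle_less by simp
next
  case binary
  then show ?thesis using assms(2) by (simp add: act_tail_def)
qed

text \<open>Induction along the blocks of a finite word. The last block may be incomplete, which
  makes words of extreme letters the base case.\<close>

lemma word_block_induct [consumes 1, case_names binary block]:
  assumes u: "u \<in> lists {..<n}"
    and enc: "\<And>w. P (enc n w)"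
    and step: "\<And>w c u. middle n c \<Longrightarrow> u \<in> lists {..<n} \<Longrightarrow> P u \<Longrightarrow> P (enc n w @ c # u)"
  shows "P u"
proof -
  \<comment> \<open>\<open>enc n w\<close> collects the letters of the block that is still
    open.\<close>
  have "P (enc n w @ u)" for w
    using u
  proof (induction u arbitrary: w rule: list.induct)
    case Nil
    then show ?case using enc by simp
  next
    case (Cons a u)
    show ?case
    proof (cases "middle n a")
      case True
      have u: "u \<in> lists {..<n}" using Cons.prems by simp
      then have "P u" using Cons.IH[of "[]"] by (simp add: enc_simps)
      then show ?thesis by (rule step[OF True u])
    next
      case False
      then have "enc n w @ a # u = enc n (w @ [a \<noteq> 0]) @ u"
        using Cons.prems by (auto simp: middle_def enc_append enc_simps)
      moreover have "P (enc n (w @ [a \<noteq> 0]) @ u)"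
        by (rule Cons.IH) (use Cons.prems in simp)
      ultimately show ?thesis by (simp only:)
    qed
  qed
  from this[of "[]"] show ?thesis by (simp add: enc_simps)
qed

text \<open>A middle letter closes the current block, so the action behind it has no memory of
  u.\<close>

lemma act_word_middle:
  assumes "u \<in> lists {..<n}" "middle n c"
  shows "\<exists>q\<in>lists {..<n}. \<forall>y. act n \<beta> (u \<frown> c ## y) = q \<frown> c ## act n \<beta> y"
  using assms(1)
proof (induction rule: word_block_induct)
  case (binary w)
  show ?case using act_block[OF assms(2)] by (intro bexI[of _ "enc n (\<beta> w)"]) simp_all
next
  case (block w d u)
  then obtain q where "q \<in> lists {..<n}" "\<And>y. act n \<beta> (u \<frown> c ## y) = q \<frown> c ## act n \<beta> y" by blast
  then show ?case
    using act_block[OF block(1), of \<beta> w] middle_less[OF block(1)]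
    by (intro bexI[of _ "enc n (\<beta> w) @ d # q"]) simp_all
qed

text \<open>The last block of u may still be open, but with t appended it is at least
  \<open>stable \<beta>\<close> long; behind it only \<open>act_tail\<close> is left.\<close>

lemma act_word_binary:
  assumes \<beta>: "eventually_prefix \<beta>" and u: "u \<in> lists {..<n}" and t: "stable \<beta> \<le> length t"
  shows "\<exists>q\<in>lists {..<n}. \<forall>y\<in>undotted_points n.
    act n \<beta> (u \<frown> enc n t \<frown> y) = q \<frown> act_tail \<beta> y"
  using u
proof (induction rule: word_block_induct)
  case (binary w)
  show ?case using act_long[OF \<beta>, of "w @ t"] t
    by (intro bexI[of _ "enc n (\<beta> (w @ t))"]) (simp_all add: enc_append)
next
  case (block w d u)
  then obtain q where "q \<in> lists {..<n}"
    "\<forall>y\<in>undotted_points n. act n \<beta> (u \<frown> enc n t \<frown> y) = q \<frown> act_tail \<beta> y" by blast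
  then show ?case
    using act_block[OF block(1), of \<beta> w] middle_less[OF block(1)]
    by (intro bexI[of _ "enc n (\<beta> w) @ d # q"]) simp_all
qed

text \<open>A long word s and the word by which g replaces it end in the same letters, behind which
  the action has lost all memory. So the action turns s y and its image under g into q z and q' z
  with the same z, and z is arbitrary because the action is onto. Hence h replaces q by q'. The
  lengths of the words q vary, which \<open>replaces_long_prefixes_cover\<close> evens out.\<close>

lemma act_conjugate:
  assumes \<beta>: "eventually_prefix \<beta>"
    and onto: "\<And>z. z \<in> undotted_points n \<Longrightarrow> \<exists>y\<in>undotted_points n. act n \<beta> y = z"
    and g: "replaces_long_prefixes n g N"
    and h: "\<And>x. x \<in> undotted_points n \<Longrightarrow> h (0, act n \<beta> x) = (0, act n \<beta> (snd (g (0, x))))"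
  shows "\<exists>N. replaces_long_prefixes n h N"
proof -
  let ?X = "undotted_points n" and ?L = "lists {..<n}"
  \<comment> \<open>N letters for \<open>g\<close>, followed by a window of
    \<open>stable \<beta>\<close> letters that \<open>g\<close> leaves in place.\<close>
  define K where "K = N + stable \<beta>"
  define S where "S = {s \<in> ?L. length s = K}"
  \<comment> \<open>q begins the images of all points of the cone of s, and it is a prefix that
    \<open>h\<close> replaces.\<close>
  define R where "R s q \<longleftrightarrow> q \<in> ?L \<and> (\<forall>y\<in>?X. \<exists>z\<in>?X. act n \<beta> (s \<frown> y) = q \<frown> z) \<and>
    (\<exists>v\<in>?L. \<forall>y\<in>?X. h (0, q \<frown> y) = (0, v \<frown> y))" for s q
  have "\<exists>q. R s q" if "s \<in> S" for s
  proof -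
    have s: "s \<in> ?L" "length s = K" using that by (auto simp: S_def)
    have sub: "take p s \<in> ?L" "drop p s \<in> ?L" for p
      using s(1) set_take_subset[of p s] set_drop_subset[of p s] by (auto simp: lists_eq_set)
    show ?thesis
    proof (cases "\<exists>p. N \<le> p \<and> p < K \<and> middle n (s ! p)")
      \<comment> \<open>A middle letter in the window survives \<open>g\<close>, and on both sides
        the action starts afresh behind it.\<close>
      case True
      then obtain p where p: "N \<le> p" "p < K" and c: "middle n (s ! p)" by blast
      define c where "c = s ! p"
      have c: "middle n c" "c < n" using c middle_less by (simp_all add: c_def)
      have "N \<le> length (take p s)" using p s by simp
      then obtain v where v: "v \<in> ?L" "\<forall>x\<in>?X. g (0, take p s \<frown> x) = (0, v \<frown> x)"
        by (rule replaces_long_prefixesD[OF g sub(1)[of p]])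
      obtain q where q: "q \<in> ?L" "\<forall>y. act n \<beta> (take p s \<frown> c ## y) = q \<frown> c ## act n \<beta> y"
        using act_word_middle[OF sub(1) c(1)] by blast
      obtain q' where q': "q' \<in> ?L" "\<forall>y. act n \<beta> (v \<frown> c ## y) = q' \<frown> c ## act n \<beta> y"
        using act_word_middle[OF v(1) c(1)] by blast
      have s_eq: "s = take p s @ c # drop (Suc p) s"
        using p s by (simp add: c_def id_take_nth_drop)
      have "R s (q @ [c])"
        unfolding R_def
      proof (intro conjI ballI bexI[of _ "q' @ [c]"])
        show "q @ [c] \<in> ?L" "q' @ [c] \<in> ?L" using q q' c by simp_all
        fix y assume y: "y \<in> ?X"
        have "act n \<beta> (s \<frown> y) = (q @ [c]) \<frown> act n \<beta> (drop (Suc p) s \<frown> y)"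
          by (subst s_eq) (simp add: q(2))
        moreover have "act n \<beta> (drop (Suc p) s \<frown> y) \<in> ?X"
          using y sub by (intro act_in_undotted_points[OF \<beta>]) simp
        ultimately show "\<exists>z\<in>?X. act n \<beta> (s \<frown> y) = (q @ [c]) \<frown> z" by blast
        \<comment> \<open>An arbitrary tail y is in the range of the action, so the rule for
          \<open>act n \<beta> y'\<close> becomes one for y.\<close>
        obtain y' where y': "y' \<in> ?X" "act n \<beta> y' = y" using onto[OF y] by blast
        have "c ## y' \<in> ?X" using y' c by simp
        then have "g (0, take p s \<frown> c ## y') = (0, v \<frown> c ## y')" "take p s \<frown> c ## y' \<in> ?X"
          using v(2) sub by simp_all
        then show "h (0, (q @ [c]) \<frown> y) = (0, (q' @ [c]) \<frown> y)"
          using h[of "take p s \<frown> c ## y'"] q(2) q'(2) y'(2) by simp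
      qed
      then show ?thesis by blast
    next
      \<comment> \<open>The whole window consists of extreme letters, so both sides continue with
        the same \<open>act_tail\<close>.\<close>
      case False
      define t where "t = dec (drop N s)"
      have "\<not> middle n c" if c: "c \<in> set (drop N s)" for c
      proof -
        obtain i where i: "i < length (drop N s)" "c = drop N s ! i"
          using c unfolding in_set_conv_nth by blast
        then have "c = s ! (N + i)" "N + i < K" using s by auto
        then show ?thesis using False by auto
      qed
      then have enc_t: "enc n t = drop N s"
        unfolding t_def using sub(2)[of N] by (intro enc_dec) (auto simp: lists_eq_set)
      have t: "stable \<beta> \<le> length t" using s by (simp add: t_def dec_def K_def)
      have "N \<le> length (take N s)" using s by (simp add: K_def)
      then obtain v where v: "v \<in> ?L" "\<forall>x\<in>?X. g (0, take N s \<frown> x) = (0, v \<frown> x)"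
        by (rule replaces_long_prefixesD[OF g sub(1)[of N]])
      obtain q where q: "q \<in> ?L" "\<forall>y\<in>?X. act n \<beta> (take N s \<frown> enc n t \<frown> y) = q \<frown> act_tail \<beta> y"
        using act_word_binary[OF \<beta> sub(1) t] by blast
      obtain q' where q': "q' \<in> ?L" "\<forall>y\<in>?X. act n \<beta> (v \<frown> enc n t \<frown> y) = q' \<frown> act_tail \<beta> y"
        using act_word_binary[OF \<beta> v(1) t] by blast
      have s_eq: "s = take N s @ enc n t" by (simp add: enc_t)
      have "R s q"
        unfolding R_def
      proof (intro conjI ballI bexI[of _ q'])
        show "q \<in> ?L" "q' \<in> ?L" using q q' by simp_all
        fix y assume y: "y \<in> ?X"
        have "act n \<beta> (s \<frown> y) = q \<frown> act_tail \<beta> y"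
          using bspec[OF q(2) y] by (subst s_eq) simp
        then show "\<exists>z\<in>?X. act n \<beta> (s \<frown> y) = q \<frown> z"
          using act_tail_in_undotted_points[OF \<beta> y] by blast
        obtain y' where y': "y' \<in> ?X" "act_tail \<beta> y' = y" using act_tail_surj[OF onto y] by blast
        have "enc n t \<frown> y' \<in> ?X" using y' by simp
        then have "g (0, take N s \<frown> enc n t \<frown> y') = (0, v \<frown> enc n t \<frown> y')"
          "take N s \<frown> enc n t \<frown> y' \<in> ?X"
          using bspec[OF v(2)] sub y' by (simp_all del: conc_conc)
        then show "h (0, q \<frown> y) = (0, q' \<frown> y)"
          using h[of "take N s \<frown> enc n t \<frown> y'"] bspec[OF q(2) y'(1)] bspec[OF q'(2) y'(1)] y'(2)
          by (simp del: conc_conc)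
      qed
      then show ?thesis by blast
    qed
  qed
  then have R: "R s (SOME q. R s q)" if "s \<in> S" for s using that by (meson someI_ex)
  show ?thesis
  proof (rule replaces_long_prefixes_cover)
    show "0 < n" using n by simp
    show "finite ((\<lambda>s. SOME q. R s q) ` S)" unfolding S_def by (simp add: finite_lists_length)
    show "(\<lambda>s. SOME q. R s q) ` S \<subseteq> ?L" using R unfolding R_def by blast
    show "\<exists>v\<in>?L. \<forall>x\<in>?X. h (0, u \<frown> x) = (0, v \<frown> x)" if "u \<in> (\<lambda>s. SOME q. R s q) ` S" for u
      using R that unfolding R_def by blast
    fix x assume "x \<in> ?X"
    then obtain z where z: "z \<in> ?X" "act n \<beta> z = x" using onto by blast
    have "prefix K z \<in> S" using prefix_in_lists[OF z(1)] by (simp add: S_def)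
    moreover have "suffix K z \<in> ?X" using z(1) by simp
    ultimately obtain y where "y \<in> ?X" "act n \<beta> (prefix K z \<frown> suffix K z) = (SOME q. R (prefix K z) q) \<frown> y"
      using R[of "prefix K z"] unfolding R_def by blast
    then show "\<exists>u\<in>(\<lambda>s. SOME q. R s q) ` S. \<exists>y\<in>?X. x = u \<frown> y"
      using z(2) \<open>prefix K z \<in> S\<close> by auto
  qed
qed

text \<open>The end of a word acts like the middle letter that follows it: this letter lies between
  the extreme letters just as 1/2 lies between the two halves of the interval.\<close>

lemma lexlt_blocks:
  assumes "bin_mid u < bin_mid v" "middle n c" "middle n d"
  shows "lexlt (enc n u \<frown> c ## x) (enc n v \<frown> d ## y)"
  using assms(1)
proof (induction u arbitrary: v)
  case Nil
  then show ?case
    using assms(2,3) bin_mid_bounds[of "tl v"]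
    by (cases v) (auto simp: enc_simps middle_def of_bool_def split: if_splits)
next
  case (Cons b u)
  show ?case
  proof (cases v)
    case Nil
    then show ?thesis using Cons.prems assms(2,3) bin_mid_bounds[of u]
      by (auto simp: enc_simps middle_def of_bool_def split: if_splits)
  next
    case v: (Cons b' v')
    show ?thesis
    proof (cases "b = b'")
      case True
      then show ?thesis using Cons v by (simp add: enc_simps)
    next
      case False
      then show ?thesis using Cons.prems n bin_mid_bounds[of u] bin_mid_bounds[of v'] v
        by (auto simp: enc_simps of_bool_def split: if_splits)
    qed
  qed
qed

text \<open>A point without middle letters receives the middle letter 1 so far out that the first j
  letters of the point and of its image do not change. A strict inequality is visible at a finite
  position, so the order can be tested on points with a block.\<close>

lemma act_approx:
  assumes \<beta>: "eventually_prefix \<beta>" and x: "x \<in> undotted_points n"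
  obtains w c y where "middle n c" "y \<in> undotted_points n"
    "\<forall>i<j. x i = (enc n w \<frown> c ## y) i" "\<forall>i<j. act n \<beta> x i = act n \<beta> (enc n w \<frown> c ## y) i"
  using x
proof (cases rule: block_cases)
  case (block w c y)
  then show thesis using that by blast
next
  case binary
  \<comment> \<open>\<open>\<beta>\<close> copies all letters after the first
    \<open>stable \<beta>\<close>, so j letters are certain to remain in the image of the
    prefix.\<close>
  define k where "k = stable \<beta> + j"
  define u where "u = dec (prefix k x)"
  have u: "length u = k" "enc n u = prefix k x"
    unfolding u_def by (simp add: dec_def, rule enc_prefix_binary[OF x binary])
  have "u = take (stable \<beta>) u @ drop (stable \<beta>) u" by simp
  moreover have "stable \<beta> \<le> length (take (stable \<beta>) u)" by (simp add: u k_def)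
  ultimately have "\<beta> u = \<beta> (take (stable \<beta>) u) @ drop (stable \<beta>) u" using stableD[OF \<beta>] by metis
  then have l: "j \<le> length (\<beta> u)" by (simp add: u k_def)
  have "act n \<beta> x = enc n (\<beta> u) \<frown> suffix k x"
    unfolding u_def by (rule act_binary'[OF \<beta> x binary]) (simp add: k_def)
  then have "\<forall>i<j. act n \<beta> x i = act n \<beta> (enc n u \<frown> 1 ## (\<lambda>_. 0)) i"
    using l by (simp add: act_block[OF middle_1])
  moreover have "\<forall>i<j. x i = (enc n u \<frown> 1 ## (\<lambda>_. 0)) i"
    by (simp add: u k_def)
  ultimately show thesis using that middle_1 zero_in_undotted_points by blast
qed

text \<open>Induction on the first position of difference. Were the images in the wrong order, close
  approximations by points with a block would show the same contradictory comparisons.\<close>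

lemma act_mono:
  assumes \<beta>: "eventually_prefix \<beta>"
    and mono: "\<And>u v. bin_mid u < bin_mid v \<Longrightarrow> bin_mid (\<beta> u) < bin_mid (\<beta> v)"
    and inj: "inj_on (act n \<beta>) (undotted_points n)"
    and xy: "x \<in> undotted_points n" "y \<in> undotted_points n" "lexlt x y"
  shows "lexlt (act n \<beta> x) (act n \<beta> y)"
proof -
  obtain k where "\<forall>i<k. x i = y i" "x k < y k" using xy(3) by (auto simp: lexlt_def)
  then show ?thesis
    using xy(1,2)
  proof (induction k arbitrary: x y rule: less_induct)
    case (less k)
    \<comment> \<open>Stripping equal first blocks lowers k but leaves tails that may have no middle
      letter. Therefore the approximation takes place inside the induction and not before
      it.\<close>
    have blocks: "lexlt (act n \<beta> (enc n u \<frown> c ## x')) (act n \<beta> (enc n v \<frown> d ## y'))"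
      if eq: "\<forall>i<k. (enc n u \<frown> c ## x') i = (enc n v \<frown> d ## y') i"
        and lt: "(enc n u \<frown> c ## x') k < (enc n v \<frown> d ## y') k"
        and cd: "middle n c" "middle n d" and xy': "x' \<in> undotted_points n" "y' \<in> undotted_points n"
      for u c x' v d y'
    proof -
      have l: "lexlt (enc n u \<frown> c ## x') (enc n v \<frown> d ## y')" using eq lt unfolding lexlt_def by blast
      show ?thesis
      proof (cases "u = v")
        case False
        then have "bin_mid u < bin_mid v"
          using lexlt_blocks[OF _ cd(2,1), of v u y' x'] l lex.less_asym bin_mid_inject[of u v]
          by (metis linorder_less_linear)
        then show ?thesis
          unfolding act_block[OF cd(1)] act_block[OF cd(2)] by (intro lexlt_blocks mono cd)
      next
        case [simp]: True
        show ?thesis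
        proof (cases "c = d")
          case False
          then show ?thesis using l by (simp add: act_block cd)
        next
          case [simp]: True
          have k: "length u < k"
            using lt by (cases k "length u" rule: block_position_cases) (simp_all add: nth_block)
          then obtain k' where k': "k = Suc (length u + k')" using less_imp_Suc_add by blast
          have "lexlt (act n \<beta> x') (act n \<beta> y')"
          proof (rule less.IH[OF _ _ _ xy'])
            show "k' < k" using k' by simp
            show "x' k' < y' k'" using lt by (simp add: k' nth_block)
            show "\<forall>i<k'. x' i = y' i"
            proof (intro allI impI)
              fix i assume "i < k'"
              then show "x' i = y' i"
                using eq[rule_format, of "Suc (length u + i)"] by (simp add: k' nth_block)
            qed
          qed
          then show ?thesis by (simp add: act_block cd)
        qed
      qed
    qed
    show ?case
    proof (rule ccontr)
      assume "\<not> lexlt (act n \<beta> x) (act n \<beta> y)"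
      moreover have "act n \<beta> x \<noteq> act n \<beta> y"
        using inj_onD[OF inj _ less.prems(3,4)] less.prems(2) by auto
      ultimately have "lexlt (act n \<beta> y) (act n \<beta> x)" using lexlt_total by blast
      then obtain l where l: "\<forall>i<l. act n \<beta> y i = act n \<beta> x i" "act n \<beta> y l < act n \<beta> x l"
        unfolding lexlt_def by blast
      \<comment> \<open>Far enough to see both the difference of the points and that of their
        images.\<close>
      define j where "j = Suc (max k l)"
      obtain u c x' where x': "middle n c" "x' \<in> undotted_points n"
        "\<forall>i<j. x i = (enc n u \<frown> c ## x') i" "\<forall>i<j. act n \<beta> x i = act n \<beta> (enc n u \<frown> c ## x') i"
        by (rule act_approx[OF \<beta> less.prems(3)])
      obtain v d y' where y': "middle n d" "y' \<in> undotted_points n"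
        "\<forall>i<j. y i = (enc n v \<frown> d ## y') i" "\<forall>i<j. act n \<beta> y i = act n \<beta> (enc n v \<frown> d ## y') i"
        by (rule act_approx[OF \<beta> less.prems(4)])
      have "lexlt (act n \<beta> (enc n u \<frown> c ## x')) (act n \<beta> (enc n v \<frown> d ## y'))"
        using less.prems(1,2) x' y' by (intro blocks) (simp_all add: j_def)
      moreover have "lexlt (act n \<beta> (enc n v \<frown> d ## y')) (act n \<beta> (enc n u \<frown> c ## x'))"
        unfolding lexlt_def using l x'(4) y'(4) by (intro exI[of _ l]) (simp add: j_def)
      ultimately show False using lex.less_asym by blast
    qed
  qed
qed

text \<open>The action keeps the middle letter that ends each block.\<close>

lemma act_middle_infinitely_often:
  assumes \<beta>: "eventually_prefix \<beta>" and x: "x \<in> undotted_points n" "middle_infinitely_often n x"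
  shows "middle_infinitely_often n (act n \<beta> x)"
proof -
  have "\<exists>i\<ge>k. middle n (act n \<beta> x i)" for k
    using x
  proof (induction k arbitrary: x rule: less_induct)
    case (less k)
    from less.prems(1) show ?case
    proof (cases rule: block_cases)
      case (block w c y)
      show ?thesis
      proof (cases "k \<le> length (\<beta> w)")
        case True
        then show ?thesis
          unfolding block(3) act_block[OF block(1)]
          using block(1) by (intro exI[of _ "length (\<beta> w)"]) (simp add: nth_block)
      next
        case False
        have "middle_infinitely_often n y"
          unfolding middle_infinitely_often_def
        proof
          fix j
          obtain i where i: "j + Suc (length w) \<le> i" "middle n (x i)"
            using less.prems(2) unfolding middle_infinitely_often_def by blast
          obtain m where "i = j + Suc (length w) + m" using le_Suc_ex[OF i(1)] by blast
          then have "i = Suc (length w + (j + m))" by simp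
          then have "middle n (y (j + m))" using i(2) by (simp add: block(3) nth_block)
          then show "\<exists>i\<ge>j. middle n (y i)" by (intro exI[of _ "j + m"]) simp
        qed
        then obtain i where "i \<ge> k - Suc (length (\<beta> w))" "middle n (act n \<beta> y i)"
          using less.IH[of "k - Suc (length (\<beta> w))" y] block(2) False by auto
        then show ?thesis
          unfolding block(3) act_block[OF block(1)]
          by (intro exI[of _ "Suc (length (\<beta> w) + i)"]) (simp add: nth_block)
      qed
    next
      case binary
      then show ?thesis using less.prems(2) by (auto simp: middle_infinitely_often_def)
    qed
  qed
  then show ?thesis by (simp add: middle_infinitely_often_def)
qed

end

section \<open>Rigidity\<close>

text \<open>An element of the base \<open>n\<close> analogue of \<open>F\<close> that moves every point beginning with a middle
  letter.\<close>

definition shift_map :: "nat \<Rightarrow> (nat \<Rightarrow> nat) \<Rightarrow> nat \<Rightarrow> nat" where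
  "shift_map n x = (if x 0 = 0 then if x 1 < n - 1 then suffix 1 x else (n - 1) ## 0 ## suffix 2 x
     else (n - 1) ## x)"

definition unshift_map :: "nat \<Rightarrow> (nat \<Rightarrow> nat) \<Rightarrow> nat \<Rightarrow> nat" where
  "unshift_map n x = (if x 0 < n - 1 then 0 ## x else if x 1 = 0 then 0 ## (n - 1) ## suffix 2 x
     else suffix 1 x)"

lemma two_letters:
  "(a ## b ## y) 1 = b" "suffix 1 (a ## y) = y" "suffix 2 (a ## b ## y) = y"
  by (auto simp: One_nat_def suffix_def numeral_2_eq_2)

lemma two_letters_cases:
  fixes x :: "nat \<Rightarrow> nat"
  obtains a b y where "x = a ## b ## y"
  by (metis build_first)

lemma shift_map_simps:
  "shift_map n (a ## b ## y) = (if a = 0 then if b < n - 1 then b ## y else (n - 1) ## 0 ## y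
     else (n - 1) ## a ## b ## y)"
  by (simp add: shift_map_def two_letters)

lemma unshift_map_simps:
  "unshift_map n (a ## b ## y) = (if a < n - 1 then 0 ## a ## b ## y
     else if b = 0 then 0 ## (n - 1) ## y else b ## y)"
  by (simp add: unshift_map_def two_letters)

section \<open>Maps supported on a cone\<close>

definition localize :: "nat \<Rightarrow> nat list \<Rightarrow> ((nat \<Rightarrow> nat) \<Rightarrow> nat \<Rightarrow> nat) \<Rightarrow> dpoint \<Rightarrow> dpoint" where
  "localize n u \<phi> = (\<lambda>p\<in>cantor n 1. if prefix (length u) (snd p) = u
     then (0, u \<frown> \<phi> (suffix (length u) (snd p))) else p)"

lemma localize_inside:
  "u \<in> lists {..<n} \<Longrightarrow> y \<in> undotted_points n \<Longrightarrow> localize n u \<phi> (0, u \<frown> y) = (0, u \<frown> \<phi> y)"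
  by (simp add: localize_def cantor_def)

lemma localize_outside:
  "x \<in> undotted_points n \<Longrightarrow> prefix (length u) x \<noteq> u \<Longrightarrow> localize n u \<phi> (0, x) = (0, x)"
  by (simp add: localize_def cantor_def)

text \<open>Different words of equal length are separated before the tails begin, so changes inside
  a cone cannot affect comparisons with points outside it.\<close>

lemma lexlt_same_length:
  assumes "length u = length v" "u \<noteq> v" "lexlt (u \<frown> x) (v \<frown> y)"
  shows "lexlt (u \<frown> x') (v \<frown> y')"
proof -
  have "\<not> Sublist.prefix u v" "\<not> Sublist.prefix v u"
    using assms(1,2) by (auto simp: Sublist.prefix_def)
  then show ?thesis using lexlt_of_lexord lexord_of_lexlt[OF assms(3)] by blast
qed

definition F_act :: "nat \<Rightarrow> (real \<Rightarrow> real) \<Rightarrow> dpoint \<Rightarrow> dpoint" where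
  "F_act n f = (\<lambda>p\<in>cantor n 1. (0, act n (F_word f) (snd p)))"

lemma carrier_F_group: "carrier F_group = F_set"
  by (simp add: F_group_def)

interpretation F: group F_group
  by (rule group_F)

context
  fixes n :: nat
  assumes n: "3 \<le> n"
begin

lemma shift_map_in: "x \<in> undotted_points n \<Longrightarrow> shift_map n x \<in> undotted_points n"
  using n by (cases x rule: two_letters_cases) (auto simp: shift_map_simps)

lemma unshift_map_in: "x \<in> undotted_points n \<Longrightarrow> unshift_map n x \<in> undotted_points n"
  using n by (cases x rule: two_letters_cases) (auto simp: unshift_map_simps)

lemma unshift_shift: "x \<in> undotted_points n \<Longrightarrow> unshift_map n (shift_map n x) = x"
proof (cases x rule: two_letters_cases)
  case (1 a b y)
  assume "x \<in> undotted_points n"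
  then have "a < n" "b < n" by (simp_all add: 1)
  then show ?thesis
    using n by (cases y rule: two_letters_cases) (auto simp: 1 shift_map_simps unshift_map_simps)
qed

lemma shift_unshift: "x \<in> undotted_points n \<Longrightarrow> shift_map n (unshift_map n x) = x"
proof (cases x rule: two_letters_cases)
  case (1 a b y)
  assume "x \<in> undotted_points n"
  then have "a < n" "b < n" by (simp_all add: 1)
  then show ?thesis
    using n by (cases y rule: two_letters_cases) (auto simp: 1 shift_map_simps unshift_map_simps)
qed

lemma shift_map_mono:
  assumes "x \<in> undotted_points n" "y \<in> undotted_points n" "lexlt x y"
  shows "lexlt (shift_map n x) (shift_map n y)"
proof -
  obtain a b x' c d y' where xy: "x = a ## b ## x'" "y = c ## d ## y'"
    using two_letters_cases[of x] two_letters_cases[of y] by metis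
  then have "a < n" "b < n" "c < n" "d < n" using assms(1,2) by simp_all
  then show ?thesis using assms(3) n by (auto simp: xy shift_map_simps)
qed

lemma localize_shift_in_T:
  assumes u: "u \<in> lists {..<n}"
  shows "localize n u (shift_map n) \<in> T_set n 1"
proof -
  let ?X = "undotted_points n" and ?s = "localize n u (shift_map n)"
  have point_cases: "(\<exists>y\<in>?X. x = u \<frown> y) \<or> prefix (length u) x \<noteq> u" if "x \<in> ?X" for x
    using that prefix_suffix[of x "length u"] suffix_in_undotted_points[OF that, of "length u"] by metis
  have loc_in: "localize n u \<phi> p \<in> cantor n 1"
    if \<phi>: "\<And>y. y \<in> ?X \<Longrightarrow> \<phi> y \<in> ?X" and p: "p \<in> cantor n 1" for \<phi> p
  proof -
    obtain x where x: "p = (0, x)" "x \<in> ?X" using p unfolding cantor_1_iff by blast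
    from point_cases[OF x(2)] show ?thesis
    proof
      assume "\<exists>y\<in>?X. x = u \<frown> y"
      then obtain y where "y \<in> ?X" "x = u \<frown> y" by blast
      then show ?thesis using localize_inside[OF u] \<phi> u by (simp add: x(1) cantor_def)
    next
      assume "prefix (length u) x \<noteq> u"
      then show ?thesis using localize_outside[OF x(2)] p x(1) by metis
    qed
  qed
  have loc_inv: "localize n u \<psi> (localize n u \<phi> p) = p"
    if \<phi>: "\<And>y. y \<in> ?X \<Longrightarrow> \<phi> y \<in> ?X" "\<And>y. y \<in> ?X \<Longrightarrow> \<psi> (\<phi> y) = y" and p: "p \<in> cantor n 1" for \<phi> \<psi> p
  proof -
    obtain x where x: "p = (0, x)" "x \<in> ?X" using p unfolding cantor_1_iff by blast
    from point_cases[OF x(2)] show ?thesis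
    proof
      assume "\<exists>y\<in>?X. x = u \<frown> y"
      then obtain y where "y \<in> ?X" "x = u \<frown> y" by blast
      then show ?thesis using localize_inside[OF u] \<phi> by (simp add: x(1))
    next
      assume "prefix (length u) x \<noteq> u"
      then show ?thesis using localize_outside[OF x(2)] x(1) by metis
    qed
  qed
  have "bij_betw ?s (cantor n 1) (cantor n 1)"
  proof (rule bij_betwI[where g = "localize n u (unshift_map n)"])
    show "?s \<in> cantor n 1 \<rightarrow> cantor n 1" "localize n u (unshift_map n) \<in> cantor n 1 \<rightarrow> cantor n 1"
      using loc_in shift_map_in unshift_map_in by blast+
    show "localize n u (unshift_map n) (?s p) = p" if "p \<in> cantor n 1" for p
      by (rule loc_inv[where \<phi> = "shift_map n" and \<psi> = "unshift_map n", OF shift_map_in unshift_shift that])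
    show "?s (localize n u (unshift_map n) p) = p" if "p \<in> cantor n 1" for p
      by (rule loc_inv[where \<phi> = "unshift_map n" and \<psi> = "shift_map n", OF unshift_map_in shift_unshift that])
  qed
  then have Bij: "?s \<in> Bij (cantor n 1)" by (simp add: Bij_def localize_def)
  \<comment> \<open>\<open>shift_map\<close> reads at most two letters behind
    \<open>u\<close>.\<close>
  have "replaces_long_prefixes n ?s (length u + 2)"
    unfolding replaces_long_prefixes_def
  proof (intro ballI impI)
    fix w assume w: "w \<in> lists {..<n}" "length w = length u + 2"
    show "\<exists>v\<in>lists {..<n}. \<forall>x\<in>?X. ?s (0, w \<frown> x) = (0, v \<frown> x)"
    proof (cases "take (length u) w = u")
      case True
      have "length (drop (length u) w) = Suc (Suc 0)" using w(2) by simp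
      then obtain a b where "drop (length u) w = [a, b]" by (simp only: length_Suc_conv length_0_conv) blast
      then have w_eq: "w = u @ [a, b]" using True append_take_drop_id[of "length u" w] by simp
      then have ab: "a < n" "b < n" using w(1) by simp_all
      define v where "v = u @ (if a = 0 then if b < n - 1 then [b] else [n - 1, 0] else [n - 1, a, b])"
      have "?s (0, w \<frown> x) = (0, v \<frown> x)" if "x \<in> ?X" for x
        using localize_inside[OF u, of "a ## b ## x"] ab that
        by (simp add: w_eq v_def shift_map_simps)
      moreover have "v \<in> lists {..<n}" using u ab n by (simp add: v_def)
      ultimately show ?thesis by blast
    next
      case False
      have "?s (0, w \<frown> x) = (0, w \<frown> x)" if "x \<in> ?X" for x
        using False w that by (intro localize_outside) simp_all
      then show ?thesis using w(1) by blast
    qed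
  qed
  then have G: "?s \<in> G_set n 1" using Bij n G_set_iff[of n ?s] by auto
  have "cyclic_mono n ?s"
  proof (rule cyclic_mono_mono)
    fix x y assume x: "x \<in> ?X" and y: "y \<in> ?X" and xy: "lexlt x y"
    let ?k = "length u"
    have split: "z = prefix ?k z \<frown> suffix ?k z" for z :: "nat \<Rightarrow> nat" by simp
    from point_cases[OF x] point_cases[OF y]
    consider (both) x' y' where "x' \<in> ?X" "y' \<in> ?X" "x = u \<frown> x'" "y = u \<frown> y'"
      | (left) x' where "x' \<in> ?X" "x = u \<frown> x'" "prefix ?k y \<noteq> u"
      | (right) y' where "y' \<in> ?X" "y = u \<frown> y'" "prefix ?k x \<noteq> u"
      | (none) "prefix ?k x \<noteq> u" "prefix ?k y \<noteq> u" by blast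
    then show "lexlt (snd (?s (0, x))) (snd (?s (0, y)))"
    proof cases
      case both
      then show ?thesis using xy shift_map_mono by (simp add: localize_inside[OF u])
    next
      case left
      have "lexlt (u \<frown> x') (prefix ?k y \<frown> suffix ?k y)" using xy left split by metis
      then have "lexlt (u \<frown> shift_map n x') (prefix ?k y \<frown> suffix ?k y)"
        by (rule lexlt_same_length[rotated 2]) (use left(3) in auto)
      then show ?thesis
        using left localize_outside[OF y left(3)] by (simp add: localize_inside[OF u])
    next
      case right
      have "lexlt (prefix ?k x \<frown> suffix ?k x) (u \<frown> y')" using xy right split by metis
      then have "lexlt (prefix ?k x \<frown> suffix ?k x) (u \<frown> shift_map n y')"
        by (rule lexlt_same_length[rotated 2]) (use right(3) in auto)
      then show ?thesis
        using right localize_outside[OF x right(3)] by (simp add: localize_inside[OF u])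
    next
      case none
      then show ?thesis using xy localize_outside[OF x] localize_outside[OF y] by simp
    qed
  qed
  then show ?thesis using G n T_set_iff[of n ?s] by auto
qed

text \<open>If q moved y, some element m of T would move y but fix q y, being supported on a small
  cone around y. Then q (m y) = m (q y) = q y contradicts injectivity.\<close>

lemma centralizer_fixes:
  assumes q: "inj_on q (cantor n 1)" "\<And>p. p \<in> cantor n 1 \<Longrightarrow> q p \<in> cantor n 1"
    and comm: "\<And>m p. m \<in> T_set n 1 \<Longrightarrow> p \<in> cantor n 1 \<Longrightarrow> m (q p) = q (m p)"
    and y: "y \<in> undotted_points n" "middle_infinitely_often n y"
  shows "q (0, y) = (0, y)"
proof (rule ccontr)
  assume neq: "q (0, y) \<noteq> (0, y)"
  have yc: "(0, y) \<in> cantor n 1" using y(1) by (simp add: cantor_def)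
  obtain z where z: "q (0, y) = (0, z)" "z \<in> undotted_points n"
    using q(2)[OF yc] unfolding cantor_1_iff by blast
  then have "z \<noteq> y" using neq by simp
  then obtain d where d: "z d \<noteq> y d" by auto
  \<comment> \<open>Beyond d, so that the cone of the prefix excludes z, and at a middle letter, so
    that \<open>shift_map\<close> moves the rest of y.\<close>
  obtain p where p: "Suc d \<le> p" "middle n (y p)"
    using y(2) unfolding middle_infinitely_often_def by blast
  define u where "u = prefix p y"
  define m where "m = localize n u (shift_map n)"
  have u: "u \<in> lists {..<n}" "length u = p" using prefix_in_lists[OF y(1)] by (simp_all add: u_def)
  have mT: "m \<in> T_set n 1" unfolding m_def by (rule localize_shift_in_T[OF u(1)])
  have "prefix p z ! d \<noteq> u ! d" using d p(1) by (simp add: u_def)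
  then have "prefix (length u) z \<noteq> u" using u(2) by metis
  then have mz: "m (0, z) = (0, z)" unfolding m_def by (rule localize_outside[OF z(2)])
  have y_eq: "y = u \<frown> suffix p y" by (simp add: u_def)
  have "m (0, u \<frown> suffix p y) = (0, u \<frown> shift_map n (suffix p y))"
    unfolding m_def using y(1) by (intro localize_inside[OF u(1)]) simp
  then have my: "m (0, y) = (0, u \<frown> shift_map n (suffix p y))" using y_eq by simp
  have "q (m (0, y)) = q (0, y)" using comm[OF mT yc] z(1) mz by simp
  moreover have "m (0, y) \<in> cantor n 1"
    using my u(1) shift_map_in[of "suffix p y"] y(1) by (simp add: cantor_def)
  ultimately have "m (0, y) = (0, y)" using inj_onD[OF q(1)] yc by blast
  then have "u \<frown> shift_map n (suffix p y) = u \<frown> suffix p y" using my y_eq by simp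
  then have "shift_map n (suffix p y) = suffix p y" by simp
  moreover have "shift_map n (suffix p y) 0 = n - 1"
    using p(2) by (simp add: shift_map_def middle_def)
  ultimately have "y p = n - 1" by simp
  then show False using p(2) by (simp add: middle_def)
qed

section \<open>The action of F on the Cantor space\<close>

lemma F_act_apply: "x \<in> undotted_points n \<Longrightarrow> F_act n f (0, x) = (0, act n (F_word f) x)"
  by (simp add: F_act_def cantor_def)

lemma act_F_word_mult:
  assumes "f \<in> F_set" "g \<in> F_set" "x \<in> undotted_points n"
  shows "act n (F_word g) (act n (F_word f) x) = act n (F_word (f \<otimes>\<^bsub>F_group\<^esub> g)) x"
proof (rule act_compose[OF n])
  have "f \<otimes>\<^bsub>F_group\<^esub> g \<in> F_set" using F.m_closed[of f g] assms by (simp add: carrier_F_group)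
  then show "eventually_prefix (F_word (f \<otimes>\<^bsub>F_group\<^esub> g))" by (rule eventually_prefix_F_word)
qed (use assms in \<open>simp_all add: eventually_prefix_F_word F_word_mult\<close>)

lemma act_F_word_in:
  "f \<in> F_set \<Longrightarrow> x \<in> undotted_points n \<Longrightarrow> act n (F_word f) x \<in> undotted_points n"
  by (rule act_in_undotted_points[OF n eventually_prefix_F_word])

lemma inv_in_F: "f \<in> F_set \<Longrightarrow> inv\<^bsub>F_group\<^esub> f \<in> F_set"
  using F.inv_closed[of f] by (simp add: carrier_F_group)

lemma act_F_word_inv:
  assumes f: "f \<in> F_set" and x: "x \<in> undotted_points n"
  shows "act n (F_word (inv\<^bsub>F_group\<^esub> f)) (act n (F_word f) x) = x"
    and "act n (F_word f) (act n (F_word (inv\<^bsub>F_group\<^esub> f)) x) = x"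
  using act_F_word_mult[OF f inv_in_F[OF f] x] act_F_word_mult[OF inv_in_F[OF f] f x]
    act_id[OF n F_word_one x] f
  by (simp_all add: carrier_F_group)

lemma act_F_word_inj: "f \<in> F_set \<Longrightarrow> inj_on (act n (F_word f)) (undotted_points n)"
  by (rule inj_on_inverseI[where g = "act n (F_word (inv\<^bsub>F_group\<^esub> f))"]) (rule act_F_word_inv)

lemma F_act_Bij:
  assumes f: "f \<in> F_set"
  shows "F_act n f \<in> Bij (cantor n 1)"
proof -
  have "bij_betw (F_act n f) (cantor n 1) (cantor n 1)"
  proof (rule bij_betwI[where g = "F_act n (inv\<^bsub>F_group\<^esub> f)"])
    show "F_act n f \<in> cantor n 1 \<rightarrow> cantor n 1" "F_act n (inv\<^bsub>F_group\<^esub> f) \<in> cantor n 1 \<rightarrow> cantor n 1"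
      using act_F_word_in[OF f] act_F_word_in[OF inv_in_F[OF f]]
      by (auto simp: cantor_1_iff F_act_apply)
    fix p assume "p \<in> cantor n 1"
    then obtain x where "p = (0, x)" "x \<in> undotted_points n" unfolding cantor_1_iff by blast
    then show "F_act n (inv\<^bsub>F_group\<^esub> f) (F_act n f p) = p" "F_act n f (F_act n (inv\<^bsub>F_group\<^esub> f) p) = p"
      using act_F_word_in[OF f] act_F_word_in[OF inv_in_F[OF f]] act_F_word_inv[OF f]
      by (simp_all add: F_act_apply)
  qed
  then show ?thesis by (simp add: Bij_def F_act_def)
qed

text \<open>The conjugate satisfies the equation of \<open>act_conjugate\<close> for the map applied
  last, which is why the inverse of f supplies \<open>\<beta>\<close>.\<close>

lemma F_act_conj_G:
  assumes f: "f \<in> F_set" and g: "g \<in> G_set n 1"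
  shows "compose (cantor n 1) (F_act n (inv\<^bsub>F_group\<^esub> f)) (compose (cantor n 1) g (F_act n f)) \<in> G_set n 1"
    (is "?h \<in> _")
proof -
  have n0: "0 < n" using n by simp
  have gB: "g \<in> Bij (cantor n 1)" using g G_set_subset_Bij[OF n0] by blast
  obtain N where N: "replaces_long_prefixes n g N" using g G_set_iff[OF n0] by blast
  let ?\<beta> = "F_word (inv\<^bsub>F_group\<^esub> f)"
  have "\<exists>N. replaces_long_prefixes n ?h N"
  proof (rule act_conjugate[OF n _ _ N])
    show "eventually_prefix ?\<beta>" by (rule eventually_prefix_F_word[OF inv_in_F[OF f]])
    show "\<exists>y\<in>undotted_points n. act n ?\<beta> y = z" if "z \<in> undotted_points n" for z
      using act_F_word_inv(1)[OF f that] act_F_word_in[OF f that] by blast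
    fix x assume x: "x \<in> undotted_points n"
    have 1: "act n ?\<beta> x \<in> undotted_points n" by (rule act_F_word_in[OF inv_in_F[OF f] x])
    have "F_act n f (0, act n ?\<beta> x) = (0, x)"
      using F_act_apply[OF 1] act_F_word_inv(2)[OF f x] by simp
    then have "?h (0, act n ?\<beta> x) = F_act n (inv\<^bsub>F_group\<^esub> f) (g (0, x))"
      using 1 by (simp add: compose_def cantor_def)
    also have "\<dots> = (0, act n ?\<beta> (snd (g (0, x))))"
      using Bij_cantor_base(2,3)[OF gB x] F_act_apply by metis
    finally show "?h (0, act n ?\<beta> x) = (0, act n ?\<beta> (snd (g (0, x))))" .
  qed
  moreover have "?h \<in> Bij (cantor n 1)"
    by (intro compose_Bij F_act_Bij gB f inv_in_F)
  ultimately show ?thesis using G_set_iff[OF n0] by blast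
qed

lemma F_act_cyclic_mono:
  assumes f: "f \<in> F_set"
  shows "cyclic_mono n (F_act n f)"
proof (rule cyclic_mono_mono)
  fix x y assume "x \<in> undotted_points n" "y \<in> undotted_points n" "lexlt x y"
  then show "lexlt (snd (F_act n f (0, x))) (snd (F_act n f (0, y)))"
    using act_mono[OF n eventually_prefix_F_word[OF f] F_word_mono[OF f] act_F_word_inj[OF f]]
    by (simp add: F_act_apply)
qed

lemma F_act_conj_T:
  assumes f: "f \<in> F_set" and g: "g \<in> T_set n 1"
  shows "compose (cantor n 1) (F_act n (inv\<^bsub>F_group\<^esub> f)) (compose (cantor n 1) g (F_act n f)) \<in> T_set n 1"
proof -
  have n0: "0 < n" using n by simp
  have g': "g \<in> G_set n 1" "cyclic_mono n g" "g \<in> Bij (cantor n 1)"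
    using g T_set_iff[OF n0] T_set_subset_Bij[OF n0] by blast+
  have "cyclic_mono n (compose (cantor n 1) (F_act n (inv\<^bsub>F_group\<^esub> f)) (compose (cantor n 1) g (F_act n f)))"
    by (intro cyclic_mono_compose F_act_cyclic_mono compose_Bij F_act_Bij f g' inv_in_F)
  then show ?thesis using F_act_conj_G[OF f g'(1)] T_set_iff[OF n0] by blast
qed

text \<open>By \<open>comm\<close> the map \<open>F_act n f\<close> after g centralises T, so it
  fixes all points with infinitely many middle letters. Choose a word s that g replaces by v. Then
  the action sends v 1 x to s 1 x; by \<open>act_word_middle\<close> it also sends v 1 x to q 1
  followed by the image of x.\<close>

lemma F_act_faithful:
  assumes f: "f \<in> F_set" and g: "g \<in> G_set n 1"
    and comm: "\<And>m p. m \<in> T_set n 1 \<Longrightarrow> p \<in> cantor n 1 \<Longrightarrow> m (F_act n f (g p)) = F_act n f (g (m p))"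
  shows "f = \<one>\<^bsub>F_group\<^esub>"
proof -
  let ?X = "undotted_points n" and ?h = "act n (F_word f)"
  have n0: "0 < n" using n by simp
  have gB: "g \<in> Bij (cantor n 1)" using g G_set_subset_Bij[OF n0] by blast
  obtain N where N: "replaces_long_prefixes n g N" using g G_set_iff[OF n0] by blast
  note fB = F_act_Bij[OF f]
  have q: "compose (cantor n 1) (F_act n f) g \<in> Bij (cantor n 1)" by (rule compose_Bij[OF fB gB])
  have fixed: "?h (snd (g (0, y))) = y" if y: "y \<in> ?X" "middle_infinitely_often n y" for y
  proof -
    have "F_act n f (g (0, y)) = (0, y)"
    proof (rule centralizer_fixes[where q = "\<lambda>p. F_act n f (g p)"])
      show "inj_on (\<lambda>p. F_act n f (g p)) (cantor n 1)"
      proof (rule inj_on_cong[THEN iffD1])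
        show "inj_on (compose (cantor n 1) (F_act n f) g) (cantor n 1)"
          using q by (simp add: Bij_def bij_betw_def)
      qed (simp add: compose_def)
      show "F_act n f (g p) \<in> cantor n 1" if "p \<in> cantor n 1" for p
        using that Bij_imp_funcset[OF fB] Bij_imp_funcset[OF gB] by blast
    qed (use comm y in auto)
    then show ?thesis using Bij_cantor_base(2,3)[OF gB y(1)] F_act_apply by (metis snd_conv)
  qed
  \<comment> \<open>Long enough to be replaced by \<open>g\<close>.\<close>
  define s where "s = replicate N (1::nat)"
  have s: "s \<in> lists {..<n}" "N \<le> length s" using n by (auto simp: s_def lists_eq_set)
  obtain v where v: "v \<in> lists {..<n}" "\<forall>x\<in>?X. g (0, s \<frown> x) = (0, v \<frown> x)"
    by (rule replaces_long_prefixesD[OF N s])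
  have m1: "middle n 1" by (rule middle_1[OF n])
  obtain q where q: "q \<in> lists {..<n}" "\<forall>y. ?h (v \<frown> 1 ## y) = q \<frown> 1 ## ?h y"
    using act_word_middle[OF n v(1) m1] by blast
  have m_conc: "middle_infinitely_often n (w \<frown> x)" if x: "middle_infinitely_often n x" for w x
    unfolding middle_infinitely_often_def
  proof
    fix k
    obtain i where "k \<le> i" "middle n (x i)" using x unfolding middle_infinitely_often_def by blast
    then show "\<exists>i\<ge>k. middle n ((w \<frown> x) i)" by (intro exI[of _ "length w + i"]) simp
  qed
  have eq: "(q @ [1]) \<frown> ?h x = (s @ [1]) \<frown> x" if x: "x \<in> ?X" "middle_infinitely_often n x" for x
  proof -
    have 1: "1 ## x \<in> ?X" using x n by simp
    have "?h (snd (g (0, (s @ [1]) \<frown> x))) = (s @ [1]) \<frown> x"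
      using x s n by (intro fixed m_conc) simp_all
    then show ?thesis using v(2) 1 q(2) by simp
  qed
  let ?one = "\<lambda>_. 1 :: nat"
  have one: "?one \<in> ?X" "middle_infinitely_often n ?one"
    using n m1 by (auto simp: undotted_points_iff middle_infinitely_often_def)
  \<comment> \<open>\<open>?one\<close> and \<open>0 ## ?one\<close> differ in their first letter;
    they refute that all test points begin alike.\<close>
  have zero_one: "0 ## ?one \<in> ?X" "middle_infinitely_often n (0 ## ?one)"
    using one m_conc[OF one(2), of "[0]"] n by simp_all
  have h_id: "?h x = x" if x: "x \<in> ?X" "middle_infinitely_often n x" for x
  \<comment> \<open>By \<open>eq\<close> one of the words q 1 and s 1 extends the other by a word r
    that does not depend on x. So either \<open>?h x = r \<frown> x\<close> for all test points or
    \<open>x = r \<frown> ?h x\<close> for all of them.\<close>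
  proof (cases "length q \<le> length s")
    case True
    obtain r where r: "\<And>x. x \<in> ?X \<Longrightarrow> middle_infinitely_often n x \<Longrightarrow> ?h x = r \<frown> x"
    proof -
      have "length (q @ [1]) \<le> length (s @ [1])" using True by simp
      then obtain r where r: "s @ [1] = (q @ [1]) @ r"
        using eq[OF one] conc_eq_conc_cases by metis
      have "?h x = r \<frown> x" if "x \<in> ?X" "middle_infinitely_often n x" for x
        using eq[OF that] unfolding r by (metis conc_conc same_concat_eq)
      then show thesis by (rule that)
    qed
    \<comment> \<open>The action maps the test points onto themselves, as that of the inverse of f
      preserves them too. A nonempty r would give all of them the same first letter.\<close>
    have "r = []"
    proof (rule ccontr)
      assume "r \<noteq> []"
      then obtain c r' where c: "r = c # r'" by (cases r) auto
      define y where "y = (if c = 0 then ?one else 0 ## ?one)"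
      have y: "y \<in> ?X" "middle_infinitely_often n y" "y 0 \<noteq> c"
        using one zero_one by (auto simp: y_def)
      let ?y = "act n (F_word (inv\<^bsub>F_group\<^esub> f)) y"
      have "?y \<in> ?X" "middle_infinitely_often n ?y" "?h ?y = y"
        using act_F_word_in[OF inv_in_F[OF f] y(1)] act_F_word_inv(2)[OF f y(1)]
          act_middle_infinitely_often[OF n eventually_prefix_F_word[OF inv_in_F[OF f]] y(1,2)] by auto
      then have "y = r \<frown> ?y" using r[of ?y] by simp
      then have "y 0 = c" by (metis c build_cons build.simps(1))
      then show False using y(3) by simp
    qed
    then show ?thesis using r[OF x] by simp
  next
    case False
    have "length (s @ [1]) \<le> length (q @ [1])" using False by simp
    then obtain r where r: "q @ [1] = (s @ [1]) @ r"
      using eq[OF one, symmetric] conc_eq_conc_cases by metis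
    have rx: "x = r \<frown> ?h x" if "x \<in> ?X" "middle_infinitely_often n x" for x
      using eq[OF that] unfolding r by (metis conc_conc same_concat_eq)
    \<comment> \<open>Here q is longer than s, so r is nonempty and every test point would begin
      with c.\<close>
    obtain c r' where c: "r = c # r'" using False r by (cases r) auto
    have "x 0 = c" if "x \<in> ?X" "middle_infinitely_often n x" for x
      using rx[OF that] by (metis c build_cons build.simps(1))
    from this[OF one] this[OF zero_one] have False by simp
    then show ?thesis ..
  qed
  \<comment> \<open>\<open>F_word f w\<close> is read off from the first block of the image of w 1 1
    1 ..., a test point.\<close>
  have "F_word f w = w" for w
  proof -
    let ?x = "enc n w \<frown> 1 ## ?one"
    have x: "?x \<in> ?X" "middle_infinitely_often n ?x"
      using n one m_conc[OF one(2), of "enc n w @ [1]"] by (simp_all add: enc_in_lists[OF n])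
    have "enc n (F_word f w) \<frown> 1 ## ?h ?one = ?x"
      using h_id[OF x] act_block[OF n m1, of "F_word f" w ?one] by simp
    then show ?thesis using block_eq_iff[OF n m1 m1] by blast
  qed
  then show ?thesis by (rule F_word_faithful[OF f])
qed

text \<open>Serves both groups: the conjugator is used through its membership in G, and commutation
  is used only for elements of T.\<close>

lemma contains_copy_of_F:
  assumes M: "group (right_action_group (cantor n 1) M)" "T_set n 1 \<subseteq> M" "M \<subseteq> G_set n 1"
    and conj: "\<And>f g. f \<in> F_set \<Longrightarrow> g \<in> M \<Longrightarrow>
      compose (cantor n 1) (F_act n (inv\<^bsub>F_group\<^esub> f)) (compose (cantor n 1) g (F_act n f)) \<in> M"
  shows "contains_copy_of (Out (right_action_group (cantor n 1) M)) F_group"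
proof (rule contains_copy_of_Out_conjugation[OF M(1) _ group_F])
  show "M \<subseteq> Bij (cantor n 1)" using M(3) G_set_subset_Bij[of n] n by simp
  show "F_act n k \<in> Bij (cantor n 1)" if "k \<in> carrier F_group" for k
    using that F_act_Bij by (simp add: carrier_F_group)
  show "F_act n (k \<otimes>\<^bsub>F_group\<^esub> l) p = F_act n l (F_act n k p)"
    if "k \<in> carrier F_group" "l \<in> carrier F_group" and p: "p \<in> cantor n 1" for k l p
  proof -
    obtain x where "p = (0, x)" "x \<in> undotted_points n" using p unfolding cantor_1_iff by blast
    then show ?thesis
      using that(1,2) act_F_word_mult act_F_word_in by (simp add: carrier_F_group F_act_apply)
  qed
  show "F_act n \<one>\<^bsub>F_group\<^esub> p = p" if p: "p \<in> cantor n 1" for p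
  proof -
    obtain x where "p = (0, x)" "x \<in> undotted_points n" using p unfolding cantor_1_iff by blast
    then show ?thesis using act_id[OF n F_word_one] by (simp add: F_act_apply)
  qed
  show "compose (cantor n 1) (F_act n (inv\<^bsub>F_group\<^esub> k)) (compose (cantor n 1) m (F_act n k)) \<in> M"
    if "k \<in> carrier F_group" "m \<in> M" for k m
    using conj that by (simp add: carrier_F_group)
  show "k = \<one>\<^bsub>F_group\<^esub>" if k: "k \<in> carrier F_group" and g: "g \<in> M"
    and comm: "\<And>m x. m \<in> M \<Longrightarrow> x \<in> cantor n 1 \<Longrightarrow> m (F_act n k (g x)) = F_act n k (g (m x))" for k g
  proof (rule F_act_faithful)
    show "k \<in> F_set" using k by (simp add: carrier_F_group)
    show "g \<in> G_set n 1" using g M(3) by blast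
    show "m (F_act n k (g p)) = F_act n k (g (m p))" if "m \<in> T_set n 1" "p \<in> cantor n 1" for m p
      using comm that M(2) by blast
  qed
qed

end

theorem theorem1p7:
  fixes n :: nat
  assumes "n \<ge> 3"
  shows "contains_copy_of (Out (T_group n 1)) F_group \<and>
         contains_copy_of (Out (G_group n 1)) F_group"
proof
  have n0: "0 < n" using assms by simp
  have TG: "T_set n 1 \<subseteq> G_set n 1" by (auto simp: T_set_def)
  show "contains_copy_of (Out (T_group n 1)) F_group"
    using contains_copy_of_F[OF assms, of "T_set n 1"] group_T[OF n0] TG F_act_conj_T[OF assms]
    unfolding T_group_def by blast
  show "contains_copy_of (Out (G_group n 1)) F_group"
    using contains_copy_of_F[OF assms, of "G_set n 1"] group_G[OF n0] TG F_act_conj_G[OF assms]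
    unfolding G_group_def by blast
qed

end
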